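(* Let $\lambda=\alpha+i\beta$ with $\alpha,\beta\in\mathbb{R}$, $|\alpha|<\tfrac12$, and let $\epsilon\in\{0,1\}$. For all $a,b\in\mathbb{R}^+$, $$\|\pi_{\lambda,\epsilon,a,b}\|_{\mathrm{ub}}\ \ge\ \|\pi_{\lambda,\epsilon}\|_{\mathrm{ub}}=\max\{\|q_{0,\epsilon}\|_\infty,\|q_{1,\epsilon}\|_\infty\},$$ where $q_{0,\epsilon}$ and $q_{1,\epsilon}$ are the functions on $\mathbb{R}$ defined in the context (depending on $\lambda$).
   Context: A representation $\pi$ of a locally compact group $G$ is always a continuous representation by linear operators on a (complex) Hilbert space $\mathcal{H}_\pi$. It is uniformly bounded if each $\pi(x)$ is bounded and there is a constant $C\ge1$ with $C^{-1}\|\xi\|\le\|\pi(x)\xi\|\le C\|\xi\|$ for all $x\in G$, $\xi\in\mathcal{H}_\pi$; the smallest such $C$ is denoted $\|\pi\|_{\mathrm{ub}}$. Write $\mathbb{R}^+=(0,\infty)$ and $\hat f(r)=\int_{\mathbb{R}}f(t)e^{-itr}\,dt$. For $\alpha\in(-\tfrac12,\tfrac12)$, $\mathcal{H}_\alpha$ is the completion of $C_c^\infty(\mathbb{R})$ in the norm $\|f\|_{\mathcal{H}_\alpha}=\left(\int_{\mathbb{R}}\big||r|^\alpha\hat f(r)\big|^2\,dr\right)^{1/2}$. For $a,b\in\mathbb{R}^+$, $\mathcal{H}_{\alpha,a,b}$ is the same space with the equivalent Hilbert norm $$\|f\|_{\mathcal{H}_{\alpha,a,b}}=\left(a\int_0^\infty\big||r|^\alpha\hat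 f(r)\big|^2dr+b\int_{-\infty}^0\big||r|^\alpha\hat f(r)\big|^2dr\right)^{1/2}.$$ For $\lambda\in\mathbb{C}$ with $\alpha=\operatorname{Re}\lambda\in(-\tfrac12,\tfrac12)$ and $\epsilon\in\{0,1\}$, the (Kunze--Stein) representation $\pi_{\lambda,\epsilon}$ of $\mathrm{SL}(2,\mathbb{R})$ on $\mathcal{H}_\alpha$ is the one given (first for $f\in C_c^\infty(\mathbb{R})$, then by continuous extension to $\mathcal{H}_\alpha$) by $$\pi_{\lambda,\epsilon}(x)f(t)=\operatorname{sgn}^\epsilon(x_{11}+tx_{21})\,|x_{11}+tx_{21}|^{2\lambda-1}\,f\!\left(\frac{x_{12}+x_{22}t}{x_{11}+x_{21}t}\right),\qquad x=\begin{pmatrix} x_{11} & x_{12} \\ x_{21} & x_{22} \end{pmatrix}.$$ It is a uniformly bounded representation. $\pi_{\lambda,\epsilon,a,b}$ denotes the same representation acting on $\mathcal{H}_{\alpha,a,b}$ where $\alpha=\operatorname{Re}\lambda$. For $u\in\mathbb{R}$ set $$m_{0,\alpha}(u)=\sqrt{2\pi}\,2^{\alpha+iu}\,\frac{\Gamma\left(\frac14+\frac{\alpha+iu}2\right)}{\Gamma\left(\frac14-\frac{\alpha+iu}2\right)},\qquad m_{1,\alpha}(u)=i\sqrt{2\pi}\,2^{\alpha+iu}\,\frac{\Gamma\left(\frac34+\frac{\alpha+iu}2\right)}{\Gamma\left(\frac34-\frac{\alpha+iu}2\right)},$$ and, for $\lambda=\alpha+i\beta$, $$q_{0,\epsilon}(u)=\frac{m_{0,\alpha}(2\beta-u)}{m_{\epsilon,\alpha}(u)},\qquad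 q_{1,\epsilon}(u)=-\frac{m_{1,\alpha}(2\beta-u)}{m_{1-\epsilon,\alpha}(u)}.$$ $\|\cdot\|_\infty$ is the norm of $L^\infty(\mathbb{R})$. *)

theory Defs
  imports "HOL-Analysis.Analysis" "HOL-Probability.Essential_Supremum"
begin

definition SL2R :: "(real^2^2) set" where
  "SL2R = {x. det x = 1}"

(* The space C_c^infinity(R) of complex-valued functions; D n is the n-th derivative of f. *)
definition test_fun :: "(real \<Rightarrow> complex) \<Rightarrow> bool" where
  "test_fun f \<longleftrightarrow>
     (\<exists>D. D 0 = f \<and> (\<forall>n t. (D n has_vector_derivative D (Suc n) t) (at t))) \<and>
     compact (closure {t. f t \<noteq> 0})"

definition fourier :: "(real \<Rightarrow> complex) \<Rightarrow> real \<Rightarrow> complex" where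
  "fourier f r = (LINT t|lborel. f t * exp (- (\<i> * of_real t * of_real r)))"

definition test_norm :: "real \<Rightarrow> (real \<Rightarrow> complex) \<Rightarrow> real" where
  "test_norm \<alpha> f =
     sqrt (LINT r|lborel. (norm (of_real (\<bar>r\<bar> powr \<alpha>) * fourier f r))\<^sup>2)"

definition test_norm_ab :: "real \<Rightarrow> real \<Rightarrow> real \<Rightarrow> (real \<Rightarrow> complex) \<Rightarrow> real" where
  "test_norm_ab \<alpha> a b f =
     sqrt (a * (LINT r:{0<..}|lborel. (norm (of_real (\<bar>r\<bar> powr \<alpha>) * fourier f r))\<^sup>2) +
           b * (LINT r:{..<0}|lborel. (norm (of_real (\<bar>r\<bar> powr \<alpha>) * fourier f r))\<^sup>2))"

(* Distributions are represented as functionals on test functions, extended by 0 to all other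
   functions so that equality of functionals is equality of distributions. *)
type_synonym distribution = "(real \<Rightarrow> complex) \<Rightarrow> complex"

definition distr_of :: "(real \<Rightarrow> complex) \<Rightarrow> distribution" where
  "distr_of f = (\<lambda>\<phi>. if test_fun \<phi> then (LINT t|lborel. f t * \<phi> t) else 0)"

(* The completion H_alpha is realised inside the distributions: its elements are the
   distributional limits of the sequences of test functions that are Cauchy in the
   H_alpha norm.  For |alpha| < 1/2 the map from the abstract completion (Cauchy sequences
   modulo null sequences) to the distributions is well defined and injective: the Fourier
   transforms of such a sequence converge in L^2(|r|^(2 alpha) dr), and every test function
   has Fourier transform in the dual space L^2(|r|^(-2 alpha) dr).  The realisation gives a
   meaning to the statement that a function which is not compactly supported, such as
   ks_fun s \<epsilon> x f below, is an element of H_alpha. *)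
definition H_approx :: "real \<Rightarrow> (nat \<Rightarrow> real \<Rightarrow> complex) \<Rightarrow> distribution \<Rightarrow> bool" where
  "H_approx \<alpha> f u \<longleftrightarrow>
     (\<forall>n. test_fun (f n)) \<and>
     (\<forall>e>0. \<exists>N. \<forall>m\<ge>N. \<forall>n\<ge>N. test_norm \<alpha> (\<lambda>t. f m t - f n t) < e) \<and>
     (\<forall>\<phi>. (\<lambda>n. distr_of (f n) \<phi>) \<longlonglongrightarrow> u \<phi>)"

definition H_space :: "real \<Rightarrow> distribution set" where
  "H_space \<alpha> = {u. \<exists>f. H_approx \<alpha> f u}"

(* Extension by continuity of a norm on test functions (dominated by a multiple of
   test_norm \<alpha>) to H_alpha. *)
definition H_extend :: "real \<Rightarrow> ((real \<Rightarrow> complex) \<Rightarrow> real) \<Rightarrow> distribution \<Rightarrow> real" where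
  "H_extend \<alpha> N u = (THE c. \<exists>f. H_approx \<alpha> f u \<and> (\<lambda>n. N (f n)) \<longlonglongrightarrow> c)"

definition H_norm :: "real \<Rightarrow> distribution \<Rightarrow> real" where
  "H_norm \<alpha> = H_extend \<alpha> (test_norm \<alpha>)"

definition H_norm_ab :: "real \<Rightarrow> real \<Rightarrow> real \<Rightarrow> distribution \<Rightarrow> real" where
  "H_norm_ab \<alpha> a b = H_extend \<alpha> (test_norm_ab \<alpha> a b)"

(* At the only possible t with x11 + t x21 = 0 the value is 0, because 0 powr _ = 0; for a
   test function f this is the value that makes the result smooth. *)
definition ks_fun ::
    "complex \<Rightarrow> nat \<Rightarrow> real^2^2 \<Rightarrow> (real \<Rightarrow> complex) \<Rightarrow> real \<Rightarrow> complex" where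
  "ks_fun s \<epsilon> x f t =
     of_real (sgn (x$1$1 + t * x$2$1) ^ \<epsilon>) *
     of_real \<bar>x$1$1 + t * x$2$1\<bar> powr (2 * s - 1) *
     f ((x$1$2 + x$2$2 * t) / (x$1$1 + x$2$1 * t))"

(* The Kunze-Stein representation: the continuous extension of distr_of f \<mapsto> distr_of (ks_fun s \<epsilon> x f)
   from test functions to H_alpha, alpha = Re s. *)
definition ks_rep :: "complex \<Rightarrow> nat \<Rightarrow> real^2^2 \<Rightarrow> distribution \<Rightarrow> distribution" where
  "ks_rep s \<epsilon> x u =
     (THE v. v \<in> H_space (Re s) \<and>
        (\<exists>f. H_approx (Re s) f u \<and>
             (\<forall>n. distr_of (ks_fun s \<epsilon> x (f n)) \<in> H_space (Re s)) \<and>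
             (\<lambda>n. H_norm (Re s) (\<lambda>\<phi>. distr_of (ks_fun s \<epsilon> x (f n)) \<phi> - v \<phi>)) \<longlonglongrightarrow> 0))"

(* The smallest uniform bound of a representation \<pi> of G on the space H with norm N;
   it is infinite exactly if \<pi> is not uniformly bounded. *)
definition ub_norm :: "'g set \<Rightarrow> 'h set \<Rightarrow> ('h \<Rightarrow> real) \<Rightarrow> ('g \<Rightarrow> 'h \<Rightarrow> 'h) \<Rightarrow> ereal" where
  "ub_norm G H N \<pi> =
     Inf (ereal ` {C. 1 \<le> C \<and>
       (\<forall>x\<in>G. \<forall>\<xi>\<in>H. inverse C * N \<xi> \<le> N (\<pi> x \<xi>) \<and> N (\<pi> x \<xi>) \<le> C * N \<xi>)})"

definition m_fun :: "nat \<Rightarrow> real \<Rightarrow> real \<Rightarrow> complex" where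
  "m_fun k \<alpha> u =
     (if k = 0
      then of_real (sqrt (2 * pi)) * 2 powr Complex \<alpha> u *
           (Gamma (1/4 + Complex \<alpha> u / 2) / Gamma (1/4 - Complex \<alpha> u / 2))
      else \<i> * of_real (sqrt (2 * pi)) * 2 powr Complex \<alpha> u *
           (Gamma (3/4 + Complex \<alpha> u / 2) / Gamma (3/4 - Complex \<alpha> u / 2)))"

definition q0 :: "real \<Rightarrow> real \<Rightarrow> nat \<Rightarrow> real \<Rightarrow> complex" where
  "q0 \<alpha> \<beta> \<epsilon> u = m_fun 0 \<alpha> (2 * \<beta> - u) / m_fun \<epsilon> \<alpha> u"

definition q1 :: "real \<Rightarrow> real \<Rightarrow> nat \<Rightarrow> real \<Rightarrow> complex" where
  "q1 \<alpha> \<beta> \<epsilon> u = - (m_fun 1 \<alpha> (2 * \<beta> - u) / m_fun (1 - \<epsilon>) \<alpha> u)"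

definition Linf_norm :: "(real \<Rightarrow> complex) \<Rightarrow> ereal" where
  "Linf_norm q = esssup lborel (\<lambda>u. ereal (norm (q u)))"

end

theory Submission
  imports Defs "HOL-Computational_Algebra.Polynomial" "HOL-Probability.Characteristic_Functions"
begin

text \<open>
  The matrices whose lower left entry \<open>c\<close> is nonzero form a single double coset \<open>P w P\<close> of the upper
  triangular group \<open>P\<close>, and \<open>P\<close> acts by isometries of \<open>H_alpha\<close>: it acts by translations, which
  multiply the Fourier transform by a phase, and by dilations, whose effect on the norm is cancelled by
  the character in front.  So the uniform bound of the representation is the norm of a single operator,
  the inversion \<open>W g(t) = sgn(t)^epsilon |t|^(2 lambda - 1) g(-1/t)\<close>; its square is plus or minus the
  identity, so that the lower bound in the definition of the uniform bound comes for free
  (\<open>ks_fun_bruhat\<close>, \<open>ks_norm_bounds\<close>).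

  The norm of \<open>W\<close> is read off in Mellin coordinates.  On the half-lines with \<open>t = exp x\<close> or
  \<open>t = - exp x\<close>, inversion is the reflection of \<open>x\<close>; hence on the Fourier side in \<open>x\<close> it maps
  \<open>u\<close> to \<open>2 beta - u\<close>, keeping or exchanging even and odd parts according to \<open>epsilon\<close>.  The norm of
  \<open>H_alpha\<close>, on the other hand, is a weighted \<open>L^2\<close> norm in the dual variable \<open>r\<close>.
  Plancherel's theorem in the logarithm of \<open>|r|\<close>, together with the local functional equation that
  relates the Mellin transforms of \<open>f\<close> and of its Fourier transform, turns it into
  \<open>1/(4 pi)\<close> times the sum over \<open>k = 0, 1\<close> of the integrals of
  \<open>|m_k(u)|^2 |F_k(u)|^2\<close>, where \<open>F_k\<close> is the Mellin transform of the even or odd part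
  (\<open>mellin_plancherel\<close>).  Therefore \<open>W\<close> is unitarily equivalent to multiplication by \<open>q_0\<close> and
  \<open>q_1\<close>, up to a reflection of the line.  The upper bound by the suprema of \<open>q_0\<close> and \<open>q_1\<close> is immediate
  (\<open>inversion_norm_le\<close>); the lower bound tests \<open>W\<close> on wave packets that concentrate at one frequency
  (\<open>bound_imp_q_bound\<close>).

  All of this happens on test functions.  Passing to the completion needs three facts.  A Cauchy sequence
  of test functions that tends to 0 as a distribution tends to 0 in norm
  (\<open>distribution_null_imp_norm_null\<close>): the norm is the integral of a square function built from the
  values of the distribution at test functions, to which Fatou's lemma applies.  Test functions are
  bounded functionals (\<open>pairing_bound\<close>), so Cauchy sequences converge as distributions.  And
  every test function is a limit of test functions that vanish near the point that the matrix moves to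
  infinity (\<open>admissible_approximation\<close>); on these the operators stay within the test functions.  The
  operators are bounded because \<open>q_0\<close> and \<open>q_1\<close> are (\<open>abs_m_bounded_ratio\<close>), so that they extend
  (\<open>ks_rep_approx\<close>).

  The inequality for the weights \<open>a\<close> and \<open>b\<close> is an averaging argument.  The reflection of the real line
  exchanges the two weights and conjugates the representation by the automorphism that negates the
  off-diagonal entries, so a uniform bound for the weights \<open>(a, b)\<close> is one for \<open>(b, a)\<close>.  The squares of
  these two norms add up to \<open>a + b\<close> times the square of the unweighted norm
  (\<open>weighted_bound_imp_bound\<close>).
\<close>

section \<open>Smooth functions and test functions\<close>

definition smooth :: "(real \<Rightarrow> complex) \<Rightarrow> bool" where
  "smooth f \<longleftrightarrow> (\<exists>D. D 0 = f \<and> (\<forall>n t. (D n has_vector_derivative D (Suc n) t) (at t)))"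

text \<open>A whole sequence of derivatives is produced by differentiating again and again, so smoothness follows
  from a class of functions that is closed under one derivative.\<close>

lemma smooth_coinduct:
  assumes "P f"
    and step: "\<And>f. P f \<Longrightarrow> \<exists>f'. P f' \<and> (\<forall>t. (f has_vector_derivative f' t) (at t))"
  shows "smooth f"
proof -
  obtain d where d: "\<And>f. P f \<Longrightarrow> P (d f) \<and> (\<forall>t. (f has_vector_derivative d f t) (at t))"
    using step by metis
  have P: "P ((d ^^ n) f)" for n
    by (induction n) (use \<open>P f\<close> d in auto)
  show ?thesis
    unfolding smooth_def
    by (rule exI[of _ "\<lambda>n. (d ^^ n) f"]) (use P d in auto)
qed

lemma smooth_has_derivative:
  assumes "smooth f"
  obtains f' where "smooth f'" "\<And>t. (f has_vector_derivative f' t) (at t)"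
proof -
  obtain D where D: "D 0 = f" "\<And>n t. (D n has_vector_derivative D (Suc n) t) (at t)"
    using assms unfolding smooth_def by blast
  have "smooth (D 1)"
    unfolding smooth_def by (rule exI[of _ "\<lambda>n. D (Suc n)"]) (use D in auto)
  then show ?thesis using that D by (metis One_nat_def)
qed

lemma smooth_antiderivative:
  assumes "smooth f'" "\<And>t. (f has_vector_derivative f' t) (at t)"
  shows "smooth f"
  by (rule smooth_coinduct[where P = "\<lambda>g. g = f \<or> smooth g"])
     (use assms in \<open>auto intro: smooth_has_derivative\<close>)

lemma smooth_continuous: "smooth f \<Longrightarrow> continuous_on A f"
  by (meson continuous_at_imp_continuous_on has_vector_derivative_continuous smooth_has_derivative)

inductive sum_of :: "((real \<Rightarrow> complex) \<Rightarrow> bool) \<Rightarrow> (real \<Rightarrow> complex) \<Rightarrow> bool" for B where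
  base: "B f \<Longrightarrow> sum_of B f"
| add: "sum_of B f \<Longrightarrow> sum_of B g \<Longrightarrow> sum_of B (\<lambda>t. f t + g t)"

text \<open>Products, and the singular powers below, are closed under derivatives only up to finite sums.\<close>

lemma smooth_sum_of:
  assumes "sum_of B f"
    and step: "\<And>f. B f \<Longrightarrow> \<exists>f'. sum_of B f' \<and> (\<forall>t. (f has_vector_derivative f' t) (at t))"
  shows "smooth f"
proof (rule smooth_coinduct[where P = "sum_of B"])
  show "sum_of B f" by fact
  fix g assume "sum_of B g"
  then show "\<exists>g'. sum_of B g' \<and> (\<forall>t. (g has_vector_derivative g' t) (at t))"
  proof induction
    case (base f)
    then show ?case by (rule step)
  next
    case (add f g)
    then obtain f' g' where "sum_of B f'" "sum_of B g'"
        "\<And>t. (f has_vector_derivative f' t) (at t)" "\<And>t. (g has_vector_derivative g' t) (at t)"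
      by blast
    then show ?case
      by (intro exI[of _ "\<lambda>t. f' t + g' t"] conjI allI has_vector_derivative_add sum_of.add)
  qed
qed

lemma smooth_add:
  assumes "smooth f" "smooth g"
  shows "smooth (\<lambda>t. f t + g t)"
proof (rule smooth_sum_of[where B = smooth])
  show "sum_of smooth (\<lambda>t. f t + g t)"
    using assms by (intro sum_of.intros)
  show "\<exists>f'. sum_of smooth f' \<and> (\<forall>t. (f has_vector_derivative f' t) (at t))" if "smooth f" for f
    using smooth_has_derivative[OF that] sum_of.base by metis
qed

lemma smooth_mult:
  assumes "smooth f" "smooth g"
  shows "smooth (\<lambda>t. f t * g t)"
proof (rule smooth_sum_of[where B = "\<lambda>h. \<exists>f g. smooth f \<and> smooth g \<and> h = (\<lambda>t. f t * g t)"])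
  fix h assume "\<exists>f g. smooth f \<and> smooth g \<and> h = (\<lambda>t. f t * g t)"
  then obtain f g where fg: "smooth f" "smooth g" and h: "h = (\<lambda>t. f t * g t)" by blast
  obtain f' g' where d: "smooth f'" "smooth g'"
      "\<And>t. (f has_vector_derivative f' t) (at t)" "\<And>t. (g has_vector_derivative g' t) (at t)"
    using fg by (metis smooth_has_derivative)
  let ?h' = "\<lambda>t. f t * g' t + f' t * g t"
  show "\<exists>h'. sum_of (\<lambda>h. \<exists>f g. smooth f \<and> smooth g \<and> h = (\<lambda>t. f t * g t)) h' \<and>
          (\<forall>t. (h has_vector_derivative h' t) (at t))"
    unfolding h
    by (rule exI[of _ ?h'], intro conjI sum_of.add sum_of.base)
       (use fg d in \<open>auto intro: has_vector_derivative_mult\<close>)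
qed (use assms in \<open>auto intro: sum_of.base\<close>)

lemma smooth_const: "smooth (\<lambda>t. c)"
  by (rule smooth_coinduct[where P = "\<lambda>f. \<exists>c. f = (\<lambda>t. c)"])
     (auto intro!: exI[of _ "\<lambda>t. 0"])

lemma smooth_affine:
  assumes "smooth f"
  shows "smooth (\<lambda>t. f (a * t + b))"
proof -
  have "smooth (\<lambda>t. 1 * f (a * t + b))"
  proof (rule smooth_coinduct[where P = "\<lambda>h. \<exists>f c. smooth f \<and> h = (\<lambda>t. c * f (a * t + b))"])
    fix h assume "\<exists>f c. smooth f \<and> h = (\<lambda>t. c * f (a * t + b))"
    then obtain f c where f: "smooth f" and h: "h = (\<lambda>t. c * f (a * t + b))" by blast
    obtain f' where f': "smooth f'" "\<And>t. (f has_vector_derivative f' t) (at t)"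
      using f by (metis smooth_has_derivative)
    have "(h has_vector_derivative c * of_real a * f' (a * t + b)) (at t)" for t
    proof -
      have "((\<lambda>t. a * t + b) has_vector_derivative a) (at t)"
        by (auto intro!: derivative_eq_intros simp flip: has_real_derivative_iff_has_vector_derivative)
      from vector_diff_chain_at[OF this f'(2)]
      have "((\<lambda>t. f (a * t + b)) has_vector_derivative a *\<^sub>R f' (a * t + b)) (at t)"
        by (simp add: o_def)
      from has_vector_derivative_mult_right[OF this, of c] show ?thesis
        unfolding h by (simp add: scaleR_conv_of_real mult.assoc)
    qed
    then show "\<exists>h'. (\<exists>f c. smooth f \<and> h' = (\<lambda>t. c * f (a * t + b))) \<and>
        (\<forall>t. (h has_vector_derivative h' t) (at t))"
      using f' by blast
  qed (use assms in blast)
  then show ?thesis by simp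
qed

lemma vanishes_outside_derivative:
  assumes "\<And>t. (f has_vector_derivative f' t) (at t)"
    and "\<And>t. R < \<bar>t\<bar> \<Longrightarrow> f t = (0::complex)" and "R < \<bar>t\<bar>"
  shows "f' t = 0"
proof -
  have "(f has_vector_derivative 0) (at t)"
  proof (rule has_vector_derivative_transform_within_open[where f = "\<lambda>_. 0" and S = "{t. R < \<bar>t\<bar>}"])
    show "open {t::real. R < \<bar>t\<bar>}"
      by (intro open_Collect_less continuous_intros)
  qed (use assms in auto)
  then show ?thesis
    using assms(1) vector_derivative_unique_at by blast
qed

text \<open>The factor \<open>f (\<eta> t)\<close> vanishes near 0 and so removes the singularity there.  Away from 0 a
  derivative changes the exponents and replaces \<open>f\<close> by its derivative.  The cases of interest are
  \<open>\<eta> t = - 1 / t\<close> for inversion and \<open>\<eta> t = d * ln \<bar>t\<bar>\<close> for wave packets.\<close>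

lemma smooth_singular_power:
  fixes \<eta> :: "real \<Rightarrow> real"
  assumes f: "smooth f" "\<And>x. R < \<bar>x\<bar> \<Longrightarrow> f x = 0"
    and r: "0 < r" "\<And>t. 0 < \<bar>t\<bar> \<Longrightarrow> \<bar>t\<bar> < r \<Longrightarrow> R < \<bar>\<eta> t\<bar>"
    and \<eta>: "\<And>t. t \<noteq> 0 \<Longrightarrow> (\<eta> has_real_derivative c * sgn t ^ j * \<bar>t\<bar> powr y) (at t)"
  shows "smooth (\<lambda>t. of_real (sgn t ^ k) * of_real \<bar>t\<bar> powr z * f (\<eta> t))"
proof (rule smooth_sum_of[where B = "\<lambda>h. \<exists>k z f. smooth f \<and> (\<forall>x. R < \<bar>x\<bar> \<longrightarrow> f x = 0) \<and>
         h = (\<lambda>t. of_real (sgn t ^ k) * of_real \<bar>t\<bar> powr z * f (\<eta> t))"])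
  let ?B = "\<lambda>h. \<exists>k z f. smooth f \<and> (\<forall>x. R < \<bar>x\<bar> \<longrightarrow> f x = 0) \<and>
         h = (\<lambda>t. of_real (sgn t ^ k) * of_real \<bar>t\<bar> powr z * f (\<eta> t))"
  show "sum_of ?B (\<lambda>t. of_real (sgn t ^ k) * of_real \<bar>t\<bar> powr z * f (\<eta> t))"
    using f by (auto intro!: sum_of.base)
  fix h assume "?B h"
  then obtain k z f where f: "smooth f" "\<And>x. R < \<bar>x\<bar> \<Longrightarrow> f x = 0"
    and h: "h = (\<lambda>t. of_real (sgn t ^ k) * of_real \<bar>t\<bar> powr z * f (\<eta> t))" by blast
  obtain f' where f': "smooth f'" "\<And>t. (f has_vector_derivative f' t) (at t)"
    using f(1) by (metis smooth_has_derivative)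
  have f'0: "f' x = 0" if "R < \<bar>x\<bar>" for x
    by (rule vanishes_outside_derivative[OF f'(2) f(2) that])
  let ?h' = "\<lambda>t. of_real (sgn t ^ Suc k) * of_real \<bar>t\<bar> powr (z - 1) * (z * f (\<eta> t)) +
      of_real (sgn t ^ (k + j)) * of_real \<bar>t\<bar> powr (z + of_real y) * (of_real c * f' (\<eta> t))"
  have h': "(h has_vector_derivative ?h' t) (at t)" for t
  proof (cases "t = 0")
    case True
    have "(h has_vector_derivative 0) (at 0)"
    proof (rule has_vector_derivative_transform_within_open[where f = "\<lambda>_. 0" and S = "{-r<..<r}"])
      fix t assume "t \<in> {-r<..<r}"
      then show "0 = h t" using r(2)[of t] f(2)[of "\<eta> t"] by (cases "t = 0") (auto simp: h)
    qed (use r in auto)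
    then show ?thesis using True by simp
  next
    case False
    define S where "S = (if t > 0 then {0<..} else {..<(0::real)})"
    have S: "open S" "t \<in> S" "\<And>u. u \<in> S \<Longrightarrow> sgn u = sgn t" "\<And>u. u \<in> S \<Longrightarrow> \<bar>u\<bar> = sgn t * u"
        "\<And>u. u \<in> S \<Longrightarrow> u \<noteq> 0"
      using False by (auto simp: S_def split: if_splits)
    have pow: "((\<lambda>u. of_real (sgn t * u) powr z) has_vector_derivative
        z * of_real \<bar>t\<bar> powr (z - 1) * of_real (sgn t)) (at t)"
    proof -
      have "((\<lambda>w::complex. w powr z) has_field_derivative z * of_real \<bar>t\<bar> powr (z - 1)) (at (of_real (sgn t * t)))"
        using False by (auto intro!: derivative_eq_intros has_field_derivative_powr
            simp: complex_nonpos_Reals_iff sgn_if)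
      moreover have "((\<lambda>u. of_real (sgn t * u) :: complex) has_vector_derivative of_real (sgn t)) (at t)"
        by (auto intro!: derivative_eq_intros has_vector_derivative_of_real
             simp flip: has_real_derivative_iff_has_vector_derivative)
      ultimately have "((\<lambda>w. w powr z) \<circ> (\<lambda>u. complex_of_real (sgn t * u)) has_vector_derivative
          of_real (sgn t) * (z * of_real \<bar>t\<bar> powr (z - 1))) (at t)"
        by (intro field_vector_diff_chain_at)
      then show ?thesis by (simp add: o_def mult.commute)
    qed
    have comp: "((\<lambda>u. f (\<eta> u)) has_vector_derivative (c * sgn t ^ j * \<bar>t\<bar> powr y) *\<^sub>R f' (\<eta> t)) (at t)"
      using vector_diff_chain_at[OF \<eta>[OF False, unfolded has_real_derivative_iff_has_vector_derivative] f'(2)]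
      by (simp add: o_def)
    have D: "((\<lambda>u. of_real (sgn t ^ k) * (of_real (sgn t * u) powr z * f (\<eta> u))) has_vector_derivative
       of_real (sgn t ^ k) * (of_real (sgn t * t) powr z * ((c * sgn t ^ j * \<bar>t\<bar> powr y) *\<^sub>R f' (\<eta> t)) +
         (z * of_real \<bar>t\<bar> powr (z - 1) * of_real (sgn t)) * f (\<eta> t))) (at t)"
      by (intro has_vector_derivative_mult_right has_vector_derivative_mult pow comp)
    have eq: "of_real (sgn t ^ k) * (of_real (sgn t * t) powr z * ((c * sgn t ^ j * \<bar>t\<bar> powr y) *\<^sub>R f' (\<eta> t)) +
         (z * of_real \<bar>t\<bar> powr (z - 1) * of_real (sgn t)) * f (\<eta> t)) = ?h' t"
    proof -
      have "of_real \<bar>t\<bar> powr (z + of_real y) = of_real \<bar>t\<bar> powr z * complex_of_real (\<bar>t\<bar> powr y)"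
        using False by (simp add: powr_add powr_of_real)
      moreover have "sgn t * t = \<bar>t\<bar>" by (simp add: abs_sgn mult.commute)
      ultimately show ?thesis
        by (simp add: scaleR_conv_of_real power_add algebra_simps)
    qed
    show ?thesis
      unfolding eq[symmetric]
    proof (rule has_vector_derivative_transform_within_open[OF D S(1,2)])
      fix u assume "u \<in> S"
      then have "sgn u = sgn t" "\<bar>u\<bar> = sgn t * u" using S(3,4) by blast+
      then show "of_real (sgn t ^ k) * (of_real (sgn t * u) powr z * f (\<eta> u)) = h u"
        by (simp only: h mult.assoc)
    qed
  qed
  have "sum_of ?B ?h'"
  proof (intro sum_of.add sum_of.base)
    show "?B (\<lambda>t. of_real (sgn t ^ Suc k) * of_real \<bar>t\<bar> powr (z - 1) * (z * f (\<eta> t)))"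
      by (rule exI[of _ "Suc k"], rule exI[of _ "z - 1"], rule exI[of _ "\<lambda>x. z * f x"])
         (use f smooth_mult[OF smooth_const] in auto)
    show "?B (\<lambda>t. of_real (sgn t ^ (k + j)) * of_real \<bar>t\<bar> powr (z + of_real y) * (of_real c * f' (\<eta> t)))"
      by (rule exI[of _ "k + j"], rule exI[of _ "z + of_real y"], rule exI[of _ "\<lambda>x. of_real c * f' x"])
         (use f'(1) f'0 smooth_mult[OF smooth_const] in auto)
  qed
  then show "\<exists>h'. sum_of ?B h' \<and> (\<forall>t. (h has_vector_derivative h' t) (at t))"
    using h' by blast
qed

text \<open>The functions \<open>p (1 / t) * exp (- 1 / t)\<close> with a polynomial \<open>p\<close>, extended by 0, are closed under
  derivatives: differentiation replaces \<open>p\<close> by \<open>X^2 (p - p')\<close>.\<close>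

lemma smooth_exp_inverse:
  "smooth (\<lambda>t. if t > 0 then of_real (exp (- (1 / t))) else 0)"
proof -
  define h :: "real poly \<Rightarrow> real \<Rightarrow> real"
    where "h p t = (if t > 0 then poly p (1 / t) * exp (- (1 / t)) else 0)" for p t
  have lim0: "((\<lambda>t. poly p (1 / t) * exp (- (1 / t))) \<longlongrightarrow> 0) (at_right 0)" for p :: "real poly"
  proof -
    have "((\<lambda>x. poly p x * exp (- x)) \<longlongrightarrow> 0) at_top"
    proof -
      have "((\<lambda>x. \<Sum>i\<le>degree p. coeff p i * (x ^ i / exp x)) \<longlongrightarrow> (\<Sum>i\<le>degree p. coeff p i * 0)) at_top"
        by (intro tendsto_intros tendsto_power_div_exp_0)
      then show ?thesis
        by (simp add: poly_altdef sum_distrib_right exp_minus divide_inverse mult.assoc)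
    qed
    then have "((\<lambda>t. poly p (inverse t) * exp (- inverse t)) \<longlongrightarrow> 0) (at_right 0)"
      by (rule filterlim_compose[OF _ filterlim_inverse_at_top_right])
    then show ?thesis by (simp add: inverse_eq_divide)
  qed
  have der: "(h p has_real_derivative h ([:0,0,1:] * (p - pderiv p)) t) (at t)" for p t
  proof -
    consider "t > 0" | "t < 0" | "t = 0" by linarith
    then show ?thesis
    proof cases
      case 1
      have "((\<lambda>t. poly p (1 / t) * exp (- (1 / t))) has_real_derivative
             h ([:0,0,1:] * (p - pderiv p)) t) (at t)"
        using 1 by (auto intro!: derivative_eq_intros DERIV_chain2[OF poly_DERIV]
            simp: h_def power2_eq_square field_simps)
      then show ?thesis
        by (rule has_field_derivative_transform_within_open[where S = "{0<..}"]) (use 1 in \<open>auto simp: h_def\<close>)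
    next
      case 2
      have "((\<lambda>t. 0) has_real_derivative h ([:0,0,1:] * (p - pderiv p)) t) (at t)"
        using 2 by (auto simp: h_def)
      then show ?thesis
        by (rule has_field_derivative_transform_within_open[where S = "{..<0}"]) (use 2 in \<open>auto simp: h_def\<close>)
    next
      \<comment> \<open>At 0 the difference quotient from the right is of the same form, with \<open>p\<close> replaced by \<open>X p\<close>.\<close>
      case 3
      have "((\<lambda>s. h p s / s) \<longlongrightarrow> 0) (at_right 0)"
      proof (rule Lim_transform_eventually[OF lim0[of "[:0,1:] * p"]])
        show "\<forall>\<^sub>F x in at_right 0. poly ([:0, 1:] * p) (1 / x) * exp (- (1 / x)) = h p x / x"
          by (auto simp: eventually_at_right_field h_def intro!: exI[of _ 1])
      qed
      moreover have "((\<lambda>s. h p s / s) \<longlongrightarrow> 0) (at_left 0)"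
      proof (rule Lim_transform_eventually[OF tendsto_const])
        show "\<forall>\<^sub>F x in at_left 0. 0 = h p x / x"
          by (auto simp: eventually_at_left_field h_def intro!: exI[of _ "-1"])
      qed
      ultimately have "((\<lambda>s. h p s / s) \<longlongrightarrow> 0) (at 0)"
        by (rule filterlim_split_at[rotated])
      then show ?thesis
        using 3 by (simp add: has_field_derivative_iff h_def)
    qed
  qed
  have "smooth (\<lambda>t. of_real (h 1 t))"
  proof (rule smooth_coinduct[where P = "\<lambda>f. \<exists>p. f = (\<lambda>t. of_real (h p t))"])
    fix f assume "\<exists>p. f = (\<lambda>t. complex_of_real (h p t))"
    then obtain p where f: "f = (\<lambda>t. of_real (h p t))" by blast
    show "\<exists>f'. (\<exists>p. f' = (\<lambda>t. of_real (h p t))) \<and> (\<forall>t. (f has_vector_derivative f' t) (at t))"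
      unfolding f
      by (rule exI[of _ "\<lambda>t. of_real (h ([:0,0,1:] * (p - pderiv p)) t)"])
         (use der in \<open>auto intro!: has_vector_derivative_of_real
            simp flip: has_real_derivative_iff_has_vector_derivative\<close>)
  qed blast
  moreover have "(\<lambda>t. complex_of_real (h 1 t)) = (\<lambda>t. if t > 0 then of_real (exp (- (1 / t))) else 0)"
    by (auto simp: h_def)
  ultimately show ?thesis by simp
qed


lemma test_fun_iff:
  "test_fun f \<longleftrightarrow> smooth f \<and> (\<exists>R. \<forall>t. R < \<bar>t\<bar> \<longrightarrow> f t = 0)"
proof -
  have "compact (closure {t. f t \<noteq> 0}) \<longleftrightarrow> (\<exists>R. \<forall>t. R < \<bar>t\<bar> \<longrightarrow> f t = 0)"
  proof -
    have "compact (closure {t. f t \<noteq> 0}) \<longleftrightarrow> bounded {t. f t \<noteq> 0}"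
      by (meson bounded_closure bounded_subset closed_closure closure_subset compact_eq_bounded_closed)
    also have "\<dots> \<longleftrightarrow> (\<exists>R. \<forall>t. R < \<bar>t\<bar> \<longrightarrow> f t = 0)"
      unfolding bounded_real by (metis (mono_tags, lifting) mem_Collect_eq not_less)
    finally show ?thesis .
  qed
  then show ?thesis by (simp add: test_fun_def smooth_def)
qed

lemma test_fun_smooth: "test_fun f \<Longrightarrow> smooth f"
  by (simp add: test_fun_iff)

lemma test_funE:
  assumes "test_fun f"
  obtains R where "R > 0" "\<And>t. R < \<bar>t\<bar> \<Longrightarrow> f t = 0"
proof -
  obtain R where "\<And>t. R < \<bar>t\<bar> \<Longrightarrow> f t = 0" using assms by (auto simp: test_fun_iff)
  then show ?thesis by (intro that[of "max 1 R"]) auto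
qed

lemma test_funI: "smooth f \<Longrightarrow> (\<And>t. R < \<bar>t\<bar> \<Longrightarrow> f t = 0) \<Longrightarrow> test_fun f"
  by (auto simp: test_fun_iff)

lemma test_fun_add:
  assumes "test_fun f" "test_fun g" shows "test_fun (\<lambda>t. f t + g t)"
proof -
  obtain R S where "\<And>t. R < \<bar>t\<bar> \<Longrightarrow> f t = 0" "\<And>t. S < \<bar>t\<bar> \<Longrightarrow> g t = 0"
    using assms by (meson test_funE)
  then show ?thesis
    by (intro test_funI[where R = "max R S"] smooth_add assms[THEN test_fun_smooth]) auto
qed

lemma test_fun_mult_smooth:
  assumes "test_fun f" "smooth g" shows "test_fun (\<lambda>t. g t * f t)"
proof -
  obtain R where "\<And>t. R < \<bar>t\<bar> \<Longrightarrow> f t = 0"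
    using assms by (meson test_funE)
  then show ?thesis
    by (intro test_funI[where R = R] smooth_mult assms(1)[THEN test_fun_smooth] assms(2)) auto
qed

lemma test_fun_cmult: "test_fun f \<Longrightarrow> test_fun (\<lambda>t. c * f t)"
  by (rule test_fun_mult_smooth[OF _ smooth_const])

lemma test_fun_diff:
  assumes "test_fun f" "test_fun g" shows "test_fun (\<lambda>t. f t - g t)"
  using test_fun_add[OF assms(1) test_fun_cmult[OF assms(2), of "-1"]] by simp

lemma test_fun_zero: "test_fun (\<lambda>t. 0)"
  by (rule test_funI[OF smooth_const, of 0]) auto

lemma test_fun_affine:
  assumes "test_fun f" "a \<noteq> 0" shows "test_fun (\<lambda>t. f (a * t + b))"
proof -
  obtain R where R: "\<And>t. R < \<bar>t\<bar> \<Longrightarrow> f t = 0"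
    using assms by (meson test_funE)
  show ?thesis
  proof (intro test_funI[where R = "(R + \<bar>b\<bar>) / \<bar>a\<bar>"] smooth_affine assms(1)[THEN test_fun_smooth] R)
    fix t assume "(R + \<bar>b\<bar>) / \<bar>a\<bar> < \<bar>t\<bar>"
    then have "R + \<bar>b\<bar> < \<bar>a * t\<bar>" using assms by (simp add: field_simps abs_mult)
    then show "R < \<bar>a * t + b\<bar>" by linarith
  qed
qed

lemma test_fun_has_derivative:
  assumes "test_fun f"
  obtains f' where "test_fun f'" "\<And>t. (f has_vector_derivative f' t) (at t)"
proof -
  obtain R where R: "\<And>t. R < \<bar>t\<bar> \<Longrightarrow> f t = 0" using assms by (meson test_funE)
  obtain f' where f': "smooth f'" "\<And>t. (f has_vector_derivative f' t) (at t)"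
    using smooth_has_derivative[OF test_fun_smooth[OF assms]] by metis
  have "test_fun f'"
    by (rule test_funI[OF f'(1), of R]) (rule vanishes_outside_derivative[OF f'(2) R])
  then show ?thesis using f' that by blast
qed

text \<open>A class in which Plancherel's theorem has a short proof, and which contains test functions, their
  convolutions, and their Fourier transforms in logarithmic coordinates.\<close>

definition nice :: "(real \<Rightarrow> complex) \<Rightarrow> bool" where
  "nice g \<longleftrightarrow> continuous_on UNIV g \<and> integrable lborel g \<and> bounded (range g)"

lemma test_fun_nice:
  assumes "test_fun f" shows "nice f"
proof -
  obtain R where R: "\<And>t. R < \<bar>t\<bar> \<Longrightarrow> f t = 0" using assms by (meson test_funE)
  have c: "continuous_on A f" for A
    by (rule smooth_continuous[OF test_fun_smooth[OF assms]])
  have "set_integrable lborel {-R..R} f"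
    using borel_integrable_compact[OF _ c, of "{-R..R}"] by (simp add: set_integrable_def)
  moreover have "(\<lambda>x. indicat_real {-R..R} x *\<^sub>R f x) = f"
    using R by (fastforce simp: indicator_def)
  ultimately have "integrable lborel f" by (simp add: set_integrable_def)
  moreover have "bounded (range f)"
  proof (rule bounded_subset)
    show "bounded (f ` {-R..R} \<union> {0})"
      using compact_imp_bounded[OF compact_continuous_image[OF c compact_Icc]] by simp
    show "range f \<subseteq> f ` {-R..R} \<union> {0}"
    proof (rule image_subsetI)
      fix t show "f t \<in> f ` {-R..R} \<union> {0}"
        using R[of t] by (cases "R < \<bar>t\<bar>") (auto simp: not_less abs_le_iff)
    qed
  qed
  ultimately show ?thesis using c by (simp add: nice_def)
qed

lemma bump_exists:
  obtains B :: "real \<Rightarrow> real" where "test_fun (\<lambda>t. of_real (B t))" "\<And>t. 0 \<le> B t" "B 0 > 0"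
    "\<And>t. 1 \<le> \<bar>t\<bar> \<Longrightarrow> B t = 0"
proof -
  define e :: "real \<Rightarrow> real" where "e t = (if t > 0 then exp (- (1 / t)) else 0)" for t
  have "(\<lambda>t. complex_of_real (e t)) = (\<lambda>t. if t > 0 then of_real (exp (- (1 / t))) else 0)"
    by (auto simp: e_def)
  then have e: "smooth (\<lambda>t. of_real (e t))"
    using smooth_exp_inverse by simp
  have "smooth (\<lambda>t. of_real (e (1 * t + 1)) * of_real (e ((-1) * t + 1)))"
    by (intro smooth_mult smooth_affine[OF e])
  then have "test_fun (\<lambda>t. of_real (e (t + 1) * e (1 - t)))"
    by (intro test_funI[where R = 1]) (auto simp: e_def)
  then show ?thesis
    by (rule that) (auto simp: e_def)
qed

text \<open>The normalised primitive of a bump is a smooth step from 0 to 1 with its slope in \<open>[-1, 1]\<close>.  The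
  product of a step up around \<open>-2\<close> and a step down around 2 is a plateau.\<close>

lemma plateau_exists:
  obtains w :: "real \<Rightarrow> real" where "test_fun (\<lambda>t. of_real (w t))"
    "\<And>t. \<bar>t\<bar> \<le> 1 \<Longrightarrow> w t = 1" "\<And>t. 3 < \<bar>t\<bar> \<Longrightarrow> w t = 0"
proof -
  obtain B :: "real \<Rightarrow> real" where B: "test_fun (\<lambda>t. of_real (B t))" "\<And>t. 0 \<le> B t" "B 0 > 0"
    "\<And>t. 1 \<le> \<bar>t\<bar> \<Longrightarrow> B t = 0" using bump_exists by blast
  have "continuous_on A (\<lambda>t. Re (of_real (B t)))" for A
    by (intro continuous_intros smooth_continuous test_fun_smooth B)
  then have c: "continuous_on A B" for A by simp
  define I where "I t = integral {-2..t} B" for t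
  have intB: "B integrable_on {a..b}" for a b
    by (rule integrable_continuous_interval[OF c])
  have I0: "I t = 0" if "t \<le> -1" for t
  proof -
    have "I t = integral {-2..t} (\<lambda>_. 0)"
      unfolding I_def by (rule integral_cong) (use that B in auto)
    then show ?thesis by simp
  qed
  have I1: "I t = I 1" if "t \<ge> 1" for t
  proof -
    have "integral {1..t} B = integral {1..t} (\<lambda>_. 0)"
      by (rule integral_cong) (use that B in auto)
    then show ?thesis
      using Henstock_Kurzweil_Integration.integral_combine[of "-2" 1 t B] that intB
      by (simp add: I_def)
  qed
  have "I 1 \<noteq> 0"
    unfolding I_def using integral_eq_0_iff[of "-2" 1 B] c B by force
  \<comment> \<open>The lower limit \<open>-2\<close> leaves room to the left of the support, where \<open>I\<close> is constant.\<close>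
  have Ider: "(I has_real_derivative B t) (at t)" for t
  proof (cases "t > -2")
    case True
    have "(I has_real_derivative B t) (at t within {-2..t+1})"
      unfolding I_def has_real_derivative_iff_has_vector_derivative
      using True by (intro integral_has_vector_derivative c) auto
    then show ?thesis
      using True by (simp add: at_within_Icc_at)
  next
    case False
    then have "B t = 0" using B by auto
    have "((\<lambda>_. 0) has_real_derivative B t) (at t)"
      unfolding \<open>B t = 0\<close> by simp
    then show ?thesis
      by (rule has_field_derivative_transform_within_open[where S = "{..<-1}"]) (use False I0 in auto)
  qed
  define p where "p t = complex_of_real (I t / I 1)" for t
  have "smooth p"
  proof (rule smooth_antiderivative)
    show "smooth (\<lambda>t. of_real (1 / I 1) * of_real (B t))"
      by (intro smooth_mult smooth_const test_fun_smooth B)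
    fix t
    have "(p has_vector_derivative of_real (B t / I 1)) (at t)"
      unfolding p_def
      using DERIV_cdivide[OF Ider] 
      by (intro has_vector_derivative_of_real) (simp add: has_real_derivative_iff_has_vector_derivative)
    then show "(p has_vector_derivative of_real (1 / I 1) * of_real (B t)) (at t)"
      by simp
  qed
  then have "smooth (\<lambda>t. p (1 * t + 2) * p ((-1) * t + 2))"
    by (intro smooth_mult smooth_affine)
  moreover have zero: "I (t + 2) / I 1 * (I (2 - t) / I 1) = 0" if "3 < \<bar>t\<bar>" for t
    using that I0[of "t + 2"] I0[of "2 - t"] by (cases "t > 0") auto
  ultimately have "test_fun (\<lambda>t. of_real (I (t + 2) / I 1 * (I (2 - t) / I 1)))"
    by (intro test_funI[where R = 3]) (simp_all add: p_def)
  then show ?thesis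
  proof (rule that)
    fix t :: real assume "\<bar>t\<bar> \<le> 1"
    then have "I (t + 2) = I 1" "I (2 - t) = I 1" by (auto intro!: I1)
    then show "I (t + 2) / I 1 * (I (2 - t) / I 1) = 1" using \<open>I 1 \<noteq> 0\<close> by simp
  qed (rule zero)
qed

section \<open>The Fourier transform and Plancherel's theorem\<close>

lemma fubini_integrable_kernel:
  fixes f g :: "real \<Rightarrow> complex" and k :: "real \<Rightarrow> real \<Rightarrow> complex"
  assumes f: "integrable lborel f" and g: "integrable lborel g"
    and k: "case_prod k \<in> borel_measurable (lborel \<Otimes>\<^sub>M lborel)" and B: "\<And>x y. norm (k x y) \<le> B"
  shows "integrable (lborel \<Otimes>\<^sub>M lborel) (\<lambda>(x, y). f x * (g y * k x y))"
proof (rule Bochner_Integration.integrable_bound)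
  have [measurable]: "f \<in> borel_measurable borel" "g \<in> borel_measurable borel"
      "case_prod k \<in> borel_measurable (borel \<Otimes>\<^sub>M borel)"
    using f g k by simp_all
  show "integrable (lborel \<Otimes>\<^sub>M lborel) (\<lambda>(x, y). norm (f x) * (B * norm (g y)))"
  proof (rule lborel_pair.Fubini_integrable)
    show "integrable lborel (\<lambda>x. LINT y|lborel. norm (case (x, y) of (x, y) \<Rightarrow> norm (f x) * (B * norm (g y))))"
      using f by (simp add: abs_mult integrable_norm)
  qed (use g in auto)
  show "(\<lambda>(x, y). f x * (g y * k x y)) \<in> borel_measurable (lborel \<Otimes>\<^sub>M lborel)"
    by measurable
  have "norm (f x) * (norm (g y) * norm (k x y)) \<le> norm (norm (f x) * (B * norm (g y)))" for x y
  proof -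
    have "norm (f x) * (norm (g y) * norm (k x y)) \<le> norm (f x) * (norm (g y) * B)"
      by (intro mult_left_mono B) auto
    also have "\<dots> \<le> norm (norm (f x) * (B * norm (g y)))" by (simp add: mult_ac)
    finally show ?thesis .
  qed
  then show "AE x in lborel \<Otimes>\<^sub>M lborel. norm (case x of (x, y) \<Rightarrow> f x * (g y * k x y))
      \<le> norm (case x of (x, y) \<Rightarrow> norm (f x) * (B * norm (g y)))"
    by (auto simp: norm_mult)
qed

lemma fubini_kernel:
  fixes f g :: "real \<Rightarrow> complex" and k :: "real \<Rightarrow> real \<Rightarrow> complex"
  assumes f: "integrable lborel f" and g: "integrable lborel g"
    and k: "case_prod k \<in> borel_measurable (lborel \<Otimes>\<^sub>M lborel)" and B: "\<And>x y. norm (k x y) \<le> B"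
  shows "(LINT x|lborel. f x * (LINT y|lborel. g y * k x y)) =
         (LINT y|lborel. g y * (LINT x|lborel. f x * k x y))"
    and "integrable lborel (\<lambda>x. f x * (LINT y|lborel. g y * k x y))"
proof -
  note I = fubini_integrable_kernel[OF assms]
  have "(LINT y|lborel. LINT x|lborel. f x * (g y * k x y)) = (LINT x|lborel. LINT y|lborel. f x * (g y * k x y))"
    using lborel_pair.Fubini_integral[OF I] by simp
  moreover have "(LINT x|lborel. f x * (g y * k x y)) = g y * (LINT x|lborel. f x * k x y)" for y
    by (simp add: mult.left_commute[of "f _" "g _"])
  moreover have "(LINT y|lborel. f x * (g y * k x y)) = f x * (LINT y|lborel. g y * k x y)" for x
    by simp
  ultimately show "(LINT x|lborel. f x * (LINT y|lborel. g y * k x y)) =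
         (LINT y|lborel. g y * (LINT x|lborel. f x * k x y))"
    by simp
  show "integrable lborel (\<lambda>x. f x * (LINT y|lborel. g y * k x y))"
    using lborel_pair.integrable_fst[OF I] by simp
qed

lemma borel_measurable_cnj [measurable]:
  "f \<in> borel_measurable M \<Longrightarrow> (\<lambda>x. cnj (f x)) \<in> borel_measurable M"
  by (rule borel_measurable_continuous_on[where f = cnj]) (auto intro: continuous_intros)

lemma norm_exp_ii [simp]: "norm (exp (- (\<i> * of_real t * of_real r))) = 1" "norm (exp (\<i> * of_real t * of_real r)) = 1"
  by (simp_all)

lemma integrable_times_bounded:
  fixes f g :: "real \<Rightarrow> complex"
  assumes "integrable lborel f" "g \<in> borel_measurable lborel" "\<And>x. norm (g x) \<le> B"
  shows "integrable lborel (\<lambda>x. f x * g x)"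
proof (rule Bochner_Integration.integrable_bound)
  show "integrable lborel (\<lambda>x. B *\<^sub>R f x)" using assms(1) by simp
  show "(\<lambda>x. f x * g x) \<in> borel_measurable lborel" using assms by simp
  have "norm (f x) * norm (g x) \<le> \<bar>B\<bar> * norm (f x)" for x
    using mult_left_mono[OF order_trans[OF assms(3)[of x] abs_ge_self], of "norm (f x)"]
    by (simp add: mult.commute)
  then show "AE x in lborel. norm (f x * g x) \<le> norm (B *\<^sub>R f x)"
    by (simp add: norm_mult)
qed

lemma fourier_integrable:
  "integrable lborel f \<Longrightarrow> integrable lborel (\<lambda>t. f t * exp (- (\<i> * of_real t * of_real r)))"
  by (rule integrable_times_bounded[where B = 1]) auto

lemma norm_fourier_le:
  "norm (fourier f r) \<le> (LINT t|lborel. norm (f t))"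
proof -
  have "norm (fourier f r) \<le> (LINT t|lborel. norm (f t * exp (- (\<i> * of_real t * of_real r))))"
    unfolding fourier_def by (rule integral_norm_bound)
  then show ?thesis by (simp add: norm_mult)
qed

lemma continuous_fourier:
  assumes "integrable lborel f" shows "continuous_on A (fourier f)"
proof -
  have "isCont (fourier f) r" for r
  proof (unfold continuous_at_sequentially, intro allI impI)
    fix X :: "nat \<Rightarrow> real" assume X: "X \<longlonglongrightarrow> r"
    show "(fourier f \<circ> X) \<longlonglongrightarrow> fourier f r"
      unfolding fourier_def o_def
    proof (rule integral_dominated_convergence[where w = "\<lambda>t. norm (f t)"])
      show "AE t in lborel. (\<lambda>i. f t * exp (- (\<i> * of_real t * of_real (X i))))
              \<longlonglongrightarrow> f t * exp (- (\<i> * of_real t * of_real r))"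
        by (intro AE_I2 tendsto_intros X)
    qed (use assms in \<open>auto simp: norm_mult\<close>)
  qed
  then show ?thesis by (simp add: continuous_at_imp_continuous_on)
qed

lemma fourier_measurable [measurable]:
  "integrable lborel f \<Longrightarrow> fourier f \<in> borel_measurable borel"
  by (intro borel_measurable_continuous_onI continuous_fourier)

lemma fourier_add:
  "integrable lborel f \<Longrightarrow> integrable lborel g \<Longrightarrow>
   fourier (\<lambda>t. f t + g t) r = fourier f r + fourier g r"
  unfolding fourier_def by (simp add: distrib_right fourier_integrable)

lemma fourier_cmult: "fourier (\<lambda>t. c * f t) r = c * fourier f r"
  unfolding fourier_def by (simp add: mult.assoc)

lemma fourier_affine:
  assumes "a \<noteq> 0"
  shows "fourier (\<lambda>t. f (a * t + b)) r =
         of_real (1 / \<bar>a\<bar>) * exp (\<i> * of_real (b * r / a)) * fourier f (r / a)"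
proof -
  have "fourier (\<lambda>t. f (a * t + b)) r = \<bar>1 / a\<bar> *\<^sub>R
     (LINT s|lborel. f (a * (- b / a + 1 / a * s) + b) *
        exp (- (\<i> * of_real (- b / a + 1 / a * s) * of_real r)))"
    unfolding fourier_def by (rule lborel_integral_real_affine) (use assms in simp)
  also have "(\<lambda>s. f (a * (- b / a + 1 / a * s) + b) *
        exp (- (\<i> * of_real (- b / a + 1 / a * s) * of_real r))) =
      (\<lambda>s. exp (\<i> * of_real (b * r / a)) * (f s * exp (- (\<i> * of_real s * of_real (r / a)))))"
  proof
    fix s
    have "- (\<i> * of_real (- b / a + 1 / a * s) * of_real r) =
        \<i> * of_real (b * r / a) + - (\<i> * of_real s * of_real (r / a))"
      by (simp add: algebra_simps diff_divide_distrib)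
    moreover have "a * (- b / a + 1 / a * s) + b = s" using assms by (simp add: field_simps)
    ultimately show "f (a * (- b / a + 1 / a * s) + b) *
        exp (- (\<i> * of_real (- b / a + 1 / a * s) * of_real r)) =
        exp (\<i> * of_real (b * r / a)) * (f s * exp (- (\<i> * of_real s * of_real (r / a))))"
      by (simp only: exp_add mult_ac)
  qed
  also have "(LINT s|lborel. exp (\<i> * of_real (b * r / a)) * (f s * exp (- (\<i> * of_real s * of_real (r / a))))) =
     exp (\<i> * of_real (b * r / a)) * fourier f (r / a)"
    unfolding fourier_def by simp
  finally show ?thesis by (simp add: scaleR_conv_of_real mult.assoc)
qed

lemma integral_gauss_exp:
  "(LINT z|lborel. of_real (std_normal_density z) * exp (\<i> * of_real z * of_real t)) =
   complex_of_real (exp (- t\<^sup>2 / 2))"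
proof -
  have "complex_of_real (exp (- t\<^sup>2 / 2)) = char std_normal_distribution t"
    by (simp add: char_std_normal_distribution)
  also have "\<dots> = (LINT z|lborel. std_normal_density z *\<^sub>R exp (\<i> * of_real (t * z)))"
    unfolding char_def by (subst integral_density) auto
  finally show ?thesis
    by (simp add: scaleR_conv_of_real mult_ac)
qed

lemma integrable_std_normal: "integrable lborel (\<lambda>z. complex_of_real (std_normal_density z))"
  using integrable_normal_density[of 1 0] by (simp add: integrable_of_real)

lemma integral_exp_square:
  "integrable lborel (\<lambda>h::real. exp (- h\<^sup>2 / 2))" "(LINT h|lborel. exp (- h\<^sup>2 / 2)) = sqrt (2 * pi)"
proof -
  have eq: "exp (- h\<^sup>2 / 2) = sqrt (2 * pi) * std_normal_density h" for h :: real
    by (simp add: std_normal_density_def)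
  show "integrable lborel (\<lambda>h::real. exp (- h\<^sup>2 / 2))"
    unfolding eq using integrable_normal_density[of 1 0] by simp
  show "(LINT h|lborel. exp (- h\<^sup>2 / 2)) = sqrt (2 * pi)"
    unfolding eq using integral_normal_density[of 1 0] by simp
qed

text \<open>The square of the transform need not be known to be integrable.  A Gaussian factor allows Fubini's
  theorem, and the Gaussian is its own Fourier transform, of width \<open>1 / T\<close> on the other side.\<close>

lemma gauss_mean_fourier_square:
  assumes g: "nice g" and T: "T > 0"
  shows "integrable lborel (\<lambda>u. exp (- (u / T)\<^sup>2 / 2) * (norm (fourier g u))\<^sup>2)"
    and "of_real (LINT u|lborel. exp (- (u / T)\<^sup>2 / 2) * (norm (fourier g u))\<^sup>2) =
     of_real (sqrt (2 * pi)) * (LINT y|lborel. cnj (g y) * (LINT h|lborel. of_real (exp (- h\<^sup>2 / 2)) * g (y + h / T)))"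
proof -
  let ?n = "\<lambda>z. complex_of_real (std_normal_density z)"
  have gi: "integrable lborel g" using g by (simp add: nice_def)
  have [measurable]: "g \<in> borel_measurable borel" "fourier g \<in> borel_measurable borel"
    using gi by auto
  obtain B where B: "\<And>r. norm (fourier g r) \<le> B" using norm_fourier_le by blast
  have nT: "integrable lborel (\<lambda>z. ?n z * fourier g (T * z))"
    by (rule integrable_times_bounded[OF integrable_std_normal _ B]) auto
  have nT2: "integrable lborel (\<lambda>z. ?n z * fourier g (T * z) * cnj (fourier g (T * z)))"
    by (rule integrable_times_bounded[OF nT, where B = B]) (auto simp: B)
  have sq: "?n z * fourier g (T * z) * cnj (fourier g (T * z)) =
      of_real (std_normal_density z * (norm (fourier g (T * z)))\<^sup>2)" for z :: real
    by (simp add: mult.assoc complex_norm_square[symmetric] del: of_real_power)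
  have dens: "std_normal_density z * (norm (fourier g (T * z)))\<^sup>2 =
     1 / sqrt (2 * pi) * (exp (- ((0 + T * z) / T)\<^sup>2 / 2) * (norm (fourier g (0 + T * z)))\<^sup>2)" for z :: real
    using T by (simp add: std_normal_density_def)
  have int: "integrable lborel (\<lambda>z. std_normal_density z * (norm (fourier g (T * z)))\<^sup>2)"
    using nT2 unfolding sq by (simp only: complex_of_real_integrable_eq)
  show "integrable lborel (\<lambda>u. exp (- (u / T)\<^sup>2 / 2) * (norm (fourier g u))\<^sup>2)"
  proof -
    have "integrable lborel (\<lambda>z. sqrt (2 * pi) * (std_normal_density z * (norm (fourier g (T * z)))\<^sup>2))"
      using int by (rule integrable_mult_right)
    then have "integrable lborel (\<lambda>z. exp (- ((0 + T * z) / T)\<^sup>2 / 2) * (norm (fourier g (0 + T * z)))\<^sup>2)"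
      unfolding dens by simp
    then show ?thesis
      using T by (subst (asm) lborel_integrable_real_affine_iff) auto
  qed
  have "(LINT u|lborel. exp (- (u / T)\<^sup>2 / 2) * (norm (fourier g u))\<^sup>2) =
      T * sqrt (2 * pi) * (LINT z|lborel. std_normal_density z * (norm (fourier g (T * z)))\<^sup>2)"
    unfolding dens using T
    by (subst lborel_integral_real_affine[of T _ 0]) auto
  then have "of_real (LINT u|lborel. exp (- (u / T)\<^sup>2 / 2) * (norm (fourier g u))\<^sup>2) =
      of_real (T * sqrt (2 * pi)) * (LINT z|lborel. ?n z * fourier g (T * z) * cnj (fourier g (T * z)))"
    unfolding sq integral_complex_of_real by (simp only: of_real_mult)
  also have "(LINT z|lborel. ?n z * fourier g (T * z) * cnj (fourier g (T * z))) =
     (LINT z|lborel. (?n z * fourier g (T * z)) * (LINT y|lborel. cnj (g y) * exp (\<i> * of_real (T * z) * of_real y)))"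
  proof -
    have "cnj (fourier g (T * z)) = (LINT y|lborel. cnj (g y) * exp (\<i> * of_real (T * z) * of_real y))" for z
      unfolding fourier_def by (subst Bochner_Integration.integral_cnj[symmetric]) (simp add: exp_cnj mult_ac)
    then show ?thesis by simp
  qed
  also have "\<dots> = (LINT y|lborel. cnj (g y) * (LINT z|lborel. ?n z * fourier g (T * z) * exp (\<i> * of_real (T * z) * of_real y)))"
    by (rule fubini_kernel(1)[OF nT _ _ order_refl[THEN ord_eq_le_trans[OF norm_exp_ii(2)]]])
       (use gi in auto)
  also have "(\<lambda>y. LINT z|lborel. ?n z * fourier g (T * z) * exp (\<i> * of_real (T * z) * of_real y)) =
     (\<lambda>y. of_real (1 / T) * (LINT h|lborel. of_real (exp (- h\<^sup>2 / 2)) * g (y + h / T)))"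
  proof
    fix y
    have "(LINT z|lborel. ?n z * fourier g (T * z) * exp (\<i> * of_real (T * z) * of_real y)) =
      (LINT z|lborel. ?n z * (LINT x|lborel. g x * exp (\<i> * of_real z * of_real (T * (y - x)))))"
    proof (rule Bochner_Integration.integral_cong[OF refl])
      fix z
      have "(LINT x|lborel. g x * exp (\<i> * of_real z * of_real (T * (y - x)))) =
         (LINT x|lborel. (g x * exp (- (\<i> * of_real x * of_real (T * z)))) * exp (\<i> * of_real (T * z) * of_real y))"
        by (rule Bochner_Integration.integral_cong[OF refl])
           (simp add: mult.assoc exp_add[symmetric] algebra_simps)
      also have "\<dots> = fourier g (T * z) * exp (\<i> * of_real (T * z) * of_real y)"
        unfolding fourier_def by simp
      finally show "?n z * fourier g (T * z) * exp (\<i> * of_real (T * z) * of_real y) =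
         ?n z * (LINT x|lborel. g x * exp (\<i> * of_real z * of_real (T * (y - x))))"
        by (simp add: mult.assoc)
    qed
    also have "\<dots> = (LINT x|lborel. g x * (LINT z|lborel. ?n z * exp (\<i> * of_real z * of_real (T * (y - x)))))"
      by (rule fubini_kernel(1)[OF integrable_std_normal gi _ order_refl[THEN ord_eq_le_trans[OF norm_exp_ii(2)]]])
         auto
    also have "\<dots> = (LINT x|lborel. g x * of_real (exp (- (T * (y - x))\<^sup>2 / 2)))"
      by (simp only: integral_gauss_exp)
    also have "\<dots> = \<bar>1 / T\<bar> *\<^sub>R (LINT h|lborel. g (y + 1 / T * h) * of_real (exp (- (T * (y - (y + 1 / T * h)))\<^sup>2 / 2)))"
      by (rule lborel_integral_real_affine) (use T in simp)
    also have "\<dots> = of_real (1 / T) * (LINT h|lborel. of_real (exp (- h\<^sup>2 / 2)) * g (y + h / T))"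
      using T by (simp add: scaleR_conv_of_real mult.commute)
    finally show "(LINT z|lborel. ?n z * fourier g (T * z) * exp (\<i> * of_real (T * z) * of_real y)) =
      of_real (1 / T) * (LINT h|lborel. of_real (exp (- h\<^sup>2 / 2)) * g (y + h / T))" .
  qed
  finally show "of_real (LINT u|lborel. exp (- (u / T)\<^sup>2 / 2) * (norm (fourier g u))\<^sup>2) =
     of_real (sqrt (2 * pi)) * (LINT y|lborel. cnj (g y) * (LINT h|lborel. of_real (exp (- h\<^sup>2 / 2)) * g (y + h / T)))"
    using T by (simp add: mult.left_commute[of "cnj _"])
qed


lemma LIMSEQ_divide_Suc: "(\<lambda>m. c / real (Suc m)) \<longlonglongrightarrow> 0"
  using tendsto_mult[OF tendsto_const[of c] LIMSEQ_inverse_real_of_nat]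
  by (simp add: divide_inverse)

text \<open>As the Gaussian in \<open>gauss_mean_fourier_square\<close> widens, the left-hand side increases to the integral of the
  square of the transform, while the inner average on the right-hand side tends to \<open>g y\<close>, by continuity
  and boundedness of \<open>g\<close>.\<close>

theorem plancherel:
  assumes g: "nice g"
  shows "integrable lborel (\<lambda>r. (norm (fourier g r))\<^sup>2)"
    and "(LINT r|lborel. (norm (fourier g r))\<^sup>2) = 2 * pi * (LINT t|lborel. (norm (g t))\<^sup>2)"
proof -
  have gi: "integrable lborel g" and gc: "continuous_on UNIV g" using g by (auto simp: nice_def)
  have [measurable]: "g \<in> borel_measurable borel" "fourier g \<in> borel_measurable borel"
    using gi by auto
  obtain B where B: "\<And>t. norm (g t) \<le> B" using g by (auto simp: nice_def bounded_iff)
  define F where "F m u = exp (- (u / real (Suc m))\<^sup>2 / 2) * (norm (fourier g u))\<^sup>2" for m u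
  define K where "K m y = (LINT h|lborel. of_real (exp (- h\<^sup>2 / 2)) * g (y + h / real (Suc m)))" for m y
  have Kint: "integrable lborel (\<lambda>h::real. B * exp (- h\<^sup>2 / 2))"
    using integral_exp_square by simp
  have K_lim: "(\<lambda>m. K m y) \<longlonglongrightarrow> of_real (sqrt (2 * pi)) * g y" for y
  proof -
    have "(\<lambda>m. K m y) \<longlonglongrightarrow> (LINT h|lborel. of_real (exp (- h\<^sup>2 / 2)) * g y)"
      unfolding K_def
    proof (rule integral_dominated_convergence[OF _ _ Kint])
      have "(\<lambda>m. g (y + h / real (Suc m))) \<longlonglongrightarrow> g (y + 0)" for h
        using gc by (intro isCont_tendsto_compose[where g = g] tendsto_intros LIMSEQ_divide_Suc)
                    (simp add: continuous_on_eq_continuous_at)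
      then show "AE h in lborel. (\<lambda>i. of_real (exp (- h\<^sup>2 / 2)) * g (y + h / real (Suc i)))
          \<longlonglongrightarrow> of_real (exp (- h\<^sup>2 / 2)) * g y"
        by (intro AE_I2 tendsto_mult tendsto_const) simp
      show "AE h in lborel. norm (of_real (exp (- h\<^sup>2 / 2)) * g (y + h / real (Suc i))) \<le> B * exp (- h\<^sup>2 / 2)" for i
        using B by (auto simp: norm_mult)
    qed auto
    also have "(LINT h|lborel. of_real (exp (- h\<^sup>2 / 2)) * g y) = of_real (sqrt (2 * pi)) * g y"
      using integral_exp_square by simp
    finally show ?thesis .
  qed
  have K_bound: "norm (K m y) \<le> B * sqrt (2 * pi)" for m y
  proof -
    have "norm (K m y) \<le> (LINT h|lborel. B * exp (- h\<^sup>2 / 2))"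
      unfolding K_def
    proof (rule Bochner_Integration.integral_norm_bound_integral[OF _ Kint])
      show *: "norm (of_real (exp (- h\<^sup>2 / 2)) * g (y + h / real (Suc m))) \<le> B * exp (- h\<^sup>2 / 2)" for h
        using B by (auto simp: norm_mult)
      show "integrable lborel (\<lambda>h. of_real (exp (- h\<^sup>2 / 2)) * g (y + h / real (Suc m)))"
      proof (rule Bochner_Integration.integrable_bound[OF Kint])
        show "AE h in lborel. norm (of_real (exp (- h\<^sup>2 / 2)) * g (y + h / real (Suc m))) \<le> norm (B * exp (- h\<^sup>2 / 2))"
          by (intro AE_I2 order_trans[OF *]) simp
      qed auto
    qed
    then show ?thesis using integral_exp_square by simp
  qed
  have Km [measurable]: "K m \<in> borel_measurable borel" for m
    unfolding K_def by measurable
  have lim: "(\<lambda>m. LINT y|lborel. cnj (g y) * K m y) \<longlonglongrightarrow>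
       (LINT y|lborel. cnj (g y) * (of_real (sqrt (2 * pi)) * g y))"
  proof (rule integral_dominated_convergence)
    show "integrable lborel (\<lambda>y. norm (g y) * (B * sqrt (2 * pi)))" using gi by simp
    show "AE y in lborel. (\<lambda>i. cnj (g y) * K i y) \<longlonglongrightarrow> cnj (g y) * (of_real (sqrt (2 * pi)) * g y)"
      by (intro AE_I2 tendsto_mult tendsto_const K_lim)
    show "AE y in lborel. norm (cnj (g y) * K i y) \<le> norm (g y) * (B * sqrt (2 * pi))" for i
      using K_bound by (auto simp: norm_mult intro!: mult_left_mono)
  qed auto
  have "(\<lambda>y. cnj (g y) * (of_real (sqrt (2 * pi)) * g y)) =
        (\<lambda>y. of_real (sqrt (2 * pi) * (norm (g y))\<^sup>2))"
    by (auto simp: complex_norm_square mult_ac simp del: of_real_power)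
  then have rhs: "(LINT y|lborel. cnj (g y) * (of_real (sqrt (2 * pi)) * g y)) =
      of_real (sqrt (2 * pi) * (LINT y|lborel. (norm (g y))\<^sup>2))"
    by (simp only: integral_complex_of_real integral_mult_right_zero)
  have F_int: "integrable lborel (F m)" for m
    unfolding F_def[abs_def] by (rule gauss_mean_fourier_square(1)[OF g]) simp
  have F_eq: "of_real (integral\<^sup>L lborel (F m)) = of_real (sqrt (2 * pi)) * (LINT y|lborel. cnj (g y) * K m y)" for m
    unfolding F_def[abs_def] K_def by (rule gauss_mean_fourier_square(2)[OF g]) simp
  have "(\<lambda>m. complex_of_real (integral\<^sup>L lborel (F m))) \<longlonglongrightarrow>
      of_real (sqrt (2 * pi)) * of_real (sqrt (2 * pi) * (LINT y|lborel. (norm (g y))\<^sup>2))"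
    unfolding F_eq by (intro tendsto_mult tendsto_const) (use lim rhs in simp)
  then have "(\<lambda>m. complex_of_real (integral\<^sup>L lborel (F m))) \<longlonglongrightarrow>
      of_real (sqrt (2 * pi) * (sqrt (2 * pi) * (LINT y|lborel. (norm (g y))\<^sup>2)))"
    by simp
  then have "(\<lambda>m. integral\<^sup>L lborel (F m)) \<longlonglongrightarrow> sqrt (2 * pi) * (sqrt (2 * pi) * (LINT y|lborel. (norm (g y))\<^sup>2))"
    unfolding tendsto_of_real_iff .
  then have F_lim: "(\<lambda>m. integral\<^sup>L lborel (F m)) \<longlonglongrightarrow> 2 * pi * (LINT y|lborel. (norm (g y))\<^sup>2)"
    by (simp add: mult.assoc[symmetric] del: of_nat_Suc)
  have mono: "AE u in lborel. mono (\<lambda>m. F m u)"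
  proof (intro AE_I2 monoI)
    fix u :: real and m n :: nat assume "m \<le> n"
    have "(u / real (Suc n))\<^sup>2 \<le> (u / real (Suc m))\<^sup>2"
      using \<open>m \<le> n\<close> unfolding power_divide
      by (intro divide_left_mono power_mono) auto
    then show "F m u \<le> F n u"
      unfolding F_def by (intro mult_right_mono) auto
  qed
  have pw: "AE u in lborel. (\<lambda>m. F m u) \<longlonglongrightarrow> (norm (fourier g u))\<^sup>2"
  proof (intro AE_I2)
    fix u :: real
    have "(\<lambda>m. F m u) \<longlonglongrightarrow> exp (- 0\<^sup>2 / 2) * (norm (fourier g u))\<^sup>2"
      unfolding F_def by (intro tendsto_intros LIMSEQ_divide_Suc)  auto
    then show "(\<lambda>m. F m u) \<longlonglongrightarrow> (norm (fourier g u))\<^sup>2" by simp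
  qed
  note mc = integral_monotone_convergence_nonneg[OF F_int mono _ pw F_lim]
  show "integrable lborel (\<lambda>r. (norm (fourier g r))\<^sup>2)"
    by (rule mc) (auto simp: F_def)
  show "(LINT r|lborel. (norm (fourier g r))\<^sup>2) = 2 * pi * (LINT t|lborel. (norm (g t))\<^sup>2)"
    by (rule mc) (auto simp: F_def)
qed

lemma nice_square_integrable:
  assumes "nice g" shows "integrable lborel (\<lambda>t. (norm (g t))\<^sup>2)"
proof -
  obtain B where B: "\<And>t. norm (g t) \<le> B" using assms by (auto simp: nice_def bounded_iff)
  show ?thesis
  proof (rule Bochner_Integration.integrable_bound)
    show "integrable lborel (\<lambda>t. B * norm (g t))" using assms by (simp add: nice_def)
    show "(\<lambda>t. (norm (g t))\<^sup>2) \<in> borel_measurable lborel" using assms by (auto simp: nice_def)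
    have "(norm (g t))\<^sup>2 \<le> \<bar>B\<bar> * norm (g t)" for t
      using mult_right_mono[OF order_trans[OF B abs_ge_self], of "norm (g t)" t]
      by (simp add: power2_eq_square)
    then show "AE t in lborel. norm ((norm (g t))\<^sup>2) \<le> norm (B * norm (g t))"
      by (simp add: abs_mult)
  qed
qed

lemma plateau_norm_positive:
  assumes f: "test_fun f" and one: "\<And>t. \<bar>t\<bar> \<le> 1 \<Longrightarrow> norm (f t) = 1"
  shows "0 < (LINT t|lborel. (norm (f t))\<^sup>2)"
proof -
  have "(LINT t|lborel. indicator {-1..1::real} t) \<le> (LINT t|lborel. (norm (f t))\<^sup>2)"
  proof (rule integral_mono)
    show "integrable lborel (indicator {-1..1::real} :: real \<Rightarrow> real)"
      by (rule integrable_real_indicator) auto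
    show "integrable lborel (\<lambda>t. (norm (f t))\<^sup>2)"
      by (rule nice_square_integrable[OF test_fun_nice[OF f]])
    show "indicator {-1..1} t \<le> (norm (f t))\<^sup>2" for t :: real
      by (cases "\<bar>t\<bar> \<le> 1") (auto simp: indicator_def one)
  qed
  then show ?thesis by simp
qed

lemma plancherel_nn:
  assumes g: "nice g"
  shows "(\<integral>\<^sup>+r. ennreal ((norm (fourier g r))\<^sup>2) \<partial>lborel) = ennreal (2 * pi) * (\<integral>\<^sup>+t. ennreal ((norm (g t))\<^sup>2) \<partial>lborel)"
  using plancherel[OF g] nice_square_integrable[OF g]
  by (simp add: nn_integral_eq_integral ennreal_mult)

lemma integral_derivative_eq_0:
  fixes g :: "real \<Rightarrow> complex"
  assumes der: "\<And>t. (g has_vector_derivative g' t) (at t)"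
    and g: "\<And>t. R < \<bar>t\<bar> \<Longrightarrow> g t = 0" and g': "\<And>t. R < \<bar>t\<bar> \<Longrightarrow> g' t = 0"
    and int: "integrable lborel g'"
  shows "(LINT t|lborel. g' t) = 0"
proof -
  define S where "S = \<bar>R\<bar> + 1"
  have "(g' has_integral (g S - g (- S))) {-S..S}"
    using der by (intro fundamental_theorem_of_calculus)
      (auto simp: S_def intro: has_vector_derivative_at_within)
  then have "(g' has_integral 0) {-S..S}"
    using g[of S] g[of "-S"] by (simp add: S_def)
  then have "(g' has_integral 0) UNIV"
    by (rule has_integral_on_superset) (use g' in \<open>auto simp: S_def\<close>)
  moreover have "(g' has_integral (LINT t|lborel. g' t)) UNIV"
    using has_integral_integral_lborel[OF int] by simp
  ultimately show ?thesis by (rule has_integral_unique[symmetric])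
qed

lemma fourier_derivative:
  assumes f: "test_fun f" and f': "test_fun f'" and der: "\<And>t. (f has_vector_derivative f' t) (at t)"
  shows "fourier f' r = \<i> * of_real r * fourier f r"
proof -
  obtain R where R: "\<And>t. R < \<bar>t\<bar> \<Longrightarrow> f t = 0" using f by (meson test_funE)
  have R': "\<And>t. R < \<bar>t\<bar> \<Longrightarrow> f' t = 0" by (rule vanishes_outside_derivative[OF der R])
  let ?e = "\<lambda>t. exp (- (\<i> * of_real t * of_real r))"
  have fi: "integrable lborel f" "integrable lborel f'"
    using test_fun_nice[OF f] test_fun_nice[OF f'] by (auto simp: nice_def)
  have e: "(?e has_vector_derivative - (\<i> * of_real r) * ?e t) (at t)" for t
  proof -
    have "((\<lambda>w. exp (- (\<i> * of_real r) * w)) has_field_derivative - (\<i> * of_real r) * exp (- (\<i> * of_real r) * of_real t)) (at (of_real t))"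
      by (auto intro!: derivative_eq_intros)
    from has_vector_derivative_real_field[OF this] show ?thesis by (simp add: mult_ac)
  qed
  have "(LINT t|lborel. f t * (- (\<i> * of_real r) * ?e t) + f' t * ?e t) = 0"
  proof (rule integral_derivative_eq_0[where R = R and g = "\<lambda>t. f t * ?e t"])
    show "((\<lambda>t. f t * ?e t) has_vector_derivative f t * (- (\<i> * of_real r) * ?e t) + f' t * ?e t) (at t)" for t
      by (rule has_vector_derivative_mult[OF der e])
    have "integrable lborel (\<lambda>t. - (\<i> * of_real r) * (f t * ?e t) + f' t * ?e t)"
      by (intro Bochner_Integration.integrable_add integrable_mult_right fourier_integrable fi)
    then show "integrable lborel (\<lambda>t. f t * (- (\<i> * of_real r) * ?e t) + f' t * ?e t)"
      by (simp add: mult_ac)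
  qed (use R R' in auto)
  moreover have "(LINT t|lborel. f t * (- (\<i> * of_real r) * ?e t) + f' t * ?e t) =
     - (\<i> * of_real r) * fourier f r + fourier f' r"
  proof -
    have "(LINT t|lborel. - (\<i> * of_real r) * (f t * ?e t) + f' t * ?e t) =
       - (\<i> * of_real r) * fourier f r + fourier f' r"
      unfolding fourier_def using fi by (simp add: fourier_integrable)
    then show ?thesis by (simp add: mult_ac)
  qed
  ultimately show ?thesis by simp
qed

section \<open>Weighted norms on test functions\<close>

lemma integrable_symmetric:
  fixes h :: "real \<Rightarrow> real"
  assumes [measurable]: "h \<in> borel_measurable borel"
    and h: "h integrable_on {0<..}" "\<And>x. 0 < x \<Longrightarrow> 0 \<le> h x"
  shows "integrable lborel (\<lambda>x. indicator (- {0}) x * h \<bar>x\<bar>)"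
proof -
  have "h absolutely_integrable_on {0<..}"
    by (rule nonnegative_absolutely_integrable_1[OF h(1)]) (use h in auto)
  then have p: "integrable lborel (\<lambda>x. indicator {0<..} x * h x)"
    unfolding set_integrable_def by (subst (asm) integrable_completion) auto
  from lborel_integrable_real_affine[OF this, of "-1" 0]
  have n: "integrable lborel (\<lambda>x. indicator {0<..} (- x) * h (- x))" by simp
  have "(\<lambda>x. indicator {0<..} x * h x + indicator {0<..} (- x) * h (- x)) =
        (\<lambda>x. indicator (- {0}) x * h \<bar>x\<bar>)"
    by (auto simp: indicator_def fun_eq_iff)
  with Bochner_Integration.integrable_add[OF p n] show ?thesis by simp
qed

text \<open>The common majorant of all weights below: the exponent is above \<open>-1\<close> at 0 and below \<open>-1\<close> at
  infinity.\<close>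

lemma integrable_powr_min:
  fixes a b :: real
  assumes "-1 < a" "a - b < -1"
  shows "integrable lborel (\<lambda>r::real. \<bar>r\<bar> powr a * min 1 (1 / \<bar>r\<bar> powr b))"
proof -
  have b: "b > 0" using assms by simp
  have 1: "(\<lambda>r::real. r powr a * min 1 (1 / r powr b)) integrable_on {0..1}"
  proof (rule integrable_eq)
    show "(\<lambda>r::real. r powr a) integrable_on {0..1}"
      using assms by (intro integrable_on_powr_from_0) auto
    show "r powr a = r powr a * min 1 (1 / r powr b)" if "r \<in> {0..1}" for r :: real
    proof (cases "r = 0")
      case False
      then have "0 < r powr b" "r powr b \<le> 1" using that b powr_le1[of b r] by auto
      then have "1 \<le> 1 / r powr b" by (simp add: le_divide_eq)
      then show ?thesis by simp
    qed simp
  qed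
  have 2: "(\<lambda>r::real. r powr a * min 1 (1 / r powr b)) integrable_on {1..}"
  proof (rule integrable_eq)
    have "((\<lambda>r::real. r powr (a - b)) has_integral -(1 powr (a - b + 1)) / (a - b + 1)) {1..}"
      using assms by (intro has_integral_powr_to_inf) auto
    then show "(\<lambda>r::real. r powr (a - b)) integrable_on {1..}" by blast
    show "r powr (a - b) = r powr a * min 1 (1 / r powr b)" if "r \<in> {1..}" for r :: real
    proof -
      have "1 \<le> r powr b" using that b by (auto intro: ge_one_powr_ge_zero)
      then have "1 / r powr b \<le> 1" by (simp add: divide_le_eq_1)
      then show ?thesis by (simp add: powr_diff)
    qed
  qed
  have "(\<lambda>r::real. r powr a * min 1 (1 / r powr b)) integrable_on ({0..1} \<union> {1..})"
  proof (rule integrable_Un[OF _ 1 2])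
    have "{0..1} \<inter> {1..} = {1::real}" by auto
    then show "negligible ({0..1} \<inter> {1..} :: real set)" by simp
  qed
  also have "{0..1} \<union> {1..} = {0::real..}" by auto
  finally have "(\<lambda>r::real. r powr a * min 1 (1 / r powr b)) integrable_on {0<..}"
  proof (rule integrable_spike_set)
    show "negligible {x \<in> {0..} - {0<..}. x powr a * min 1 (1 / x powr b) \<noteq> 0}"
      by (rule negligible_subset[OF negligible_sing[of 0]]) auto
    show "negligible {x \<in> {0<..} - {0..}. x powr a * min 1 (1 / x powr b) \<noteq> 0}"
      by (rule negligible_subset[OF negligible_sing[of 0]]) auto
  qed
  from integrable_symmetric[OF _ this]
  have "integrable lborel (\<lambda>r::real. indicator (- {0}) r * (\<bar>r\<bar> powr a * min 1 (1 / \<bar>r\<bar> powr b)))" by simp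
  also have "(\<lambda>r::real. indicator (- {0}) r * (\<bar>r\<bar> powr a * min 1 (1 / \<bar>r\<bar> powr b))) =
     (\<lambda>r. \<bar>r\<bar> powr a * min 1 (1 / \<bar>r\<bar> powr b))"
    by (auto simp: indicator_def fun_eq_iff)
  finally show ?thesis .
qed

lemma integrable_powr_min_square:
  assumes "-1/2 < \<alpha>" "\<alpha> < 1/2"
  shows "integrable lborel (\<lambda>r::real. \<bar>r\<bar> powr (2 * \<alpha>) * min 1 (1 / r\<^sup>2))"
proof -
  have "(\<lambda>r::real. \<bar>r\<bar> powr (2 * \<alpha>) * min 1 (1 / r\<^sup>2)) = (\<lambda>r. \<bar>r\<bar> powr (2 * \<alpha>) * min 1 (1 / \<bar>r\<bar> powr 2))"
  proof
    show "\<bar>r\<bar> powr (2 * \<alpha>) * min 1 (1 / r\<^sup>2) = \<bar>r\<bar> powr (2 * \<alpha>) * min 1 (1 / \<bar>r\<bar> powr 2)" for r :: real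
      by (cases "r = 0") auto
  qed
  then show ?thesis using integrable_powr_min[of "2 * \<alpha>" 2] assms by simp
qed

lemma test_fun_integrable: "test_fun f \<Longrightarrow> integrable lborel f"
  using test_fun_nice by (simp add: nice_def)

text \<open>The transform is bounded by the \<open>L^1\<close> norm of \<open>f\<close>, and \<open>r\<close> times the transform by that of the
  derivative.\<close>

lemma fourier_test_bound:
  assumes f: "test_fun f" and f': "test_fun f'" and der: "\<And>t. (f has_vector_derivative f' t) (at t)"
    and "r \<noteq> 0"
  shows "(norm (fourier f r))\<^sup>2 \<le>
    ((LINT t|lborel. norm (f t)) + (LINT t|lborel. norm (f' t)))\<^sup>2 * min 1 (1 / r\<^sup>2)"
proof -
  let ?A = "LINT t|lborel. norm (f t)" and ?B = "LINT t|lborel. norm (f' t)"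
  have pos: "0 \<le> ?A" "0 \<le> ?B" by (auto intro!: integral_nonneg_AE)
  have 1: "norm (fourier f r) \<le> ?A + ?B"
    using norm_fourier_le[of f r] pos by linarith
  have 2: "\<bar>r\<bar> * norm (fourier f r) \<le> ?A + ?B"
  proof -
    have "\<bar>r\<bar> * norm (fourier f r) \<le> ?B"
      using norm_fourier_le[of f' r] fourier_derivative[OF f f' der, of r] by (simp add: norm_mult)
    then show ?thesis using pos by linarith
  qed
  show ?thesis
  proof (cases "r\<^sup>2 \<le> 1")
    case True
    then have "min 1 (1 / r\<^sup>2) = 1" using \<open>r \<noteq> 0\<close> by (auto simp: min_def field_simps)
    then show ?thesis using power_mono[OF 1, of 2] by simp
  next
    case False
    then have "1 / r\<^sup>2 \<le> 1" by (simp add: divide_le_eq_1)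
    then have m: "min 1 (1 / r\<^sup>2) = 1 / r\<^sup>2" by simp
    have "r\<^sup>2 * (norm (fourier f r))\<^sup>2 \<le> (?A + ?B)\<^sup>2"
      using power_mono[OF 2, of 2] by (simp add: power_mult_distrib)
    then show ?thesis unfolding m using \<open>r \<noteq> 0\<close> by (simp add: pos_le_divide_eq mult.commute)
  qed
qed

lemma weight_sq: "(norm (of_real (\<bar>r\<bar> powr \<alpha>) * z))\<^sup>2 = \<bar>r\<bar> powr (2 * \<alpha>) * (norm (z::complex))\<^sup>2"
proof -
  have "(\<bar>r\<bar> powr \<alpha>)\<^sup>2 = \<bar>r\<bar> powr (2 * \<alpha>)"
    by (simp add: power2_eq_square flip: powr_add)
  then show ?thesis by (simp add: norm_mult power_mult_distrib)
qed

text \<open>The explicit bound serves to estimate the norms of functions that are cut off near a point.\<close>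

lemma test_norm_finite:
  assumes \<alpha>: "\<bar>\<alpha>\<bar> < 1/2"
    and f: "test_fun f" and f': "test_fun f'" and der: "\<And>t. (f has_vector_derivative f' t) (at t)"
  shows "integrable lborel (\<lambda>r. (norm (of_real (\<bar>r\<bar> powr \<alpha>) * fourier f r))\<^sup>2)"
    and "(test_norm \<alpha> f)\<^sup>2 \<le> ((LINT t|lborel. norm (f t)) + (LINT t|lborel. norm (f' t)))\<^sup>2 *
          (LINT r|lborel. \<bar>r\<bar> powr (2 * \<alpha>) * min 1 (1 / r\<^sup>2))"
proof -
  let ?N = "(LINT t|lborel. norm (f t)) + (LINT t|lborel. norm (f' t))"
  note [measurable] = fourier_measurable[OF test_fun_integrable[OF f]]
  have bd: "(norm (of_real (\<bar>r\<bar> powr \<alpha>) * fourier f r))\<^sup>2 \<le> ?N\<^sup>2 * (\<bar>r\<bar> powr (2 * \<alpha>) * min 1 (1 / r\<^sup>2))" for r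
  proof (cases "r = 0")
    case False
    have "\<bar>r\<bar> powr (2 * \<alpha>) * (norm (fourier f r))\<^sup>2 \<le> \<bar>r\<bar> powr (2 * \<alpha>) * (?N\<^sup>2 * min 1 (1 / r\<^sup>2))"
      by (intro mult_left_mono fourier_test_bound[OF f f' der False]) auto
    then show ?thesis unfolding weight_sq by (simp only: mult_ac)
  qed simp
  have k: "integrable lborel (\<lambda>r::real. ?N\<^sup>2 * (\<bar>r\<bar> powr (2 * \<alpha>) * min 1 (1 / r\<^sup>2)))"
    using \<alpha> by (intro integrable_mult_right integrable_powr_min_square) auto
  show I: "integrable lborel (\<lambda>r. (norm (of_real (\<bar>r\<bar> powr \<alpha>) * fourier f r))\<^sup>2)"
    by (rule Bochner_Integration.integrable_bound[OF k]) (use bd in \<open>auto intro: order_trans[OF _ abs_ge_self]\<close>)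
  have "(test_norm \<alpha> f)\<^sup>2 = (LINT r|lborel. (norm (of_real (\<bar>r\<bar> powr \<alpha>) * fourier f r))\<^sup>2)"
    unfolding test_norm_def by (intro real_sqrt_pow2 integral_nonneg_AE) simp
  also have "\<dots> \<le> (LINT r|lborel. ?N\<^sup>2 * (\<bar>r\<bar> powr (2 * \<alpha>) * min 1 (1 / r\<^sup>2)))"
    by (intro integral_mono I k bd)
  finally show "(test_norm \<alpha> f)\<^sup>2 \<le> ?N\<^sup>2 * (LINT r|lborel. \<bar>r\<bar> powr (2 * \<alpha>) * min 1 (1 / r\<^sup>2))"
    by simp
qed

lemma test_weight_integrable:
  assumes "\<bar>\<alpha>\<bar> < 1/2" "test_fun f"
  shows "integrable lborel (\<lambda>r. (norm (of_real (\<bar>r\<bar> powr \<alpha>) * fourier f r))\<^sup>2)"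
proof -
  obtain f' where "test_fun f'" "\<And>t. (f has_vector_derivative f' t) (at t)"
    using test_fun_has_derivative[OF assms(2)] by blast
  then show ?thesis using test_norm_finite(1)[OF assms(1,2)] by blast
qed

text \<open>Integrate \<open>(a + b)^2 \<le> (1 + \<theta>) a^2 + (1 + 1 / \<theta>) b^2\<close> with \<open>\<theta>\<close> the quotient of the two
  norms; adding a small \<open>e\<close> to both norms keeps this quotient meaningful.\<close>

lemma minkowski:
  fixes F G :: "real \<Rightarrow> complex"
  assumes F: "integrable lborel (\<lambda>r. (norm (F r))\<^sup>2)" and G: "integrable lborel (\<lambda>r. (norm (G r))\<^sup>2)"
    and [measurable]: "F \<in> borel_measurable borel" "G \<in> borel_measurable borel"
  shows "integrable lborel (\<lambda>r. (norm (F r) + norm (G r))\<^sup>2)"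
    and "sqrt (LINT r|lborel. (norm (F r) + norm (G r))\<^sup>2) \<le>
         sqrt (LINT r|lborel. (norm (F r))\<^sup>2) + sqrt (LINT r|lborel. (norm (G r))\<^sup>2)"
proof -
  let ?x = "sqrt (LINT r|lborel. (norm (F r))\<^sup>2)" and ?y = "sqrt (LINT r|lborel. (norm (G r))\<^sup>2)"
  have young: "(a + b)\<^sup>2 \<le> (1 + \<theta>) * a\<^sup>2 + (1 + 1 / \<theta>) * b\<^sup>2" if "\<theta> > 0" for a b \<theta> :: real
  proof -
    have "0 \<le> (\<theta> * a - b)\<^sup>2 / \<theta>" using that by simp
    then show ?thesis using that by (simp add: power2_eq_square field_simps)
  qed
  have dom: "integrable lborel (\<lambda>r. (1 + \<theta>) * (norm (F r))\<^sup>2 + (1 + 1 / \<theta>) * (norm (G r))\<^sup>2)" for \<theta>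
    by (intro Bochner_Integration.integrable_add integrable_mult_right F G)
  show I: "integrable lborel (\<lambda>r. (norm (F r) + norm (G r))\<^sup>2)"
    by (rule Bochner_Integration.integrable_bound[OF dom[of 1]])
       (use young[of 1] in \<open>auto intro!: AE_I2 order_trans[OF _ abs_ge_self]\<close>)
  have xy: "0 \<le> ?x" "0 \<le> ?y" by (auto intro!: integral_nonneg_AE)
  show "sqrt (LINT r|lborel. (norm (F r) + norm (G r))\<^sup>2) \<le> ?x + ?y"
  proof (rule field_le_epsilon)
    fix e :: real assume "e > 0"
    \<comment> \<open>The parameter \<open>\<theta> = Y / X\<close> turns the right-hand side into \<open>(X + Y)\<^sup>2\<close>.\<close>
    define X Y where "X = ?x + e / 2" and "Y = ?y + e / 2"
    have X: "X > 0" "Y > 0" using xy \<open>e > 0\<close> by (auto simp: X_def Y_def intro: add_nonneg_pos)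
    have "(LINT r|lborel. (norm (F r) + norm (G r))\<^sup>2) \<le>
       (LINT r|lborel. (1 + Y / X) * (norm (F r))\<^sup>2 + (1 + 1 / (Y / X)) * (norm (G r))\<^sup>2)"
      by (intro integral_mono I dom young) (use X in auto)
    also have "\<dots> = (1 + Y / X) * ?x\<^sup>2 + (1 + X / Y) * ?y\<^sup>2"
      by (subst Bochner_Integration.integral_add) (auto intro!: integrable_mult_right F G integral_nonneg_AE)
    also have "\<dots> \<le> (1 + Y / X) * X\<^sup>2 + (1 + X / Y) * Y\<^sup>2"
      using X xy \<open>e > 0\<close> by (intro add_mono mult_left_mono power_mono) (auto simp: X_def Y_def)
    also have "\<dots> = (X + Y)\<^sup>2"
      using X by (simp add: power2_eq_square field_simps)
    finally have "sqrt (LINT r|lborel. (norm (F r) + norm (G r))\<^sup>2) \<le> X + Y"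
      using X by (intro real_le_lsqrt) auto
    then show "sqrt (LINT r|lborel. (norm (F r) + norm (G r))\<^sup>2) \<le> ?x + ?y + e"
      by (simp add: X_def Y_def)
  qed
qed

lemma cauchy_schwarz:
  fixes F G :: "real \<Rightarrow> complex"
  assumes F: "integrable lborel (\<lambda>r. (norm (F r))\<^sup>2)" and G: "integrable lborel (\<lambda>r. (norm (G r))\<^sup>2)"
    and [measurable]: "F \<in> borel_measurable borel" "G \<in> borel_measurable borel"
  shows "integrable lborel (\<lambda>r. norm (F r) * norm (G r))"
    and "(LINT r|lborel. norm (F r) * norm (G r)) \<le>
         sqrt (LINT r|lborel. (norm (F r))\<^sup>2) * sqrt (LINT r|lborel. (norm (G r))\<^sup>2)"
proof -
  let ?x = "sqrt (LINT r|lborel. (norm (F r))\<^sup>2)" and ?y = "sqrt (LINT r|lborel. (norm (G r))\<^sup>2)"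
  note M = minkowski[OF assms]
  have eq: "norm (F r) * norm (G r) = 1/2 * ((norm (F r) + norm (G r))\<^sup>2 - (norm (F r))\<^sup>2 - (norm (G r))\<^sup>2)" for r
    by (simp add: power2_eq_square algebra_simps)
  have xy: "0 \<le> ?x" "0 \<le> ?y" by (auto intro!: integral_nonneg_AE)
  show "integrable lborel (\<lambda>r. norm (F r) * norm (G r))"
    unfolding eq by (intro integrable_mult_right Bochner_Integration.integrable_diff M F G)
  have "(LINT r|lborel. norm (F r) * norm (G r)) =
      1/2 * ((LINT r|lborel. (norm (F r) + norm (G r))\<^sup>2) - ?x\<^sup>2 - ?y\<^sup>2)"
    unfolding eq using M(1) F G by (simp add: integral_nonneg_AE)
  also have "\<dots> \<le> 1/2 * ((?x + ?y)\<^sup>2 - ?x\<^sup>2 - ?y\<^sup>2)"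
    using M(2) xy by (intro mult_left_mono diff_right_mono)
      (auto simp: real_sqrt_le_iff' intro!: sqrt_le_D)
  also have "\<dots> = ?x * ?y" by (simp add: power2_eq_square algebra_simps)
  finally show "(LINT r|lborel. norm (F r) * norm (G r)) \<le> ?x * ?y" .
qed


text \<open>A single family contains the norm of \<open>H_alpha\<close> (weight 1) and the norms with different constants on
  the two half-lines, so that each fact about extension to the completion is needed only once.\<close>

definition weight :: "real \<Rightarrow> (real \<Rightarrow> real) \<Rightarrow> bool" where
  "weight B c \<longleftrightarrow> c \<in> borel_measurable borel \<and> (\<forall>r. 0 \<le> c r \<and> c r \<le> B)"

definition wnorm :: "real \<Rightarrow> (real \<Rightarrow> real) \<Rightarrow> (real \<Rightarrow> complex) \<Rightarrow> real" where
  "wnorm \<alpha> c f = sqrt (LINT r|lborel. c r * (norm (of_real (\<bar>r\<bar> powr \<alpha>) * fourier f r))\<^sup>2)"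

lemma wnorm_sq:
  assumes "weight B c"
  shows "(wnorm \<alpha> c f)\<^sup>2 = (LINT r|lborel. c r * (norm (of_real (\<bar>r\<bar> powr \<alpha>) * fourier f r))\<^sup>2)"
  using assms unfolding wnorm_def weight_def by (intro real_sqrt_pow2 integral_nonneg_AE) auto

lemma wnorm_nonneg: "weight B c \<Longrightarrow> 0 \<le> wnorm \<alpha> c f"
  unfolding wnorm_def weight_def by (auto intro!: integral_nonneg_AE)

lemma test_norm_wnorm: "test_norm \<alpha> = wnorm \<alpha> (\<lambda>_. 1)"
  by (simp add: test_norm_def wnorm_def fun_eq_iff)

lemma weight_one: "weight 1 (\<lambda>_. 1)"
  by (simp add: weight_def)

lemma test_norm_nonneg: "0 \<le> test_norm \<alpha> f"
  using wnorm_nonneg[OF weight_one] by (simp add: test_norm_wnorm)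

lemma wnorm_cmult:
  "weight B c \<Longrightarrow> wnorm \<alpha> c (\<lambda>t. k * f t) = norm k * wnorm \<alpha> c f"
  by (simp add: wnorm_def fourier_cmult norm_mult power_mult_distrib mult.left_commute[of _ "(norm k)\<^sup>2"] real_sqrt_mult)

context
  fixes \<alpha> :: real
  assumes \<alpha>: "\<bar>\<alpha>\<bar> < 1/2"
begin

lemma wnorm_integrable:
  assumes "weight B c" "test_fun f"
  shows "integrable lborel (\<lambda>r. c r * (norm (of_real (\<bar>r\<bar> powr \<alpha>) * fourier f r))\<^sup>2)"
proof (rule Bochner_Integration.integrable_bound)
  note [measurable] = fourier_measurable[OF test_fun_integrable[OF assms(2)]]
  show "integrable lborel (\<lambda>r. B * (norm (of_real (\<bar>r\<bar> powr \<alpha>) * fourier f r))\<^sup>2)"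
    by (intro integrable_mult_right test_weight_integrable \<alpha> assms)
  show "(\<lambda>r. c r * (norm (of_real (\<bar>r\<bar> powr \<alpha>) * fourier f r))\<^sup>2) \<in> borel_measurable lborel"
    using assms(1) by (auto simp: weight_def)
  have "\<bar>c r\<bar> \<le> \<bar>B\<bar>" for r using assms(1) by (auto simp: weight_def intro: order_trans[OF _ abs_ge_self])
  then show "AE r in lborel. norm (c r * (norm (of_real (\<bar>r\<bar> powr \<alpha>) * fourier f r))\<^sup>2)
      \<le> norm (B * (norm (of_real (\<bar>r\<bar> powr \<alpha>) * fourier f r))\<^sup>2)"
    by (auto simp: abs_mult intro!: mult_right_mono)
qed

lemma wnorm_triangle:
  assumes c: "weight B c" and f: "test_fun f" "test_fun g"
  shows "wnorm \<alpha> c (\<lambda>t. f t + g t) \<le> wnorm \<alpha> c f + wnorm \<alpha> c g"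
proof -
  note [measurable] = fourier_measurable[OF test_fun_integrable[OF f(1)]] fourier_measurable[OF test_fun_integrable[OF f(2)]]
  have [measurable]: "c \<in> borel_measurable borel" and c0: "\<And>r. 0 \<le> c r" using c by (auto simp: weight_def)
  define F where "F f r = complex_of_real (sqrt (c r) * \<bar>r\<bar> powr \<alpha>) * fourier f r" for f r
  have F: "(norm (F f r))\<^sup>2 = c r * (norm (of_real (\<bar>r\<bar> powr \<alpha>) * fourier f r))\<^sup>2" for f r
    using c0 by (simp add: F_def norm_mult power_mult_distrib abs_mult)
  have add: "F (\<lambda>t. f t + g t) r = F f r + F g r" for r
    using f by (simp add: F_def fourier_add test_fun_integrable distrib_left)
  have [measurable]: "F f \<in> borel_measurable borel" "F g \<in> borel_measurable borel"
    unfolding F_def[abs_def] by measurable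
  note M = minkowski[of "F f" "F g", unfolded F, OF wnorm_integrable[OF c f(1)] wnorm_integrable[OF c f(2)]]
  have "wnorm \<alpha> c (\<lambda>t. f t + g t) = sqrt (LINT r|lborel. (norm (F f r + F g r))\<^sup>2)"
    by (simp add: wnorm_def F[symmetric] add)
  also have "\<dots> \<le> sqrt (LINT r|lborel. (norm (F f r) + norm (F g r))\<^sup>2)"
  proof (intro real_sqrt_le_mono integral_mono_AE')
    show "integrable lborel (\<lambda>r. (norm (F f r) + norm (F g r))\<^sup>2)"
      by (rule M(1)) auto
  qed (auto intro!: power_mono norm_triangle_ineq)
  also have "\<dots> \<le> wnorm \<alpha> c f + wnorm \<alpha> c g"
    unfolding wnorm_def by (rule M(2)) auto
  finally show ?thesis .
qed

lemma wnorm_diff_triangle: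
  assumes c: "weight B c" and f: "test_fun f" "test_fun g"
  shows "\<bar>wnorm \<alpha> c f - wnorm \<alpha> c g\<bar> \<le> wnorm \<alpha> c (\<lambda>t. f t - g t)"
proof -
  have "wnorm \<alpha> c f \<le> wnorm \<alpha> c (\<lambda>t. f t - g t) + wnorm \<alpha> c g"
    using wnorm_triangle[OF c test_fun_diff[OF f] f(2)] by simp
  moreover have "wnorm \<alpha> c g \<le> wnorm \<alpha> c (\<lambda>t. g t - f t) + wnorm \<alpha> c f"
    using wnorm_triangle[OF c test_fun_diff[OF f(2,1)] f(1)] by simp
  moreover have "wnorm \<alpha> c (\<lambda>t. g t - f t) = wnorm \<alpha> c (\<lambda>t. f t - g t)"
    using wnorm_cmult[OF c, of \<alpha> "-1" "\<lambda>t. f t - g t"] by simp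
  ultimately show ?thesis by linarith
qed

lemma wnorm_le:
  assumes c: "weight B c" and f: "test_fun f"
  shows "wnorm \<alpha> c f \<le> sqrt B * test_norm \<alpha> f"
proof -
  have "wnorm \<alpha> c f \<le> sqrt (LINT r|lborel. B * (norm (of_real (\<bar>r\<bar> powr \<alpha>) * fourier f r))\<^sup>2)"
    unfolding wnorm_def using c
    by (intro real_sqrt_le_mono integral_mono wnorm_integrable[OF c f] integrable_mult_right
          test_weight_integrable \<alpha> f mult_right_mono) (auto simp: weight_def)
  then show ?thesis by (simp add: real_sqrt_mult test_norm_def)
qed

end

section \<open>Pairing with distributions\<close>

lemma smooth_cnj:
  assumes "smooth f" shows "smooth (\<lambda>t. cnj (f t))"
proof (rule smooth_coinduct[where P = "\<lambda>g. \<exists>f. smooth f \<and> g = (\<lambda>t. cnj (f t))"])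
  fix g assume "\<exists>f. smooth f \<and> g = (\<lambda>t. cnj (f t))"
  then obtain f where f: "smooth f" and g: "g = (\<lambda>t. cnj (f t))" by blast
  obtain f' where "smooth f'" "\<And>t. (f has_vector_derivative f' t) (at t)"
    using f by (metis smooth_has_derivative)
  then show "\<exists>g'. (\<exists>f. smooth f \<and> g' = (\<lambda>t. cnj (f t))) \<and> (\<forall>t. (g has_vector_derivative g' t) (at t))"
    unfolding g
    by (intro exI[of _ "\<lambda>t. cnj (f' t)"])
       (auto intro: bounded_linear.has_vector_derivative[OF bounded_linear_cnj])
qed (use assms in blast)

lemma test_fun_cnj: "test_fun f \<Longrightarrow> test_fun (\<lambda>t. cnj (f t))"
  by (auto simp: test_fun_iff smooth_cnj)

lemma norm_add_sq:
  fixes a b :: complex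
  shows "(norm (a + b))\<^sup>2 = (norm a)\<^sup>2 + (norm b)\<^sup>2 + 2 * Re (a * cnj b)"
  unfolding cmod_power2 by (simp add: power2_eq_square algebra_simps)

text \<open>Polarise Plancherel's theorem with a constant \<open>c\<close> of modulus 1 that makes the pairing real and
  nonnegative.  On the Fourier side the weights \<open>\<bar>r\<bar> powr \<alpha>\<close> and \<open>\<bar>r\<bar> powr - \<alpha>\<close> cancel in the product,
  which leaves the Cauchy--Schwarz inequality.\<close>

lemma pairing_bound:
  assumes \<alpha>: "\<bar>\<alpha>\<bar> < 1/2" and f: "test_fun f" and \<phi>: "test_fun \<phi>"
  shows "norm (LINT t|lborel. f t * \<phi> t) \<le> 1 / (2 * pi) * test_norm \<alpha> f * test_norm (- \<alpha>) (\<lambda>t. cnj (\<phi> t))"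
proof -
  define g where "g t = cnj (\<phi> t)" for t
  have g: "test_fun g" unfolding g_def by (rule test_fun_cnj[OF \<phi>])
  define I where "I = (LINT t|lborel. f t * \<phi> t)"
  define c where "c = (if I = 0 then 1 else I / of_real (norm I))"
  have c: "norm c = 1" "cnj c * I = of_real (norm I)"
    by (auto simp: c_def norm_divide complex_norm_square[symmetric] power2_eq_square mult.commute[of "cnj _"])
  have cg: "test_fun (\<lambda>t. c * g t)" by (rule test_fun_cmult[OF g])
  define h where "h t = f t + c * g t" for t
  have h: "test_fun h" unfolding h_def by (rule test_fun_add[OF f cg])
  note int = test_fun_integrable[OF f] test_fun_integrable[OF g] test_fun_integrable[OF cg]
  note sqi = nice_square_integrable[OF test_fun_nice[OF f]] nice_square_integrable[OF test_fun_nice[OF g]]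
  note [measurable] = int[THEN fourier_measurable]
  obtain B where B: "\<And>t. norm (\<phi> t) \<le> B" using test_fun_nice[OF \<phi>] by (auto simp: nice_def bounded_iff)
  have prod: "integrable lborel (\<lambda>t. f t * \<phi> t)"
    by (rule integrable_times_bounded[OF int(1) _ B]) (use test_fun_integrable[OF \<phi>] in auto)
  have "(LINT t|lborel. (norm (h t))\<^sup>2) =
     (LINT t|lborel. (norm (f t))\<^sup>2 + (norm (g t))\<^sup>2 + 2 * Re (cnj c * (f t * \<phi> t)))"
    by (simp add: h_def norm_add_sq norm_mult c g_def mult_ac)
  also have "\<dots> = (LINT t|lborel. (norm (f t))\<^sup>2) + (LINT t|lborel. (norm (g t))\<^sup>2) + 2 * Re (cnj c * I)"
  proof -
    have G: "integrable lborel (\<lambda>t. cnj c * (f t * \<phi> t))" using prod by (rule integrable_mult_right)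
    have "(LINT t|lborel. Re (cnj c * (f t * \<phi> t))) = Re (cnj c * I)"
      unfolding I_def integral_Re[OF G] by (simp only: integral_mult_right_zero)
    then show ?thesis
      using sqi integrable_Re[OF G] by (simp del: times_complex.sel)
  qed
  finally have 1: "2 * norm I = (LINT t|lborel. (norm (h t))\<^sup>2) - (LINT t|lborel. (norm (f t))\<^sup>2) - (LINT t|lborel. (norm (g t))\<^sup>2)"
    by (simp add: c)
  define F where "F r = of_real (\<bar>r\<bar> powr \<alpha>) * fourier f r" for r
  define G where "G r = of_real (\<bar>r\<bar> powr - \<alpha>) * fourier g r" for r
  have [measurable]: "F \<in> borel_measurable borel" "G \<in> borel_measurable borel"
    unfolding F_def[abs_def] G_def[abs_def] by measurable
  have FG: "integrable lborel (\<lambda>r. norm (F r) * norm (G r))"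
      "(LINT r|lborel. norm (F r) * norm (G r)) \<le> test_norm \<alpha> f * test_norm (- \<alpha>) g"
    unfolding test_norm_def F_def[symmetric] G_def[symmetric]
    by (rule cauchy_schwarz; use \<alpha> f g test_weight_integrable[of \<alpha> f] test_weight_integrable[of "-\<alpha>" g] in \<open>simp add: F_def G_def\<close>)+
  note P = plancherel[OF test_fun_nice[OF h]] plancherel[OF test_fun_nice[OF f]] plancherel[OF test_fun_nice[OF g]]
  have "(LINT r|lborel. (norm (fourier h r))\<^sup>2) \<le>
      (LINT r|lborel. (norm (fourier f r))\<^sup>2 + (norm (fourier g r))\<^sup>2 + 2 * (norm (F r) * norm (G r)))"
  proof (rule integral_mono_AE)
    have pw: "(norm (fourier h r))\<^sup>2 \<le> (norm (fourier f r))\<^sup>2 + (norm (fourier g r))\<^sup>2 + 2 * (norm (F r) * norm (G r))"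
      if "r \<noteq> 0" for r
    proof -
      have "norm (F r) * norm (G r) = norm (fourier f r) * norm (fourier g r)"
      proof -
        have "\<bar>r\<bar> powr \<alpha> * \<bar>r\<bar> powr - \<alpha> = 1" using that by (simp flip: powr_add)
        then show ?thesis by (simp add: F_def G_def norm_mult algebra_simps)
      qed
      note 1 = this
      have 2: "Re (fourier f r * cnj (c * fourier g r)) \<le> norm (fourier f r) * norm (fourier g r)"
        by (rule order_trans[OF complex_Re_le_cmod]) (simp add: norm_mult c)
      show ?thesis
      proof -
        have "fourier h r = fourier f r + c * fourier g r"
          unfolding h_def[abs_def] using fourier_add[OF int(1,3)] by (simp add: fourier_cmult)
        then show ?thesis
          using 1 2 by (simp add: norm_add_sq norm_mult c del: times_complex.sel)
      qed
    qed
    show "AE r in lborel. (norm (fourier h r))\<^sup>2 \<le> (norm (fourier f r))\<^sup>2 + (norm (fourier g r))\<^sup>2 + 2 * (norm (F r) * norm (G r))"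
      using AE_lborel_singleton[of 0] by eventually_elim (rule pw)
  qed (use P FG in auto)
  also have "\<dots> = (LINT r|lborel. (norm (fourier f r))\<^sup>2) + (LINT r|lborel. (norm (fourier g r))\<^sup>2)
      + 2 * (LINT r|lborel. norm (F r) * norm (G r))"
    using P FG by simp
  finally have "2 * pi * (2 * norm I) \<le> 2 * (test_norm \<alpha> f * test_norm (- \<alpha>) g)"
    using FG(2) unfolding 1 P by (simp add: algebra_simps)
  then show ?thesis
    by (simp add: I_def g_def[abs_def] field_simps)
qed

lemma convolution_nice:
  assumes f: "nice f" and k: "nice k"
  shows "nice (\<lambda>t. LINT y|lborel. f y * k (t - y))"
    and "fourier (\<lambda>t. LINT y|lborel. f y * k (t - y)) r = fourier f r * fourier k r"
proof -
  have fi: "integrable lborel f" and ki: "integrable lborel k" and kc: "continuous_on UNIV k"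
    using f k by (auto simp: nice_def)
  have [measurable]: "f \<in> borel_measurable borel" "k \<in> borel_measurable borel" using fi ki by auto
  obtain B where B: "\<And>t. norm (k t) \<le> B" using k by (auto simp: nice_def bounded_iff)
  let ?c = "\<lambda>t. LINT y|lborel. f y * k (t - y)"
  have shift: "(LINT t|lborel. g (t - y)) = (LINT t|lborel. g t)"
      and shift_int: "integrable lborel (\<lambda>t. g (t - y)) \<longleftrightarrow> integrable lborel g"
    for g :: "real \<Rightarrow> 'a::{banach, second_countable_topology}" and y
    using lborel_integral_real_affine[of 1 g "-y"] lborel_integrable_real_affine_iff[of 1 g "-y"] by simp_all
  have I: "integrable (lborel \<Otimes>\<^sub>M lborel) (\<lambda>(y, t). f y * (k (t - y) * exp (- (\<i> * of_real t * of_real r))))" for r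
  proof (rule lborel_pair.Fubini_integrable)
    have "(LINT t|lborel. norm (f y * (k (t - y) * exp (- (\<i> * of_real t * of_real r))))) =
      norm (f y) * (LINT t|lborel. norm (k t))" for y
      using shift[of "\<lambda>t. norm (k t)" y] by (simp add: norm_mult)
    then show "integrable lborel (\<lambda>y. LINT t|lborel. norm (case (y, t) of (y, t) \<Rightarrow> f y * (k (t - y) * exp (- (\<i> * of_real t * of_real r)))))"
      using fi by (simp add: integrable_norm)
    have "integrable lborel (\<lambda>t. k (t - y) * exp (- (\<i> * of_real t * of_real r)))" for y
      by (rule fourier_integrable) (use ki shift_int in blast)
    then show "AE y in lborel. integrable lborel (\<lambda>t. case (y, t) of (y, t) \<Rightarrow> f y * (k (t - y) * exp (- (\<i> * of_real t * of_real r))))"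
      by simp
  qed measurable
  have ci: "integrable lborel ?c"
    using lborel_pair.integrable_snd[OF I[of 0]] by simp
  have dom: "norm (f y * k (t - y)) \<le> B * norm (f y)" for t y
    using mult_left_mono[OF B norm_ge_zero] by (simp add: norm_mult mult.commute)
  have Bf: "integrable lborel (\<lambda>y. B * norm (f y))" using fi by simp
  have "isCont ?c t" for t
  proof (unfold continuous_at_sequentially, intro allI impI)
    fix X :: "nat \<Rightarrow> real" assume X: "X \<longlonglongrightarrow> t"
    show "(?c \<circ> X) \<longlonglongrightarrow> ?c t"
      unfolding o_def
    proof (rule integral_dominated_convergence[OF _ _ Bf])
      have "(\<lambda>i. k (X i - y)) \<longlonglongrightarrow> k (t - y)" for y
        using kc by (intro isCont_tendsto_compose[where g = k] tendsto_intros X)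
                    (simp add: continuous_on_eq_continuous_at)
      then show "AE y in lborel. (\<lambda>i. f y * k (X i - y)) \<longlonglongrightarrow> f y * k (t - y)"
        by (intro AE_I2 tendsto_intros)
    qed (use dom in auto)
  qed
  moreover have "bounded (range ?c)"
  proof -
    have "norm (?c t) \<le> (LINT y|lborel. B * norm (f y))" for t
    proof (rule Bochner_Integration.integral_norm_bound_integral[OF _ Bf dom])
      show "integrable lborel (\<lambda>y. f y * k (t - y))"
        by (rule integrable_times_bounded[OF fi _ B]) auto
    qed
    then show ?thesis by (auto simp: bounded_iff)
  qed
  ultimately show "nice ?c"
    using ci by (simp add: nice_def continuous_at_imp_continuous_on)
  have "fourier ?c r = (LINT t|lborel. LINT y|lborel. f y * (k (t - y) * exp (- (\<i> * of_real t * of_real r))))"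
    unfolding fourier_def by (simp flip: mult.assoc)
  also have "\<dots> = (LINT y|lborel. LINT t|lborel. f y * (k (t - y) * exp (- (\<i> * of_real t * of_real r))))"
    using lborel_pair.Fubini_integral[OF I[of r]] by simp
  also have "\<dots> = (LINT y|lborel. f y * (exp (- (\<i> * of_real y * of_real r)) * fourier k r))"
  proof (rule Bochner_Integration.integral_cong[OF refl])
    fix y
    have "(LINT t|lborel. k (t - y) * exp (- (\<i> * of_real t * of_real r))) =
       (LINT t|lborel. exp (- (\<i> * of_real y * of_real r)) * (k (t - y) * exp (- (\<i> * of_real (t - y) * of_real r))))"
      by (rule Bochner_Integration.integral_cong[OF refl]) (simp add: algebra_simps flip: exp_add)
    also have "\<dots> = exp (- (\<i> * of_real y * of_real r)) * fourier k r"
      using shift[of "\<lambda>t. k t * exp (- (\<i> * of_real t * of_real r))" y] by (simp add: fourier_def)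
    finally show "(LINT t|lborel. f y * (k (t - y) * exp (- (\<i> * of_real t * of_real r)))) =
       f y * (exp (- (\<i> * of_real y * of_real r)) * fourier k r)"
      by simp
  qed
  also have "\<dots> = fourier f r * fourier k r"
    unfolding fourier_def by (simp flip: mult.assoc)
  finally show "fourier ?c r = fourier f r * fourier k r" .
qed


lemma nn_weight_eq:
  assumes "\<bar>\<alpha>\<bar> < 1/2" "test_fun f"
  shows "(\<integral>\<^sup>+r. ennreal (\<bar>r\<bar> powr (2 * \<alpha>) * (norm (fourier f r))\<^sup>2) \<partial>lborel) = ennreal ((test_norm \<alpha> f)\<^sup>2)"
proof -
  have "(test_norm \<alpha> f)\<^sup>2 = (LINT r|lborel. (norm (of_real (\<bar>r\<bar> powr \<alpha>) * fourier f r))\<^sup>2)"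
    unfolding test_norm_def by (intro real_sqrt_pow2 integral_nonneg_AE) simp
  then show ?thesis
    using nn_integral_eq_integral[OF test_weight_integrable[OF assms]] by (simp add: weight_sq)
qed

text \<open>The Littlewood--Paley identity.  By Plancherel's theorem the integral over \<open>t\<close> is, up to a constant,
  that of \<open>s^2\<close> times the squares of the transforms of \<open>f\<close> at \<open>r\<close> and of \<open>\<psi>\<close> at \<open>r s\<close>.  Substituting
  \<open>v = r s\<close> in the integral over \<open>s\<close> leaves the weight \<open>\<bar>r\<bar> powr (2 * \<alpha>)\<close> and a constant, the
  integral of the function \<open>q\<close> in the proof.  It is finite because the transform of \<open>\<psi>\<close>, the derivative of a test function, is \<open>O(v)\<close>
  at 0 and \<open>O(1 / v)\<close> at infinity.  The point of the identity is that it expresses the norm through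
  the values of the distribution \<open>f\<close> at test functions.\<close>

lemma square_function:
  assumes \<alpha>: "\<bar>\<alpha>\<bar> < 1/2"
  obtains \<psi> :: "real \<Rightarrow> complex" and K :: real where "test_fun \<psi>" "K > 0"
    "\<And>f. test_fun f \<Longrightarrow> (\<lambda>s. \<integral>\<^sup>+t. ennreal ((norm (LINT y|lborel. f y * \<psi> ((t - y) / s)))\<^sup>2) \<partial>lborel) \<in> borel_measurable borel"
    "\<And>f. test_fun f \<Longrightarrow>
       (\<integral>\<^sup>+s. ennreal (\<bar>s\<bar> powr (- 2 * \<alpha> - 3)) * (\<integral>\<^sup>+t. ennreal ((norm (LINT y|lborel. f y * \<psi> ((t - y) / s)))\<^sup>2) \<partial>lborel) \<partial>lborel) =
       ennreal (K * (test_norm \<alpha> f)\<^sup>2)"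
proof -
  obtain w :: "real \<Rightarrow> real" where w: "test_fun (\<lambda>t. of_real (w t))"
    "\<And>t. \<bar>t\<bar> \<le> 1 \<Longrightarrow> w t = 1" "\<And>t. 3 < \<bar>t\<bar> \<Longrightarrow> w t = 0" using plateau_exists by blast
  let ?w = "\<lambda>t. complex_of_real (w t)"
  obtain \<psi> where \<psi>: "test_fun \<psi>" and w': "\<And>t. (?w has_vector_derivative \<psi> t) (at t)"
    using test_fun_has_derivative[OF w(1)] by blast
  obtain \<psi>' where \<psi>': "test_fun \<psi>'" "\<And>t. (\<psi> has_vector_derivative \<psi>' t) (at t)"
    using test_fun_has_derivative[OF \<psi>] by blast
  have F\<psi>: "fourier \<psi> r = \<i> * of_real r * fourier ?w r" for r
    by (rule fourier_derivative[OF w(1) \<psi> w'])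
  have [measurable]: "fourier \<psi> \<in> borel_measurable borel"
    by (intro fourier_measurable test_fun_integrable \<psi>)
  define q where "q v = \<bar>v\<bar> powr (- 2 * \<alpha> - 1) * (norm (fourier \<psi> v))\<^sup>2" for v :: real
  have [measurable]: "q \<in> borel_measurable borel" unfolding q_def[abs_def] by measurable
  have q0: "0 \<le> q v" for v by (simp add: q_def)
  define N where "N = ((LINT t|lborel. norm (?w t)) + (LINT t|lborel. norm (\<psi> t))) +
       ((LINT t|lborel. norm (\<psi> t)) + (LINT t|lborel. norm (\<psi>' t)))"
  have q_int: "integrable lborel q"
  proof (rule Bochner_Integration.integrable_bound)
    show "integrable lborel (\<lambda>v::real. N\<^sup>2 * (\<bar>v\<bar> powr (2 * (- \<alpha>)) * min 1 (1 / v\<^sup>2)))"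
      using \<alpha> by (intro integrable_mult_right integrable_powr_min_square) auto
    have "q v \<le> N\<^sup>2 * (\<bar>v\<bar> powr (2 * (- \<alpha>)) * min 1 (1 / v\<^sup>2))" for v
    proof (cases "v = 0")
      case False
      let ?m = "min 1 (1 / v\<^sup>2)"
      have pos: "0 \<le> (LINT t|lborel. norm (?w t))" "0 \<le> (LINT t|lborel. norm (\<psi> t))" "0 \<le> (LINT t|lborel. norm (\<psi>' t))"
        by (auto intro!: integral_nonneg_AE)
      have m0: "0 \<le> ?m" by simp
      have 1: "(norm (fourier ?w v))\<^sup>2 \<le> N\<^sup>2 * ?m"
        using pos by (intro order_trans[OF fourier_test_bound[OF w(1) \<psi> w' False]] mult_right_mono power_mono)
           (auto simp: N_def)
      have 2: "(norm (fourier \<psi> v))\<^sup>2 \<le> N\<^sup>2 * ?m"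
        using pos by (intro order_trans[OF fourier_test_bound[OF \<psi> \<psi>' False]] mult_right_mono power_mono)
           (auto simp: N_def)
      \<comment> \<open>One factor \<open>\<bar>v\<bar>\<close> of decay at 0 suffices: it lowers the exponent \<open>- 2 * \<alpha> - 1\<close> of the weight to \<open>- 2 * \<alpha>\<close>.\<close>
      have "(norm (fourier \<psi> v))\<^sup>2 \<le> \<bar>v\<bar> * (N\<^sup>2 * ?m)"
      proof (cases "\<bar>v\<bar> \<le> 1")
        case True
        have "(norm (fourier \<psi> v))\<^sup>2 = \<bar>v\<bar> * (\<bar>v\<bar> * (norm (fourier ?w v))\<^sup>2)"
          by (simp add: F\<psi> norm_mult power_mult_distrib power2_eq_square)
        also have "\<dots> \<le> \<bar>v\<bar> * (1 * (N\<^sup>2 * ?m))"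
          by (intro mult_left_mono mult_mono 1 True) (auto intro: mult_nonneg_nonneg)
        finally show ?thesis by simp
      next
        case False
        then have "1 * (N\<^sup>2 * ?m) \<le> \<bar>v\<bar> * (N\<^sup>2 * ?m)"
          by (intro mult_right_mono) (auto intro: mult_nonneg_nonneg)
        with 2 show ?thesis by simp
      qed
      then have "q v \<le> \<bar>v\<bar> powr (- 2 * \<alpha> - 1) * (\<bar>v\<bar> * (N\<^sup>2 * ?m))"
        unfolding q_def by (intro mult_left_mono) auto
      also have "\<bar>v\<bar> powr (- 2 * \<alpha> - 1) * \<bar>v\<bar> = \<bar>v\<bar> powr (2 * (- \<alpha>))"
        using False by (simp add: powr_diff)
      then have "\<bar>v\<bar> powr (- 2 * \<alpha> - 1) * (\<bar>v\<bar> * (N\<^sup>2 * ?m)) = N\<^sup>2 * (\<bar>v\<bar> powr (2 * (- \<alpha>)) * ?m)"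
        by (simp only: mult.assoc[symmetric]) (simp only: mult_ac)
      finally show ?thesis .
    qed (simp add: q_def)
    then show "AE v in lborel. norm (q v) \<le> norm (N\<^sup>2 * (\<bar>v\<bar> powr (2 * (- \<alpha>)) * min 1 (1 / v\<^sup>2)))"
      using q0 by (intro AE_I2) (auto intro: order_trans[OF _ abs_ge_self])
  qed simp
  define K where "K = (LINT v|lborel. q v)"
  \<comment> \<open>If the constant vanished, the plateau \<open>w\<close> would have a transform that is 0 almost everywhere.\<close>
  have "K \<noteq> 0"
  proof
    assume "K = 0"
    then have "AE v in lborel. q v = 0"
      unfolding K_def using integral_nonneg_eq_0_iff_AE[OF q_int] q0 by simp
    then have "AE v in lborel. (norm (fourier ?w v))\<^sup>2 = 0"
      using AE_lborel_singleton[of 0]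
      by eventually_elim (auto simp: q_def F\<psi>)
    then have "(LINT v|lborel. (norm (fourier ?w v))\<^sup>2) = 0"
      using integral_nonneg_eq_0_iff_AE[OF plancherel(1)[OF test_fun_nice[OF w(1)]]] by simp
    then have "(LINT v|lborel. (norm (?w v))\<^sup>2) = 0"
      using plancherel(2)[OF test_fun_nice[OF w(1)]] by simp
    moreover have "0 < (LINT v|lborel. (norm (?w v))\<^sup>2)"
      by (rule plateau_norm_positive[OF w(1)]) (simp add: w(2))
    ultimately show False by simp
  qed
  moreover have "K \<ge> 0" unfolding K_def using q0 by (intro integral_nonneg_AE) auto
  ultimately have K: "K > 0" by simp
  have Kq: "(\<integral>\<^sup>+v. ennreal (q v) \<partial>lborel) = ennreal K"
    unfolding K_def by (rule nn_integral_eq_integral[OF q_int]) (simp add: q0)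
  define A where "A f s = (\<integral>\<^sup>+r. ennreal (\<bar>s\<bar> powr (- 2 * \<alpha> - 1) * (norm (fourier f r))\<^sup>2 * (norm (fourier \<psi> (r * s)))\<^sup>2) \<partial>lborel)" for f s
  define C where "C f s = (\<integral>\<^sup>+t. ennreal ((norm (LINT y|lborel. f y * \<psi> ((t - y) / s)))\<^sup>2) \<partial>lborel)" for f s
  have CA: "ennreal (2 * pi) * C f s = (\<integral>\<^sup>+r. ennreal (s\<^sup>2 * ((norm (fourier f r))\<^sup>2 * (norm (fourier \<psi> (r * s)))\<^sup>2)) \<partial>lborel)"
    if f: "test_fun f" and "s \<noteq> 0" for f s
  proof -
    define k where "k t = \<psi> (1 / s * t + 0)" for t
    have k: "test_fun k" unfolding k_def[abs_def] by (rule test_fun_affine[OF \<psi>]) (use \<open>s \<noteq> 0\<close> in simp)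
    have Fk: "(norm (fourier k r))\<^sup>2 = s\<^sup>2 * (norm (fourier \<psi> (r * s)))\<^sup>2" for r
      unfolding k_def[abs_def] using \<open>s \<noteq> 0\<close>
      by (subst fourier_affine) (auto simp: norm_mult power_mult_distrib)
    have "C f s = (\<integral>\<^sup>+t. ennreal ((norm (LINT y|lborel. f y * k (t - y)))\<^sup>2) \<partial>lborel)"
      by (simp add: C_def k_def)
    then show ?thesis
      using plancherel_nn[OF convolution_nice(1)[OF test_fun_nice[OF f] test_fun_nice[OF k]]]
        convolution_nice(2)[OF test_fun_nice[OF f] test_fun_nice[OF k]]
      by (simp add: norm_mult power_mult_distrib Fk mult.left_commute)
  qed
  have wCA: "ennreal (\<bar>s\<bar> powr (- 2 * \<alpha> - 3)) * C f s = ennreal (1 / (2 * pi)) * A f s"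
    if f: "test_fun f" and "s \<noteq> 0" for f s
  proof -
    have [measurable]: "fourier f \<in> borel_measurable borel" by (intro fourier_measurable test_fun_integrable f)
    have "ennreal (\<bar>s\<bar> powr (- 2 * \<alpha> - 3)) * (ennreal (2 * pi) * C f s) = A f s"
      unfolding CA[OF that] A_def
    proof (subst nn_integral_cmult[symmetric], measurable, intro nn_integral_cong)
      fix r
      have "\<bar>s\<bar> powr (- 2 * \<alpha> - 3) * s\<^sup>2 = \<bar>s\<bar> powr (- 2 * \<alpha> - 1)"
      proof -
        have "- 2 * \<alpha> - 1 = (- 2 * \<alpha> - 3) + 2" by simp
        then have "\<bar>s\<bar> powr (- 2 * \<alpha> - 3) * \<bar>s\<bar> powr 2 = \<bar>s\<bar> powr (- 2 * \<alpha> - 1)"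
          by (simp only: powr_add)
        moreover have "\<bar>s\<bar> powr 2 = s\<^sup>2" using \<open>s \<noteq> 0\<close> by simp
        ultimately show ?thesis by (simp only:)
      qed
      then show "ennreal (\<bar>s\<bar> powr (- 2 * \<alpha> - 3)) * ennreal (s\<^sup>2 * ((norm (fourier f r))\<^sup>2 * (norm (fourier \<psi> (r * s)))\<^sup>2)) =
         ennreal (\<bar>s\<bar> powr (- 2 * \<alpha> - 1) * (norm (fourier f r))\<^sup>2 * (norm (fourier \<psi> (r * s)))\<^sup>2)"
        by (simp flip: ennreal_mult' mult.assoc)
    qed
    then have "ennreal (1 / (2 * pi)) * A f s = ennreal (1 / (2 * pi)) * (ennreal (2 * pi) * (ennreal (\<bar>s\<bar> powr (- 2 * \<alpha> - 3)) * C f s))"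
      by (simp add: mult.left_commute)
    also have "\<dots> = ennreal (\<bar>s\<bar> powr (- 2 * \<alpha> - 3)) * C f s"
      by (simp add: mult.assoc[symmetric] flip: ennreal_mult')
    finally show ?thesis by simp
  qed
  have Cm: "C f \<in> borel_measurable borel" if f: "test_fun f" for f
  proof -
    have [measurable]: "fourier f \<in> borel_measurable borel" by (intro fourier_measurable test_fun_integrable f)
    have "C f s = (if s = 0 then C f 0 else ennreal (1 / (2 * pi)) *
        (\<integral>\<^sup>+r. ennreal (s\<^sup>2 * ((norm (fourier f r))\<^sup>2 * (norm (fourier \<psi> (r * s)))\<^sup>2)) \<partial>lborel))" for s
    proof (cases "s = 0")
      case False
      have "C f s = ennreal (1 / (2 * pi)) * (ennreal (2 * pi) * C f s)"
        by (simp add: mult.assoc[symmetric] flip: ennreal_mult')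
      then show ?thesis using CA[OF f False] False by simp
    qed simp
    then have "C f = (\<lambda>s. if s = 0 then C f 0 else ennreal (1 / (2 * pi)) *
        (\<integral>\<^sup>+r. ennreal (s\<^sup>2 * ((norm (fourier f r))\<^sup>2 * (norm (fourier \<psi> (r * s)))\<^sup>2)) \<partial>lborel))" by blast
    also have "\<dots> \<in> borel_measurable borel" by measurable
    finally show ?thesis .
  qed
  \<comment> \<open>The order of integration is exchanged, and \<open>v = r s\<close> is substituted for fixed \<open>r\<close>.\<close>
  have main: "(\<integral>\<^sup>+s. ennreal (\<bar>s\<bar> powr (- 2 * \<alpha> - 3)) * C f s \<partial>lborel) = ennreal (K / (2 * pi) * (test_norm \<alpha> f)\<^sup>2)"
    if f: "test_fun f" for f
  proof -
    have [measurable]: "fourier f \<in> borel_measurable borel" by (intro fourier_measurable test_fun_integrable f)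
    have "(\<integral>\<^sup>+s. ennreal (\<bar>s\<bar> powr (- 2 * \<alpha> - 3)) * C f s \<partial>lborel) = (\<integral>\<^sup>+s. ennreal (1 / (2 * pi)) * A f s \<partial>lborel)"
      by (intro nn_integral_cong_AE eventually_mono[OF AE_lborel_singleton[of 0]] wCA f)
    also have "\<dots> = ennreal (1 / (2 * pi)) * (\<integral>\<^sup>+s. A f s \<partial>lborel)"
      unfolding A_def by (intro nn_integral_cmult) measurable
    also have "(\<integral>\<^sup>+s. A f s \<partial>lborel) = (\<integral>\<^sup>+r. \<integral>\<^sup>+s. ennreal (\<bar>s\<bar> powr (- 2 * \<alpha> - 1) * (norm (fourier f r))\<^sup>2 * (norm (fourier \<psi> (r * s)))\<^sup>2) \<partial>lborel \<partial>lborel)"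
      unfolding A_def by (rule lborel_pair.Fubini') measurable
    also have "\<dots> = (\<integral>\<^sup>+r. ennreal (\<bar>r\<bar> powr (2 * \<alpha>) * (norm (fourier f r))\<^sup>2) * ennreal K \<partial>lborel)"
    proof (intro nn_integral_cong_AE eventually_mono[OF AE_lborel_singleton[of 0]])
      fix r :: real assume "r \<noteq> 0"
      have "ennreal K = ennreal \<bar>r\<bar> * (\<integral>\<^sup>+s. ennreal (q (0 + r * s)) \<partial>lborel)"
        unfolding Kq[symmetric] using \<open>r \<noteq> 0\<close> by (intro nn_integral_real_affine) auto
      then have "ennreal (\<bar>r\<bar> powr (2 * \<alpha>) * (norm (fourier f r))\<^sup>2) * ennreal K =
         (\<integral>\<^sup>+s. ennreal (\<bar>r\<bar> powr (2 * \<alpha>) * (norm (fourier f r))\<^sup>2) * (ennreal \<bar>r\<bar> * ennreal (q (r * s))) \<partial>lborel)"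
        by (simp add: nn_integral_cmult)
      also have "\<dots> = (\<integral>\<^sup>+s. ennreal (\<bar>s\<bar> powr (- 2 * \<alpha> - 1) * (norm (fourier f r))\<^sup>2 * (norm (fourier \<psi> (r * s)))\<^sup>2) \<partial>lborel)"
      proof (intro nn_integral_cong)
        fix s
        have "\<bar>r\<bar> powr (2 * \<alpha>) * \<bar>r\<bar> * \<bar>r\<bar> powr (- 2 * \<alpha> - 1) = 1"
          using powr_add[of "\<bar>r\<bar>" "2 * \<alpha> + 1" "- 2 * \<alpha> - 1"] powr_add[of "\<bar>r\<bar>" "2 * \<alpha>" 1] \<open>r \<noteq> 0\<close>
          by simp
        moreover have "q (r * s) = \<bar>r\<bar> powr (- 2 * \<alpha> - 1) * \<bar>s\<bar> powr (- 2 * \<alpha> - 1) * (norm (fourier \<psi> (r * s)))\<^sup>2"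
          by (simp add: q_def abs_mult powr_mult)
        moreover have "a * F * (b * (c * d * P)) = (a * b * c) * (d * F * P)" for a b c d F P :: real
          by (simp add: mult_ac)
        ultimately have "\<bar>r\<bar> powr (2 * \<alpha>) * (norm (fourier f r))\<^sup>2 * (\<bar>r\<bar> * q (r * s)) =
            \<bar>s\<bar> powr (- 2 * \<alpha> - 1) * (norm (fourier f r))\<^sup>2 * (norm (fourier \<psi> (r * s)))\<^sup>2"
          by (simp only: mult_1_left)
        then show "ennreal (\<bar>r\<bar> powr (2 * \<alpha>) * (norm (fourier f r))\<^sup>2) * (ennreal \<bar>r\<bar> * ennreal (q (r * s))) =
           ennreal (\<bar>s\<bar> powr (- 2 * \<alpha> - 1) * (norm (fourier f r))\<^sup>2 * (norm (fourier \<psi> (r * s)))\<^sup>2)"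
          using q0 by (simp flip: ennreal_mult)
      qed
      finally show "(\<integral>\<^sup>+s. ennreal (\<bar>s\<bar> powr (- 2 * \<alpha> - 1) * (norm (fourier f r))\<^sup>2 * (norm (fourier \<psi> (r * s)))\<^sup>2) \<partial>lborel) =
        ennreal (\<bar>r\<bar> powr (2 * \<alpha>) * (norm (fourier f r))\<^sup>2) * ennreal K" by simp
    qed
    also have "\<dots> = ennreal ((test_norm \<alpha> f)\<^sup>2) * ennreal K"
      by (subst nn_integral_multc) (simp_all add: nn_weight_eq[OF \<alpha> f])
    finally show ?thesis
      using K by (simp add: mult_ac flip: ennreal_mult)
  qed
  show ?thesis
  proof (rule that[OF \<psi>, of "K / (2 * pi)"])
    show "K / (2 * pi) > 0" using K by simp
  qed (use Cm main in \<open>unfold C_def, blast+\<close>)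
qed

lemma liminf_ennreal_le:
  fixes u :: "nat \<Rightarrow> ennreal"
  assumes "\<And>m. N \<le> m \<Longrightarrow> u m \<le> c"
  shows "liminf u \<le> c"
proof -
  have "liminf u \<le> liminf (\<lambda>_. c)"
    by (rule Liminf_mono) (use assms eventually_sequentially in blast)
  then show ?thesis by (simp add: Liminf_const)
qed

text \<open>The completion embeds into the distributions.  Since the distributions tend to 0, the square
  function of \<open>f n\<close> is the limit of those of \<open>f n - f m\<close> as \<open>m\<close> grows.  Fatou's lemma, applied to both
  integrals, bounds the norm of \<open>f n\<close> by the lower limit of the norms of the differences.\<close>

lemma distribution_null_imp_norm_null:
  assumes \<alpha>: "\<bar>\<alpha>\<bar> < 1/2" and f: "\<And>n. test_fun (f n)"
    and cauchy: "\<And>e. e > 0 \<Longrightarrow> \<exists>N. \<forall>m\<ge>N. \<forall>n\<ge>N. test_norm \<alpha> (\<lambda>t. f m t - f n t) < e"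
    and null: "\<And>\<phi>. test_fun \<phi> \<Longrightarrow> (\<lambda>n. LINT t|lborel. f n t * \<phi> t) \<longlonglongrightarrow> 0"
  shows "(\<lambda>n. test_norm \<alpha> (f n)) \<longlonglongrightarrow> 0"
proof -
  obtain \<psi> K where \<psi>: "test_fun \<psi>" and K: "K > 0"
    and meas: "\<And>f. test_fun f \<Longrightarrow> (\<lambda>s. \<integral>\<^sup>+t. ennreal ((norm (LINT y|lborel. f y * \<psi> ((t - y) / s)))\<^sup>2) \<partial>lborel) \<in> borel_measurable borel"
    and main: "\<And>f. test_fun f \<Longrightarrow>
       (\<integral>\<^sup>+s. ennreal (\<bar>s\<bar> powr (- 2 * \<alpha> - 3)) * (\<integral>\<^sup>+t. ennreal ((norm (LINT y|lborel. f y * \<psi> ((t - y) / s)))\<^sup>2) \<partial>lborel) \<partial>lborel) =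
       ennreal (K * (test_norm \<alpha> f)\<^sup>2)"
    using square_function[OF \<alpha>] by blast
  define c where "c f s t = (LINT y|lborel. f y * \<psi> ((t - y) / s))" for f s t
  define C where "C f s = (\<integral>\<^sup>+t. ennreal ((norm (c f s t))\<^sup>2) \<partial>lborel)" for f s
  define w where "w s = ennreal (\<bar>s\<bar> powr (- 2 * \<alpha> - 3))" for s :: real
  have Cm: "C f \<in> borel_measurable borel" if "test_fun f" for f
    using meas[OF that] by (simp add: C_def[abs_def] c_def)
  have J: "(\<integral>\<^sup>+s. w s * C f s \<partial>lborel) = ennreal (K * (test_norm \<alpha> f)\<^sup>2)" if "test_fun f" for f
    using main[OF that] by (simp add: C_def c_def w_def)
  have \<psi>s: "test_fun (\<lambda>y. \<psi> ((t - y) / s))" if "s \<noteq> 0" for s t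
    using test_fun_affine[OF \<psi>, of "- 1 / s" "t / s"] that by (simp add: diff_divide_distrib)
  have int: "integrable lborel (\<lambda>y. f y * \<psi> ((t - y) / s))" if f: "test_fun f" and s: "s \<noteq> 0" for f s t
  proof -
    obtain B where "\<And>y. norm (\<psi> ((t - y) / s)) \<le> B"
      using test_fun_nice[OF \<psi>s[OF s]] by (auto simp: nice_def bounded_iff)
    then show ?thesis
      by (rule integrable_times_bounded[OF test_fun_integrable[OF f], rotated])
         (use test_fun_integrable[OF \<psi>s[OF s]] in auto)
  qed
  have cm: "(\<lambda>t. c g s t) \<in> borel_measurable borel" if g: "test_fun g" and s: "s \<noteq> 0" for g s
  proof -
    have "test_fun (\<lambda>t. \<psi> (1 / s * t + 0))" using s by (intro test_fun_affine \<psi>) auto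
    from convolution_nice(1)[OF test_fun_nice[OF g] test_fun_nice[OF this]]
    show ?thesis by (auto simp: nice_def c_def)
  qed
  have wC: "w s * C g s = (\<integral>\<^sup>+t. ennreal (\<bar>s\<bar> powr (- 2 * \<alpha> - 3) * (norm (c g s t))\<^sup>2) \<partial>lborel)"
    if "test_fun g" and "s \<noteq> 0" for g s
    unfolding C_def w_def using cm[OF that]
    by (subst nn_integral_cmult[symmetric]) (auto simp: ennreal_mult)
  have fatou: "w s * C (f n) s \<le> liminf (\<lambda>m. w s * C (\<lambda>t. f n t - f m t) s)" if s: "s \<noteq> 0" for n s
  proof -
    let ?p = "\<bar>s\<bar> powr (- 2 * \<alpha> - 3)"
    have "(\<lambda>m. ennreal (?p * (norm (c (\<lambda>t. f n t - f m t) s t))\<^sup>2)) \<longlonglongrightarrow> ennreal (?p * (norm (c (f n) s t))\<^sup>2)" for t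
    proof -
      have "c (\<lambda>t. f n t - f m t) s t = c (f n) s t - c (f m) s t" for m
        unfolding c_def using int[OF f s] by (simp add: left_diff_distrib)
      moreover have "(\<lambda>m. c (f n) s t - c (f m) s t) \<longlonglongrightarrow> c (f n) s t - 0"
        by (intro tendsto_intros) (use null[OF \<psi>s[OF s]] in \<open>simp add: c_def\<close>)
      ultimately have "(\<lambda>m. c (\<lambda>t. f n t - f m t) s t) \<longlonglongrightarrow> c (f n) s t" by simp
      then show ?thesis by (intro tendsto_ennrealI tendsto_intros)
    qed
    then have "liminf (\<lambda>m. ennreal (?p * (norm (c (\<lambda>t. f n t - f m t) s t))\<^sup>2)) = ennreal (?p * (norm (c (f n) s t))\<^sup>2)" for t
      by (intro lim_imp_Liminf) auto
    then have "w s * C (f n) s = (\<integral>\<^sup>+t. liminf (\<lambda>m. ennreal (?p * (norm (c (\<lambda>t. f n t - f m t) s t))\<^sup>2)) \<partial>lborel)"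
      by (simp add: wC f s)
    also have "\<dots> \<le> liminf (\<lambda>m. w s * C (\<lambda>t. f n t - f m t) s)"
      unfolding wC[OF test_fun_diff[OF f f] s]
      using cm[OF test_fun_diff[OF f f] s] by (intro nn_integral_liminf) simp
    finally show ?thesis .
  qed
  have bound: "ennreal (K * (test_norm \<alpha> (f n))\<^sup>2) \<le> liminf (\<lambda>m. ennreal (K * (test_norm \<alpha> (\<lambda>t. f n t - f m t))\<^sup>2))" for n
  proof -
    have "ennreal (K * (test_norm \<alpha> (f n))\<^sup>2) = (\<integral>\<^sup>+s. w s * C (f n) s \<partial>lborel)" by (simp add: J f)
    also have "\<dots> \<le> (\<integral>\<^sup>+s. liminf (\<lambda>m. w s * C (\<lambda>t. f n t - f m t) s) \<partial>lborel)"
      by (intro nn_integral_mono_AE eventually_mono[OF AE_lborel_singleton[of 0]] fatou)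
    also have "\<dots> \<le> liminf (\<lambda>m. \<integral>\<^sup>+s. w s * C (\<lambda>t. f n t - f m t) s \<partial>lborel)"
    proof (rule nn_integral_liminf)
      have [measurable]: "C (\<lambda>t. f n t - f m t) \<in> borel_measurable borel" for m by (rule Cm[OF test_fun_diff[OF f f]])
      show "(\<lambda>s. w s * C (\<lambda>t. f n t - f m t) s) \<in> borel_measurable lborel" for m
        unfolding w_def by measurable
    qed
    also have "\<dots> = liminf (\<lambda>m. ennreal (K * (test_norm \<alpha> (\<lambda>t. f n t - f m t))\<^sup>2))"
      by (simp add: J test_fun_diff f)
    finally show ?thesis .
  qed
  show ?thesis
  proof (rule LIMSEQ_I)
    fix e :: real assume "e > 0"
    then obtain N where N: "\<And>m n. m \<ge> N \<Longrightarrow> n \<ge> N \<Longrightarrow> test_norm \<alpha> (\<lambda>t. f m t - f n t) < e / 2"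
      using cauchy[of "e / 2"] by auto
    have "norm (test_norm \<alpha> (f n) - 0) < e" if "n \<ge> N" for n
    proof -
      have "liminf (\<lambda>m. ennreal (K * (test_norm \<alpha> (\<lambda>t. f n t - f m t))\<^sup>2)) \<le> ennreal (K * (e / 2)\<^sup>2)"
        using K by (intro liminf_ennreal_le[where N = N] ennreal_leI mult_left_mono power_mono less_imp_le[OF N] that test_norm_nonneg) auto
      from order_trans[OF bound this] have "K * (test_norm \<alpha> (f n))\<^sup>2 \<le> K * (e / 2)\<^sup>2"
        using K by (subst (asm) ennreal_le_iff) auto
      then have "(test_norm \<alpha> (f n))\<^sup>2 \<le> (e / 2)\<^sup>2" using K by simp
      then have "test_norm \<alpha> (f n) \<le> e / 2"
        by (rule power2_le_imp_le) (use \<open>e > 0\<close> in simp)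
      then show ?thesis using \<open>e > 0\<close> test_norm_nonneg[of \<alpha> "f n"] by simp
    qed
    then show "\<exists>no. \<forall>n\<ge>no. norm (test_norm \<alpha> (f n) - 0) < e" by blast
  qed
qed

section \<open>Estimates for the Gamma function\<close>

text \<open>Each term is at most the integral of \<open>y / (t^2 + y^2)\<close> over \<open>[k - 1, k]\<close>.\<close>

lemma sum_arctan_bound:
  assumes y: "y > 0"
  shows "(\<Sum>k\<in>{1..n}. y / ((real k)\<^sup>2 + y\<^sup>2)) \<le> pi / 2"
proof -
  have step: "y / ((real (Suc k))\<^sup>2 + y\<^sup>2) \<le> arctan (real (Suc k) / y) - arctan (real k / y)" for k
  proof -
    have "\<exists>z. real k < z \<and> z < real (Suc k) \<and>
       arctan (real (Suc k) / y) - arctan (real k / y) = (real (Suc k) - real k) * (1 / y * inverse (1 + (z / y)\<^sup>2))"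
      by (rule MVT2) (use y in \<open>auto intro!: derivative_eq_intros simp: field_simps\<close>)
    then obtain z where z: "real k < z" "z < real (Suc k)"
      and eq: "arctan (real (Suc k) / y) - arctan (real k / y) = 1 / y * inverse (1 + (z / y)\<^sup>2)" by auto
    have "1 / y * inverse (1 + (z / y)\<^sup>2) = y / (z\<^sup>2 + y\<^sup>2)"
      using y by (simp add: field_simps power2_eq_square add_pos_nonneg)
    moreover have "y / ((real (Suc k))\<^sup>2 + y\<^sup>2) \<le> y / (z\<^sup>2 + y\<^sup>2)"
      using y z by (intro divide_left_mono add_right_mono power_mono mult_pos_pos add_nonneg_pos) auto
    ultimately show ?thesis using eq by simp
  qed
  have "(\<Sum>k\<in>{1..n}. y / ((real k)\<^sup>2 + y\<^sup>2)) \<le> arctan (real n / y)"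
  proof (induction n)
    case (Suc n)
    then show ?case using step[of n] by simp
  qed simp
  also have "\<dots> \<le> pi / 2" using arctan_ubound[of "real n / y"] by simp
  finally show ?thesis .
qed

lemma norm_Gamma_series:
  assumes "s > 0"
  shows "norm (Gamma_series (Complex s v) n) =
    fact n * exp (s * ln (real n)) / (\<Prod>k\<le>n. norm (Complex (s + real k) v))"
proof -
  have "pochhammer (Complex s v) (n + 1) = (\<Prod>k\<le>n. Complex (s + real k) v)"
  proof -
    have "(\<Prod>k\<le>n. Complex s v + of_nat k) = (\<Prod>k\<le>n. Complex (s + real k) v)"
      by (intro prod.cong refl) (simp add: complex_eq_iff)
    then show ?thesis by (simp add: pochhammer_prod atLeast0LessThan lessThan_Suc_atMost)
  qed
  then show ?thesis
    by (simp add: Gamma_series_def norm_divide norm_mult prod_norm)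
qed

text \<open>In Euler's product the quotient of the moduli becomes a product of quotients
  \<open>\<bar>s + k + \<i> v\<bar> / \<bar>s + k + \<i> (v - d)\<bar>\<close>.  With \<open>y = v - d\<close> the square of such a quotient is at most
  \<open>1 + (2 \<bar>d\<bar> \<bar>y\<bar> + d^2) / ((s + k)^2 + y^2)\<close>, and the sum of these excesses over \<open>k\<close> is bounded
  independently of \<open>v\<close>.\<close>

lemma Gamma_imaginary_shift:
  assumes s: "s > 0"
  shows "\<exists>C>0. \<forall>v. norm (Gamma (Complex s (v - d))) \<le> C * norm (Gamma (Complex s v))"
proof -
  define S where "S = 2 * \<bar>d\<bar> * (1 / (2 * s) + pi / 2) + d\<^sup>2 * (1 / s\<^sup>2 + pi)"
  have fac: "(norm (Complex (s + real k) v))\<^sup>2 / (norm (Complex (s + real k) (v - d)))\<^sup>2 \<le>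
      exp (2 * \<bar>d\<bar> * (\<bar>v - d\<bar> / ((s + real k)\<^sup>2 + (v - d)\<^sup>2)) + d\<^sup>2 * (1 / (s + real k)\<^sup>2))" for k v
  proof -
    define y D where "y = v - d" and "D = (s + real k)\<^sup>2 + y\<^sup>2"
    have D: "D > 0" "(s + real k)\<^sup>2 > 0" "(s + real k)\<^sup>2 \<le> D" using s by (auto simp: D_def intro!: add_pos_nonneg)
    have "v\<^sup>2 \<le> y\<^sup>2 + (2 * \<bar>d\<bar> * \<bar>y\<bar> + d\<^sup>2)"
    proof -
      have "v = y + d" by (simp add: y_def)
      moreover have "2 * y * d \<le> 2 * \<bar>d\<bar> * \<bar>y\<bar>"
        using abs_ge_self[of "y * d"] by (simp add: abs_mult mult.commute)
      ultimately show ?thesis by (simp add: power2_sum)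
    qed
    then have "(norm (Complex (s + real k) v))\<^sup>2 / (norm (Complex (s + real k) y))\<^sup>2 \<le> (D + (2 * \<bar>d\<bar> * \<bar>y\<bar> + d\<^sup>2)) / D"
      unfolding cmod_power2 using D by (simp add: D_def divide_right_mono)
    also have "\<dots> = 1 + (2 * \<bar>d\<bar> * (\<bar>y\<bar> / D) + d\<^sup>2 * (1 / D))"
    proof -
      have "D \<noteq> 0" using D(1) by linarith
      then show ?thesis by (simp add: add_divide_distrib)
    qed
    also have "\<dots> \<le> 1 + (2 * \<bar>d\<bar> * (\<bar>y\<bar> / D) + d\<^sup>2 * (1 / (s + real k)\<^sup>2))"
      by (intro add_left_mono mult_left_mono divide_left_mono D(3) mult_pos_pos D(1,2)) auto
    also have "\<dots> \<le> exp (2 * \<bar>d\<bar> * (\<bar>y\<bar> / D) + d\<^sup>2 * (1 / (s + real k)\<^sup>2))"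
      by (rule exp_ge_add_one_self)
    finally show ?thesis by (simp add: y_def D_def)
  qed
  have sum1: "(\<Sum>k\<le>n. y / ((s + real k)\<^sup>2 + y\<^sup>2)) \<le> 1 / (2 * s) + pi / 2" if "y > 0" for y n
  proof -
    have "y / (s\<^sup>2 + y\<^sup>2) \<le> 1 / (2 * s)"
      using s that sum_squares_bound[of s y] by (simp add: field_simps add_pos_pos power2_eq_square)
    moreover have "(\<Sum>k\<in>{1..n}. y / ((s + real k)\<^sup>2 + y\<^sup>2)) \<le> (\<Sum>k\<in>{1..n}. y / ((real k)\<^sup>2 + y\<^sup>2))"
      using s that by (intro sum_mono divide_left_mono add_right_mono power_mono mult_pos_pos add_nonneg_pos) auto
    moreover have "(\<Sum>k\<le>n. y / ((s + real k)\<^sup>2 + y\<^sup>2)) = y / (s\<^sup>2 + y\<^sup>2) + (\<Sum>k\<in>{1..n}. y / ((s + real k)\<^sup>2 + y\<^sup>2))"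
      by (simp add: atMost_atLeast0 sum.atLeast_Suc_atMost)
    ultimately show ?thesis using sum_arctan_bound[OF that, of n] by linarith
  qed
  have sum1': "(\<Sum>k\<le>n. \<bar>y\<bar> / ((s + real k)\<^sup>2 + y\<^sup>2)) \<le> 1 / (2 * s) + pi / 2" for y n
    using sum1[of "\<bar>y\<bar>" n] s by (cases "y = 0") auto
  have sum2: "(\<Sum>k\<le>n. 1 / (s + real k)\<^sup>2) \<le> 1 / s\<^sup>2 + pi" for n
  proof -
    have "(\<Sum>k\<in>{1..n}. 1 / (s + real k)\<^sup>2) \<le> (\<Sum>k\<in>{1..n}. 2 * (1 / ((real k)\<^sup>2 + 1\<^sup>2)))"
    proof (rule sum_mono)
      fix k assume "k \<in> {1..n}"
      then have "1 \<le> (real k)\<^sup>2" "(real k)\<^sup>2 \<le> (s + real k)\<^sup>2" using s by (auto intro: power_mono)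
      then have "(real k)\<^sup>2 + 1\<^sup>2 \<le> 2 * (s + real k)\<^sup>2" by (simp only: power_one)
      then show "1 / (s + real k)\<^sup>2 \<le> 2 * (1 / ((real k)\<^sup>2 + 1\<^sup>2))"
        using s by (simp add: field_simps add_pos_nonneg)
    qed
    also have "\<dots> \<le> 2 * (pi / 2)"
      unfolding sum_distrib_left[symmetric] by (intro mult_left_mono sum_arctan_bound) auto
    finally have "(\<Sum>k\<in>{1..n}. 1 / (s + real k)\<^sup>2) \<le> pi" by simp
    moreover have "(\<Sum>k\<le>n. 1 / (s + real k)\<^sup>2) = 1 / s\<^sup>2 + (\<Sum>k\<in>{1..n}. 1 / (s + real k)\<^sup>2)"
      by (simp add: atMost_atLeast0 sum.atLeast_Suc_atMost)
    ultimately show ?thesis by simp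
  qed
  have prod: "(\<Prod>k\<le>n. norm (Complex (s + real k) v) / norm (Complex (s + real k) (v - d))) \<le> exp (S / 2)" for n v
  proof (rule power2_le_imp_le)
    have "(\<Prod>k\<le>n. norm (Complex (s + real k) v) / norm (Complex (s + real k) (v - d)))\<^sup>2 =
       (\<Prod>k\<le>n. (norm (Complex (s + real k) v))\<^sup>2 / (norm (Complex (s + real k) (v - d)))\<^sup>2)"
      by (simp add: prod_power_distrib power_divide)
    also have "\<dots> \<le> (\<Prod>k\<le>n. exp (2 * \<bar>d\<bar> * (\<bar>v - d\<bar> / ((s + real k)\<^sup>2 + (v - d)\<^sup>2)) + d\<^sup>2 * (1 / (s + real k)\<^sup>2)))"
      by (intro prod_mono conjI fac) auto
    also have "\<dots> = exp (2 * \<bar>d\<bar> * (\<Sum>k\<le>n. \<bar>v - d\<bar> / ((s + real k)\<^sup>2 + (v - d)\<^sup>2)) + d\<^sup>2 * (\<Sum>k\<le>n. 1 / (s + real k)\<^sup>2))"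
      by (simp add: exp_sum[symmetric] sum.distrib sum_distrib_left)
    also have "\<dots> \<le> exp S"
      unfolding S_def exp_le_cancel_iff by (intro add_mono mult_left_mono sum1' sum2) auto
    also have "exp S = (exp (S / 2))\<^sup>2" by (simp add: power2_eq_square flip: exp_add)
    finally show "(\<Prod>k\<le>n. norm (Complex (s + real k) v) / norm (Complex (s + real k) (v - d)))\<^sup>2 \<le> (exp (S / 2))\<^sup>2" .
  qed simp
  have series: "norm (Gamma_series (Complex s (v - d)) n) \<le> exp (S / 2) * norm (Gamma_series (Complex s v) n)" for n v
  proof -
    have pos: "(\<Prod>k\<le>n. norm (Complex (s + real k) w)) > 0" for w
      using s by (intro prod_pos) (auto simp: complex_eq_iff add_pos_nonneg[THEN less_imp_neq[THEN not_sym]])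
    have "norm (Gamma_series (Complex s (v - d)) n) =
       (\<Prod>k\<le>n. norm (Complex (s + real k) v) / norm (Complex (s + real k) (v - d))) * norm (Gamma_series (Complex s v) n)"
    proof -
      have "x / P' = P / P' * (x / P)" if "P > 0" for x P P' :: real
        using that by simp
      from this[OF pos[of v]] show ?thesis
        unfolding norm_Gamma_series[OF s] prod_dividef .
    qed
    also have "\<dots> \<le> exp (S / 2) * norm (Gamma_series (Complex s v) n)"
      by (intro mult_right_mono prod) simp
    finally show ?thesis .
  qed
  have "norm (Gamma (Complex s (v - d))) \<le> exp (S / 2) * norm (Gamma (Complex s v))" for v
    by (rule LIMSEQ_le[of "\<lambda>n. norm (Gamma_series (Complex s (v - d)) n)" _ "\<lambda>n. exp (S / 2) * norm (Gamma_series (Complex s v) n)"])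
       (auto intro!: tendsto_intros series)
  then show ?thesis by (intro exI[of _ "exp (S / 2)"]) auto
qed

text \<open>Compare Euler's products factor by factor: \<open>(p + k) \<bar>q + k + \<i> v\<bar> \<le> \<bar>p + k + \<i> v\<bar> (q + k)\<close> because
  \<open>p \<le> q\<close>.\<close>

lemma Gamma_imaginary_ratio:
  assumes p: "0 < p" "p \<le> q"
  shows "norm (Gamma (Complex p v)) * Gamma q \<le> Gamma p * norm (Gamma (Complex q v))"
proof -
  have q: "0 < q" using p by simp
  have Gr: "Gamma x = norm (Gamma (Complex x 0))" if "x > 0" for x :: real
    using Gamma_complex_of_real[of x] Gamma_real_pos[OF that] by (simp add: complex_of_real_def[symmetric])
  have "norm (Gamma_series (Complex p v) n) * norm (Gamma_series (Complex q 0) n) \<le>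
      norm (Gamma_series (Complex p 0) n) * norm (Gamma_series (Complex q v) n)" for n
  proof -
    let ?P = "\<lambda>s v. \<Prod>k\<le>n. norm (Complex (s + real k) v)"
    have pos: "?P s v > 0" if "s > 0" for s v
      using that by (intro prod_pos) (auto simp: complex_eq_iff add_pos_nonneg[THEN less_imp_neq[THEN not_sym]])
    have "?P p 0 * ?P q v \<le> ?P p v * ?P q 0"
      unfolding prod.distrib[symmetric]
    proof (intro prod_mono conjI)
      fix k
      have "((p + real k)\<^sup>2) * ((q + real k)\<^sup>2 + v\<^sup>2) \<le> ((p + real k)\<^sup>2 + v\<^sup>2) * (q + real k)\<^sup>2"
        using p by (simp add: algebra_simps) (intro mult_left_mono power_mono; simp)
      then show "norm (Complex (p + real k) 0) * norm (Complex (q + real k) v) \<le>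
          norm (Complex (p + real k) v) * norm (Complex (q + real k) 0)"
        by (intro power2_le_imp_le[OF _ mult_nonneg_nonneg]) (simp_all add: power_mult_distrib cmod_power2)
    qed auto
    then show ?thesis
      using pos[OF p(1)] pos[OF q]
      by (simp add: norm_Gamma_series[OF p(1)] norm_Gamma_series[OF q] frac_le divide_left_mono mult_pos_pos)
  qed
  then show ?thesis
    unfolding Gr[OF p(1)] Gr[OF q]
    by (intro LIMSEQ_le[of "\<lambda>n. norm (Gamma_series (Complex p v) n) * norm (Gamma_series (Complex q 0) n)" _
         "\<lambda>n. norm (Gamma_series (Complex p 0) n) * norm (Gamma_series (Complex q v) n)"])
       (auto intro!: tendsto_intros)
qed


text \<open>Only the modulus of the functions \<open>m_k\<close> enters the norms.\<close>

definition abs_m :: "nat \<Rightarrow> real \<Rightarrow> real \<Rightarrow> real" where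
  "abs_m k \<alpha> u = norm (m_fun k \<alpha> u)"

lemma norm_Gamma_minus: "norm (Gamma (Complex p (- v))) = norm (Gamma (Complex p v))"
  using complex_mod_cnj[of "Gamma (Complex p v)"] by (simp add: cnj_Gamma complex_cnj)

lemma abs_m_eq:
  assumes "k \<in> {0, 1}"
  shows "abs_m k \<alpha> u = sqrt (2 * pi) * 2 powr \<alpha> *
    (norm (Gamma (Complex (1/4 + k/2 + \<alpha>/2) (u/2))) / norm (Gamma (Complex (1/4 + k/2 - \<alpha>/2) (u/2))))"
proof -
  have 2: "norm ((2::complex) powr Complex \<alpha> u) = 2 powr \<alpha>"
    by (simp add: norm_powr_real_powr)
  have e: "1/4 + Complex \<alpha> u / 2 = Complex (1/4 + \<alpha>/2) (u/2)" "1/4 - Complex \<alpha> u / 2 = Complex (1/4 - \<alpha>/2) (- (u/2))"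
     "3/4 + Complex \<alpha> u / 2 = Complex (3/4 + \<alpha>/2) (u/2)" "3/4 - Complex \<alpha> u / 2 = Complex (3/4 - \<alpha>/2) (- (u/2))"
    by (simp_all add: complex_eq_iff)
  show ?thesis
    using assms by (auto simp: abs_m_def m_fun_def e norm_mult norm_divide 2 norm_Gamma_minus)
qed

lemma abs_m_minus: "k \<in> {0, 1} \<Longrightarrow> abs_m k \<alpha> (- u) = abs_m k \<alpha> u"
  using norm_Gamma_minus[of _ "u / 2"] by (auto simp: abs_m_eq)

lemma Complex_not_nonpos_Ints: "p > 0 \<Longrightarrow> Complex p v \<notin> \<int>\<^sub>\<le>\<^sub>0"
proof
  assume "p > 0" "Complex p v \<in> \<int>\<^sub>\<le>\<^sub>0"
  then obtain n where "Complex p v = of_int n" "n \<le> 0" by (elim nonpos_Ints_cases)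
  from arg_cong[OF this(1), of Re] have "p = of_int n" by simp
  then show False using \<open>p > 0\<close> \<open>n \<le> 0\<close> by simp
qed

lemma Gamma_Complex_nonzero: "p > 0 \<Longrightarrow> Gamma (Complex p v) \<noteq> 0"
  using Complex_not_nonpos_Ints by (simp add: Gamma_eq_zero_iff)

lemma continuous_norm_Gamma:
  assumes "p > 0" shows "continuous_on UNIV (\<lambda>u. norm (Gamma (Complex p (u / 2))))"
proof -
  have "continuous_on UNIV (\<lambda>u. Gamma (Complex p (u / 2)))"
  proof (rule continuous_on_compose2[where g = Gamma and f = "\<lambda>u. Complex p (u / 2)"])
    show "continuous_on {z::complex. z \<notin> \<int>\<^sub>\<le>\<^sub>0} Gamma" by (rule continuous_on_Gamma) auto
    have "continuous_on UNIV (\<lambda>u. of_real p + \<i> * of_real (u / 2))" by (intro continuous_intros) auto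
    then show "continuous_on UNIV (\<lambda>u. Complex p (u / 2))" by (simp add: Complex_eq)
  qed (use Complex_not_nonpos_Ints[OF assms] in auto)
  then show ?thesis by (rule continuous_on_norm)
qed

text \<open>Here \<open>\<bar>sin (x + \<i> y)\<bar>^2 = (T - 2 cos (2 x)) / 4\<close> with \<open>T = 2 cosh (2 y) \<ge> 2\<close>, which is at
  most \<open>(T + 2) / 4\<close>, and at least a constant times this if \<open>cos (2 x) < 1\<close>.\<close>

lemma sin_ratio:
  assumes "cos (2 * x) < 1"
  shows "\<exists>C>0. \<forall>y. norm (sin (Complex x' y)) \<le> C * norm (sin (Complex x y))"
proof -
  define C where "C = sqrt (2 / (1 - cos (2 * x)))"
  have "norm (sin (Complex x' y)) \<le> C * norm (sin (Complex x y))" for y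
  proof (rule power2_le_imp_le)
    define T where "T = exp (2 * y) + inverse (exp (2 * y))"
    have T: "T \<ge> 2"
    proof -
      have "0 \<le> (exp y - exp (- y))\<^sup>2" by simp
      also have "\<dots> = T - 2"
        by (simp add: T_def power2_diff exp_minus power2_eq_square exp_add[symmetric] field_simps)
      finally show ?thesis by simp
    qed
    have c: "- 1 \<le> cos (2 * x)" "- 1 \<le> cos (2 * x')" by (rule cos_ge_minus_one)+
    \<comment> \<open>Equality holds at \<open>T = 2\<close>, and the right-hand side grows at least as fast in \<open>T\<close>.\<close>
    have "(T + 2) * (1 - cos (2 * x)) \<le> 2 * (T - 2 * cos (2 * x))"
    proof -
      have "0 \<le> (T - 2) * (1 + cos (2 * x))" using T c(1) by (intro mult_nonneg_nonneg) linarith+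
      then show ?thesis by (simp add: algebra_simps)
    qed
    moreover have "(T - 2 * cos (2 * x')) * (1 - cos (2 * x)) \<le> (T + 2) * (1 - cos (2 * x))"
      using c(2) assms by (intro mult_right_mono) linarith+
    ultimately have "(T - 2 * cos (2 * x')) * (1 - cos (2 * x)) \<le> 2 * (T - 2 * cos (2 * x))" by linarith
    then have *: "T - 2 * cos (2 * x') \<le> 2 / (1 - cos (2 * x)) * (T - 2 * cos (2 * x))"
      using assms by (simp add: field_simps)
    have C2: "C\<^sup>2 = 2 / (1 - cos (2 * x))" using assms by (simp add: C_def)
    have "(norm (sin (Complex x' y)))\<^sup>2 = (T - 2 * cos (2 * x')) / 4"
      by (simp only: norm_sin_squared T_def complex.sel)
    also have "\<dots> \<le> 2 / (1 - cos (2 * x)) * (T - 2 * cos (2 * x)) / 4"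
      using * by (rule divide_right_mono) simp
    also have "\<dots> = (C * norm (sin (Complex x y)))\<^sup>2"
      by (simp only: power_mult_distrib C2 norm_sin_squared T_def complex.sel times_divide_eq_right)
    finally show "(norm (sin (Complex x' y)))\<^sup>2 \<le> (C * norm (sin (Complex x y)))\<^sup>2" .
  next
    show "0 \<le> C * norm (sin (Complex x y))" using assms by (simp add: C_def)
  qed
  moreover have "C > 0" using assms by (simp add: C_def)
  ultimately show ?thesis by blast
qed

context
  fixes \<alpha> :: real
  assumes \<alpha>: "\<bar>\<alpha>\<bar> < 1/2"
begin

lemma abs_m_params: "k \<in> {0, 1::nat} \<Longrightarrow> 0 < 1/4 + k/2 + \<alpha>/2" "k \<in> {0, 1::nat} \<Longrightarrow> 0 < 1/4 + k/2 - \<alpha>/2"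
  using \<alpha> by auto

lemma abs_m_pos: "k \<in> {0, 1} \<Longrightarrow> 0 < abs_m k \<alpha> u"
  using abs_m_params[of k] by (simp add: abs_m_eq Gamma_Complex_nonzero)

lemma abs_m_continuous:
  assumes "k \<in> {0, 1}"
  shows "continuous_on UNIV (abs_m k \<alpha>)"
proof -
  have "continuous_on UNIV (\<lambda>u. sqrt (2 * pi) * 2 powr \<alpha> *
    (norm (Gamma (Complex (1/4 + k/2 + \<alpha>/2) (u/2))) / norm (Gamma (Complex (1/4 + k/2 - \<alpha>/2) (u/2)))))"
    using abs_m_params[OF assms] Gamma_Complex_nonzero
    by (intro continuous_on_mult continuous_on_const continuous_on_divide continuous_norm_Gamma) auto
  then show ?thesis by (subst continuous_on_cong[OF refl abs_m_eq[OF assms]]) auto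
qed

text \<open>The comparison \<open>Gamma_imaginary_ratio\<close> applies to the parameters \<open>p\<close> and \<open>q + 1\<close>, and the functional equation
  from \<open>q + 1\<close> down to \<open>q\<close> costs one linear factor.\<close>

lemma abs_m_growth: "k \<in> {0, 1} \<Longrightarrow> \<exists>A>0. \<forall>u. abs_m k \<alpha> u \<le> A * (1 + \<bar>u\<bar>)"
proof -
  assume k: "k \<in> {0, 1}"
  define p q where "p = 1/4 + k/2 + \<alpha>/2" and "q = 1/4 + k/2 - \<alpha>/2"
  have p: "0 < p" and q: "0 < q" "q < 1" and pq: "p \<le> q + 1" using abs_m_params[OF k] k \<alpha> by (auto simp: p_def q_def)
  define A where "A = Gamma p / Gamma (q + 1)"
  have A: "A > 0" using p q by (simp add: A_def Gamma_real_pos)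
  have G: "norm (Gamma (Complex p v)) / norm (Gamma (Complex q v)) \<le> A * (1 + \<bar>v\<bar>)" for v
  proof -
    have "norm (Gamma (Complex p v)) * Gamma (q + 1) \<le> Gamma p * norm (Gamma (Complex (q + 1) v))"
      by (rule Gamma_imaginary_ratio[OF p pq])
    then have "norm (Gamma (Complex p v)) \<le> A * norm (Gamma (Complex (q + 1) v))"
      using Gamma_real_pos[of "q + 1"] q by (simp add: A_def field_simps)
    also have "Complex (q + 1) v = Complex q v + 1" by (simp add: complex_eq_iff)
    also have "Gamma (Complex q v + 1) = Complex q v * Gamma (Complex q v)"
      using q by (intro Gamma_plus1) (auto elim!: nonpos_Ints_cases simp: complex_eq_iff)
    also have "norm (Complex q v * Gamma (Complex q v)) = norm (Complex q v) * norm (Gamma (Complex q v))"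
      by (rule norm_mult)
    also have "A * (norm (Complex q v) * norm (Gamma (Complex q v))) \<le> A * ((1 + \<bar>v\<bar>) * norm (Gamma (Complex q v)))"
      using A q cmod_le[of "Complex q v"] by (intro mult_left_mono mult_right_mono) auto
    finally show ?thesis
      using Gamma_Complex_nonzero[OF q(1), of v] by (simp add: divide_le_eq mult.assoc)
  qed
  let ?c = "sqrt (2 * pi) * 2 powr \<alpha>"
  have "abs_m k \<alpha> u \<le> (?c * A) * (1 + \<bar>u\<bar>)" for u
  proof -
    have "abs_m k \<alpha> u \<le> ?c * (A * (1 + \<bar>u / 2\<bar>))"
      unfolding abs_m_eq[OF k] p_def[symmetric] q_def[symmetric] by (intro mult_left_mono G) auto
    also have "\<dots> \<le> ?c * (A * (1 + \<bar>u\<bar>))"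
      using A by (intro mult_left_mono) auto
    finally show ?thesis by (simp only: mult.assoc)
  qed
  moreover have "?c * A > 0" using A by simp
  ultimately show ?thesis by blast
qed

lemma abs_m_shift:
  assumes k: "k \<in> {0, 1}"
  shows "\<exists>C>0. \<forall>u. abs_m k \<alpha> (u - d) \<le> C * abs_m k \<alpha> u"
proof -
  define p q where "p = 1/4 + k/2 + \<alpha>/2" and "q = 1/4 + k/2 - \<alpha>/2"
  have pq: "0 < p" "0 < q" using abs_m_params[OF k] by (auto simp: p_def q_def)
  obtain C where C: "C > 0" "\<And>v. norm (Gamma (Complex p (v - d/2))) \<le> C * norm (Gamma (Complex p v))"
    using Gamma_imaginary_shift[OF pq(1), of "d/2"] by blast
  obtain D where D: "D > 0" "\<And>v. norm (Gamma (Complex q (v - (- d/2)))) \<le> D * norm (Gamma (Complex q v))"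
    using Gamma_imaginary_shift[OF pq(2), of "- d/2"] by blast
  let ?c = "sqrt (2 * pi) * 2 powr \<alpha>"
  have "abs_m k \<alpha> (u - d) \<le> (C * D) * abs_m k \<alpha> u" for u
  proof -
    define v where "v = u / 2"
    have v: "(u - d) / 2 = v - d/2" by (simp add: v_def diff_divide_distrib)
    have pos: "norm (Gamma (Complex q v)) > 0" "norm (Gamma (Complex q (v - d/2))) > 0"
      using Gamma_Complex_nonzero[OF pq(2)] by auto
    have "norm (Gamma (Complex q v)) \<le> D * norm (Gamma (Complex q (v - d/2)))"
      using D(2)[of "v - d/2"] by simp
    then have inv: "1 / norm (Gamma (Complex q (v - d/2))) \<le> D / norm (Gamma (Complex q v))"
      using pos D by (simp add: field_simps)
    have "norm (Gamma (Complex p (v - d/2))) * (1 / norm (Gamma (Complex q (v - d/2)))) \<le>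
        (C * norm (Gamma (Complex p v))) * (D / norm (Gamma (Complex q v)))"
      by (intro mult_mono C inv) (use C in auto)
    then have "norm (Gamma (Complex p (v - d/2))) / norm (Gamma (Complex q (v - d/2))) \<le>
        C * D * (norm (Gamma (Complex p v)) / norm (Gamma (Complex q v)))"
      by (simp add: mult_ac)
    then have "?c * (norm (Gamma (Complex p (v - d/2))) / norm (Gamma (Complex q (v - d/2)))) \<le>
        ?c * (C * D * (norm (Gamma (Complex p v)) / norm (Gamma (Complex q v))))"
      by (intro mult_left_mono) auto
    then show ?thesis
      unfolding abs_m_eq[OF k] p_def[symmetric] q_def[symmetric] v v_def[symmetric]
      by (simp only: mult.left_commute)
  qed
  moreover have "C * D > 0" using C D by simp
  ultimately show ?thesis by blast
qed

text \<open>By the reflection formula the quotient of the even and the odd multiplier is a quotient of two sines.\<close>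

lemma abs_m_cross:
  assumes j: "j \<in> {0, 1}" and k: "k \<in> {0, 1}"
  shows "\<exists>C>0. \<forall>u. abs_m j \<alpha> u \<le> C * abs_m k \<alpha> u"
proof -
  define g where "g p v = norm (Gamma (Complex p v))" for p v
  define \<sigma> where "\<sigma> p v = norm (sin (Complex (pi * p) (pi * v)))" for p v
  have refl: "g p v * g (1 - p) v = pi / \<sigma> p v" for p v
  proof -
    have "norm (Gamma (Complex p v) * Gamma (1 - Complex p v)) = norm (of_real pi / sin (of_real pi * Complex p v))"
      by (simp only: Gamma_reflection_complex)
    moreover have "1 - Complex p v = Complex (1 - p) (- v)" "of_real pi * Complex p v = Complex (pi * p) (pi * v)"
      by (simp_all add: complex_eq_iff)
    ultimately show ?thesis by (simp add: g_def \<sigma>_def norm_mult norm_divide norm_Gamma_minus)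
  qed
  let ?p = "1/4 + \<alpha>/2" and ?q = "1/4 - \<alpha>/2"
  have gpos: "g p v > 0" if "p > 0" for p v using Gamma_Complex_nonzero[OF that] by (simp add: g_def)
  have pos: "0 < ?p" "0 < ?q" "0 < 1 - ?p" "0 < 1 - ?q" "?p < 1/2" "?q < 1/2" using \<alpha> by auto
  have cosl: "cos (2 * (pi * p)) < 1" if "0 < p" "p < 1/2" for p
    using that cos_monotone_0_pi[of 0 "2 * (pi * p)"] by simp
  have ratio: "abs_m 1 \<alpha> u * \<sigma> ?q (u/2) = abs_m 0 \<alpha> u * \<sigma> ?p (u/2)" for u
  proof -
    let ?v = "u/2" and ?c = "sqrt (2 * pi) * 2 powr \<alpha>"
    have m1: "abs_m 1 \<alpha> u = ?c * (g (1 - ?q) ?v / g (1 - ?p) ?v)"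
      using abs_m_eq[of 1 \<alpha> u] by (simp add: g_def)
    have m0: "abs_m 0 \<alpha> u = ?c * (g ?p ?v / g ?q ?v)"
      using abs_m_eq[of 0 \<alpha> u] by (simp add: g_def)
    have "\<sigma> ?p ?v = pi / (g ?p ?v * g (1 - ?p) ?v)" "\<sigma> ?q ?v = pi / (g ?q ?v * g (1 - ?q) ?v)"
      unfolding refl by simp_all
    then show ?thesis
      unfolding m1 m0 using gpos[OF pos(1), of ?v] gpos[OF pos(2), of ?v] gpos[OF pos(3), of ?v] gpos[OF pos(4), of ?v]
      by simp
  qed
  have \<sigma>pos: "\<sigma> p v > 0" if "0 < p" "p < 1" for p v
  proof -
    have "\<sigma> p v = pi / (g p v * g (1 - p) v)" unfolding refl by simp
    then show ?thesis using gpos[of p v] gpos[of "1 - p" v] that by simp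
  qed
  obtain C where C: "C > 0" "\<And>v. \<sigma> ?p v \<le> C * \<sigma> ?q v"
    using sin_ratio[OF cosl[OF pos(2,6)], of "pi * ?p"] unfolding \<sigma>_def by blast
  obtain D where D: "D > 0" "\<And>v. \<sigma> ?q v \<le> D * \<sigma> ?p v"
    using sin_ratio[OF cosl[OF pos(1,5)], of "pi * ?q"] unfolding \<sigma>_def by blast
  have le1: "abs_m 1 \<alpha> u \<le> C * abs_m 0 \<alpha> u" for u
  proof -
    have "abs_m 1 \<alpha> u * \<sigma> ?q (u/2) \<le> C * abs_m 0 \<alpha> u * \<sigma> ?q (u/2)"
      unfolding ratio using C(2)[of "u/2"] abs_m_pos[of 0 u] mult_left_mono by (fastforce simp: mult_ac)
    then show ?thesis using \<sigma>pos[of ?q "u/2"] pos by simp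
  qed
  have le0: "abs_m 0 \<alpha> u \<le> D * abs_m 1 \<alpha> u" for u
  proof -
    have "abs_m 0 \<alpha> u * \<sigma> ?p (u/2) \<le> D * abs_m 1 \<alpha> u * \<sigma> ?p (u/2)"
      unfolding ratio[symmetric] using D(2)[of "u/2"] abs_m_pos[of 1 u] mult_left_mono by (fastforce simp: mult_ac)
    then show ?thesis using \<sigma>pos[of ?p "u/2"] pos by simp
  qed
  have id: "\<exists>C>0. \<forall>u. abs_m k \<alpha> u \<le> C * abs_m k \<alpha> u" for k by (intro exI[of _ 1]) auto
  show ?thesis using j k le1 le0 C(1) D(1) id by auto
qed

text \<open>This is the boundedness of \<open>q_0\<close> and \<open>q_1\<close>, the source of the uniform boundedness of the
  representation.\<close>

lemma abs_m_bounded_ratio: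
  assumes j: "j \<in> {0, 1}" and k: "k \<in> {0, 1}"
  shows "\<exists>C>0. \<forall>u. abs_m j \<alpha> (d - u) \<le> C * abs_m k \<alpha> u"
proof -
  obtain C where C: "C > 0" "\<And>u. abs_m j \<alpha> (u - d) \<le> C * abs_m j \<alpha> u" using abs_m_shift[OF j] by blast
  obtain D where D: "D > 0" "\<And>u. abs_m j \<alpha> u \<le> D * abs_m k \<alpha> u" using abs_m_cross[OF j k] by blast
  have "abs_m j \<alpha> (d - u) \<le> (C * D) * abs_m k \<alpha> u" for u
  proof -
    have "abs_m j \<alpha> (d - u) = abs_m j \<alpha> (u - d)" using abs_m_minus[OF j, of \<alpha> "u - d"] by simp
    also have "\<dots> \<le> C * (D * abs_m k \<alpha> u)"
      using C(2)[of u] mult_left_mono[OF D(2)[of u], of C] C(1) by linarith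
    finally show ?thesis by (simp add: mult.assoc)
  qed
  moreover have "C * D > 0" using C D by simp
  ultimately show ?thesis by blast
qed

end

section \<open>Logarithmic coordinates and superpositions of Gaussians\<close>

lemma nn_integral_exp_substitution:
  fixes f :: "real \<Rightarrow> ennreal"
  assumes [measurable]: "f \<in> borel_measurable borel"
  shows "(\<integral>\<^sup>+r. f r * indicator {0<..} r \<partial>lborel) = (\<integral>\<^sup>+x. f (exp x) * ennreal (exp x) \<partial>lborel)"
proof -
  define A where "A n r = f r * indicator {exp (- real (Suc n))..exp (real (Suc n))} r" for n r
  define B where "B n x = f (exp x) * ennreal (exp x) * indicator {- real (Suc n)..real (Suc n)} x" for n x
  have AB: "integral\<^sup>N lborel (A n) = integral\<^sup>N lborel (B n)" for n
    unfolding A_def B_def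
    by (rule nn_integral_substitution_aux[where g = exp]) (auto intro!: derivative_eq_intros continuous_intros)
  have icA: "incseq A"
  proof (intro incseq_SucI le_funI)
    fix n r
    have "exp (- real (Suc (Suc n))) \<le> exp (- real (Suc n))" "exp (real (Suc n)) \<le> exp (real (Suc (Suc n)))"
      by simp_all
    then show "A n r \<le> A (Suc n) r"
      unfolding A_def by (intro mult_left_mono indicator_leI) (auto simp del: of_nat_Suc exp_le_cancel_iff)
  qed
  have icB: "incseq B"
    by (auto simp: B_def incseq_Suc_iff le_fun_def split: split_indicator)
  have supA: "(SUP n. A n r) = f r * indicator {0<..} r" for r
  proof (cases "r > 0")
    case True
    obtain n where n: "\<bar>ln r\<bar> \<le> real n" using real_arch_simple by blast
    then have "exp (- real (Suc n)) \<le> r" "r \<le> exp (real (Suc n))"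
      using True by (auto simp flip: ln_le_cancel_iff[OF exp_gt_zero True] ln_le_cancel_iff[OF True exp_gt_zero])
    then have "A n r = f r * indicator {0<..} r" using True by (simp add: A_def)
    moreover have "A m r \<le> f r * indicator {0<..} r" for m
      using True by (auto simp: A_def split: split_indicator)
    ultimately show ?thesis by (intro antisym SUP_least) (auto intro: SUP_upper2[of n])
  next
    case False
    then have "A n r = 0" for n
      by (auto simp: A_def split: split_indicator intro: order_trans dest: order_less_le_trans[OF exp_gt_zero])
    then show ?thesis using False by simp
  qed
  have supB: "(SUP n. B n x) = f (exp x) * ennreal (exp x)" for x
  proof -
    obtain n where n: "\<bar>x\<bar> \<le> real n" using real_arch_simple by blast
    then have "B n x = f (exp x) * ennreal (exp x)" by (auto simp: B_def split: split_indicator)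
    moreover have "B m x \<le> f (exp x) * ennreal (exp x)" for m by (auto simp: B_def split: split_indicator)
    ultimately show ?thesis by (intro antisym SUP_least) (auto intro: SUP_upper2[of n])
  qed
  have [measurable]: "A n \<in> borel_measurable lborel" "B n \<in> borel_measurable lborel" for n
    unfolding A_def[abs_def] B_def[abs_def] by measurable
  have "(\<integral>\<^sup>+r. f r * indicator {0<..} r \<partial>lborel) = (SUP n. integral\<^sup>N lborel (A n))"
    unfolding supA[symmetric] by (intro nn_integral_monotone_convergence_SUP icA) simp
  also have "\<dots> = (\<integral>\<^sup>+x. f (exp x) * ennreal (exp x) \<partial>lborel)"
    unfolding AB supB[symmetric] by (intro nn_integral_monotone_convergence_SUP[symmetric] icB) simp
  finally show ?thesis .
qed

lemma distr_exp: "distr (density lborel (\<lambda>x. ennreal (exp x))) borel exp = density lborel (indicator {0<..})"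
proof (rule measure_eqI)
  fix A assume "A \<in> sets (distr (density lborel (\<lambda>x. ennreal (exp x))) borel exp)"
  then have [measurable]: "A \<in> sets borel" by simp
  have "emeasure (distr (density lborel (\<lambda>x. ennreal (exp x))) borel exp) A =
     (\<integral>\<^sup>+x. indicator A (exp x) * ennreal (exp x) \<partial>lborel)"
    by (simp add: nn_integral_indicator[symmetric] nn_integral_distr nn_integral_density mult.commute
        del: nn_integral_indicator)
  also have "\<dots> = (\<integral>\<^sup>+r. indicator A r * indicator {0<..} r \<partial>lborel)"
    by (rule nn_integral_exp_substitution[symmetric]) simp
  also have "\<dots> = emeasure (density lborel (indicator {0<..})) A"
    by (subst emeasure_density) (auto simp: mult.commute)
  finally show "emeasure (distr (density lborel (\<lambda>x. ennreal (exp x))) borel exp) A =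
     emeasure (density lborel (indicator {0<..})) A" .
qed simp

lemma exp_substitution:
  fixes h :: "real \<Rightarrow> 'a::{banach, second_countable_topology}"
  assumes [measurable]: "h \<in> borel_measurable borel"
  shows "integrable lborel (\<lambda>r. indicator {0<..} r *\<^sub>R h r) \<longleftrightarrow> integrable lborel (\<lambda>x. exp x *\<^sub>R h (exp x))"
    and "(LINT r|lborel. indicator {0<..} r *\<^sub>R h r) = (LINT x|lborel. exp x *\<^sub>R h (exp x))"
proof -
  have d: "density lborel (indicator {0<..}) = density lborel (\<lambda>r. ennreal (indicator {0<..} r))"
    by (simp add: ennreal_indicator)
  have "integrable lborel (\<lambda>r. indicator {0<..} r *\<^sub>R h r) \<longleftrightarrow> integrable (density lborel (indicator {0<..})) h"
    unfolding d by (subst integrable_density) auto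
  also have "\<dots> \<longleftrightarrow> integrable (density lborel (\<lambda>x. ennreal (exp x))) (\<lambda>x. h (exp x))"
    unfolding distr_exp[symmetric] by (subst integrable_distr_eq) auto
  also have "\<dots> \<longleftrightarrow> integrable lborel (\<lambda>x. exp x *\<^sub>R h (exp x))"
    by (subst integrable_density) auto
  finally show "integrable lborel (\<lambda>r. indicator {0<..} r *\<^sub>R h r) \<longleftrightarrow> integrable lborel (\<lambda>x. exp x *\<^sub>R h (exp x))" .
  have "(LINT r|lborel. indicator {0<..} r *\<^sub>R h r) = integral\<^sup>L (density lborel (indicator {0<..})) h"
    unfolding d by (subst integral_density) auto
  also have "\<dots> = (LINT x|density lborel (\<lambda>x. ennreal (exp x)). h (exp x))"
    unfolding distr_exp[symmetric] by (subst integral_distr) auto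
  also have "\<dots> = (LINT x|lborel. exp x *\<^sub>R h (exp x))"
    by (subst integral_density) auto
  finally show "(LINT r|lborel. indicator {0<..} r *\<^sub>R h r) = (LINT x|lborel. exp x *\<^sub>R h (exp x))" .
qed

lemma log_coordinates:
  fixes h :: "real \<Rightarrow> 'a::{banach, second_countable_topology}"
  assumes h: "integrable lborel h"
  shows "integrable lborel (\<lambda>x. exp x *\<^sub>R h (exp x))" "integrable lborel (\<lambda>x. exp x *\<^sub>R h (- exp x))"
    and "(LINT r|lborel. h r) = (LINT x|lborel. exp x *\<^sub>R h (exp x)) + (LINT x|lborel. exp x *\<^sub>R h (- exp x))"
proof -
  have [measurable]: "h \<in> borel_measurable borel" using h by simp
  have p: "integrable lborel (\<lambda>r. indicator {0<..} r *\<^sub>R h r)" using h by (intro integrable_mult_indicator) auto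
  have n: "integrable lborel (\<lambda>r. indicator {0<..} (- r) *\<^sub>R h r)"
    using integrable_mult_indicator[OF _ h, of "{..<0}"] by (simp add: indicator_def)
  have n': "integrable lborel (\<lambda>r. indicator {0<..} r *\<^sub>R h (- r))"
    using lborel_integrable_real_affine[OF n, of "-1" 0] by simp
  show 1: "integrable lborel (\<lambda>x. exp x *\<^sub>R h (exp x))" using p exp_substitution(1)[of h] by simp
  show 2: "integrable lborel (\<lambda>x. exp x *\<^sub>R h (- exp x))" using n' exp_substitution(1)[of "\<lambda>r. h (- r)"] by simp
  have "(LINT r|lborel. h r) = (LINT r|lborel. indicator {0<..} r *\<^sub>R h r + indicator {0<..} (- r) *\<^sub>R h r)"
    by (intro integral_cong_AE eventually_mono[OF AE_lborel_singleton[of 0]]) (auto simp: indicator_def)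
  also have "\<dots> = (LINT r|lborel. indicator {0<..} r *\<^sub>R h r) + (LINT r|lborel. indicator {0<..} (- r) *\<^sub>R h r)"
    by (rule Bochner_Integration.integral_add[OF p n])
  also have "(LINT r|lborel. indicator {0<..} (- r) *\<^sub>R h r) = (LINT r|lborel. indicator {0<..} r *\<^sub>R h (- r))"
    using lborel_integral_real_affine[of "-1" "\<lambda>r. indicator {0<..} (- r) *\<^sub>R h r" 0] by simp
  finally show "(LINT r|lborel. h r) = (LINT x|lborel. exp x *\<^sub>R h (exp x)) + (LINT x|lborel. exp x *\<^sub>R h (- exp x))"
    by (simp add: exp_substitution(2)[of h] exp_substitution(2)[of "\<lambda>r. h (- r)"])
qed

text \<open>Euler's integral in the variable \<open>t = c * exp y\<close>, in which dilations become translations.\<close>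

lemma Gamma_log:
  assumes w: "Re w > 0" and c: "c > 0"
  shows "integrable lborel (\<lambda>y. exp (w * of_real y) * of_real (exp (- (c * exp y))))"
    and "(LINT y|lborel. exp (w * of_real y) * of_real (exp (- (c * exp y)))) = Gamma w * exp (- w * of_real (ln c))"
proof -
  let ?g = "\<lambda>t. exp ((w - 1) * of_real (ln t)) / complex_of_real (exp t)"
  have g_eq: "complex_of_real t powr (w - 1) / of_real (exp t) = ?g t" if "t \<in> {0<..}" for t
    using that by (simp add: powr_def Ln_of_real)
  have [measurable]: "?g \<in> borel_measurable borel" by measurable
  have "?g absolutely_integrable_on {0<..}"
    using absolutely_integrable_Gamma_integral'[OF w] g_eq
    by (subst set_integrable_cong[OF refl refl g_eq[symmetric]]) auto
  then have 1: "integrable lborel (\<lambda>t. indicator {0<..} t *\<^sub>R ?g t)"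
    unfolding set_integrable_def by (subst (asm) integrable_completion) auto
  have "((\<lambda>t. complex_of_real t powr (w - 1) / of_real (exp t)) has_integral Gamma w) {0<..}"
  proof (rule has_integral_spike_set_eq[THEN iffD1, OF _ _ Gamma_integral_complex[OF w]])
    show "negligible {x \<in> {0..} - {0<..}. complex_of_real x powr (w - 1) / of_real (exp x) \<noteq> 0}"
      by (rule negligible_subset[OF negligible_sing[of 0]]) auto
    show "negligible {x \<in> {0<..} - {0..}. complex_of_real x powr (w - 1) / of_real (exp x) \<noteq> 0}"
      by (rule negligible_subset[OF negligible_sing[of 0]]) auto
  qed
  then have "(?g has_integral Gamma w) {0<..}"
    by (rule has_integral_eq[rotated]) (rule g_eq)
  then have "((\<lambda>t. indicator {0<..} t *\<^sub>R ?g t) has_integral Gamma w) UNIV"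
  proof -
    have "(\<lambda>t. indicator {0<..} t *\<^sub>R ?g t) = (\<lambda>t. if t \<in> {0<..} then ?g t else 0)"
      by (auto simp: indicator_def fun_eq_iff)
    moreover have "(?g has_integral Gamma w) {0<..} \<Longrightarrow> ((\<lambda>t. if t \<in> {0<..} then ?g t else 0) has_integral Gamma w) UNIV"
      by (simp only: has_integral_restrict_UNIV)
    ultimately show "(?g has_integral Gamma w) {0<..} \<Longrightarrow> ((\<lambda>t. indicator {0<..} t *\<^sub>R ?g t) has_integral Gamma w) UNIV"
      by simp
  qed
  moreover have "((\<lambda>t. indicator {0<..} t *\<^sub>R ?g t) has_integral (LINT t|lborel. indicator {0<..} t *\<^sub>R ?g t)) UNIV"
    by (rule has_integral_integral_lborel[OF 1])
  ultimately have 2: "(LINT t|lborel. indicator {0<..} t *\<^sub>R ?g t) = Gamma w" by (rule has_integral_unique[symmetric])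
  let ?e = "\<lambda>y. exp (w * of_real y) * complex_of_real (exp (- exp y))"
  have eq: "exp y *\<^sub>R ?g (exp y) = ?e y" for y :: real
  proof -
    have "complex_of_real (exp y) * exp ((w - 1) * of_real y) = exp (w * of_real y)"
      by (simp add: exp_of_real[symmetric] exp_add[symmetric] algebra_simps del: exp_of_real)
    moreover have "1 / complex_of_real (exp (exp y)) = complex_of_real (exp (- exp y))"
      by (simp add: exp_minus divide_inverse)
    ultimately show ?thesis
      by (simp add: scaleR_conv_of_real divide_inverse mult.assoc[symmetric] del: exp_of_real)
  qed
  have 3: "integrable lborel ?e" "(LINT y|lborel. ?e y) = Gamma w"
    using 1 2 exp_substitution[of ?g] unfolding eq by auto
  have shift: "exp (w * of_real y) * of_real (exp (- (c * exp y))) = exp (- w * of_real (ln c)) * ?e (ln c + 1 * y)" for y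
  proof -
    have "exp (- w * of_real (ln c)) * exp (w * of_real (ln c + 1 * y)) = exp (w * of_real y)"
      by (simp add: algebra_simps flip: exp_add)
    moreover have "exp (ln c + 1 * y) = c * exp y" using c by (simp add: exp_add)
    ultimately show ?thesis by (simp only: mult.assoc[symmetric])
  qed
  show "integrable lborel (\<lambda>y. exp (w * of_real y) * of_real (exp (- (c * exp y))))"
    unfolding shift by (intro integrable_mult_right lborel_integrable_real_affine 3) simp
  show "(LINT y|lborel. exp (w * of_real y) * of_real (exp (- (c * exp y)))) = Gamma w * exp (- w * of_real (ln c))"
    unfolding shift using lborel_integral_real_affine[of 1 ?e "ln c"] 3 by simp
qed


lemma Gamma_log_real:
  fixes a c :: real
  assumes a: "a > 0" and c: "c > 0"
  shows "(LINT y|lborel. exp (a * y) * exp (- (c * exp y))) = Gamma a * exp (- a * ln c)"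
proof -
  have "complex_of_real (LINT y|lborel. exp (a * y) * exp (- (c * exp y))) =
      (LINT y|lborel. exp (of_real a * of_real y) * of_real (exp (- (c * exp y))))"
    unfolding integral_complex_of_real[symmetric]
    by (simp add: exp_of_real[symmetric] del: exp_of_real)
  also have "\<dots> = complex_of_real (Gamma a * exp (- a * ln c))"
    using Gamma_log(2)[of "of_real a" c] a c
    by (simp add: Gamma_complex_of_real exp_of_real[symmetric] del: exp_of_real)
  finally show ?thesis by (simp only: of_real_eq_iff)
qed

text \<open>A power of \<open>\<bar>r\<bar>\<close> is a superposition of Gaussians in \<open>r\<close> of all widths; the superposition is an
  Euler integral, and Fubini's theorem exchanges it with the integral over \<open>r\<close>.\<close>

lemma integral_powr_gaussian_superposition:
  fixes F :: "real \<Rightarrow> complex"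
  assumes [measurable]: "F \<in> borel_measurable borel" and w: "Re w > 0"
    and int: "integrable lborel (\<lambda>r. norm (F r) * exp (- 2 * Re w * ln \<bar>r\<bar>))"
  shows "(LINT y|lborel. exp (w * of_real y) * (LINT r|lborel. F r * of_real (exp (- (r\<^sup>2 / 2 * exp y))))) =
     Gamma w * exp (w * of_real (ln 2)) * (LINT r|lborel. F r * exp (- 2 * w * of_real (ln \<bar>r\<bar>)))"
proof -
  let ?k = "\<lambda>r y. exp (w * of_real y) * complex_of_real (exp (- (r\<^sup>2 / 2 * exp y)))"
  have ln: "ln (r\<^sup>2 / 2) = 2 * ln \<bar>r\<bar> - ln 2" if "r \<noteq> 0" for r :: real
  proof -
    have "ln (r\<^sup>2) = 2 * ln \<bar>r\<bar>" using that ln_realpow[of "\<bar>r\<bar>" 2] by simp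
    then show ?thesis using that by (simp add: ln_div)
  qed
  have nk: "norm (?k r y) = exp (Re w * y) * exp (- (r\<^sup>2 / 2 * exp y))" for r y
    by (simp add: norm_mult)
  have I: "integrable (lborel \<Otimes>\<^sub>M lborel) (\<lambda>(r, y). F r * ?k r y)"
  proof (rule lborel_pair.Fubini_integrable)
    have "integrable lborel (\<lambda>r. Gamma (Re w) * exp (Re w * ln 2) * (norm (F r) * exp (- 2 * Re w * ln \<bar>r\<bar>)))"
      using int by (rule integrable_mult_right)
    moreover have "AE r in lborel. Gamma (Re w) * exp (Re w * ln 2) * (norm (F r) * exp (- 2 * Re w * ln \<bar>r\<bar>)) =
        (LINT y|lborel. norm (F r * ?k r y))"
    proof (rule eventually_mono[OF AE_lborel_singleton[of 0]])
      fix r :: real assume "r \<noteq> 0"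
      have "(LINT y|lborel. norm (F r * ?k r y)) = norm (F r) * (Gamma (Re w) * exp (- Re w * ln (r\<^sup>2 / 2)))"
        unfolding norm_mult[of "F r"] nk
        using Gamma_log_real[OF w, of "r\<^sup>2 / 2"] \<open>r \<noteq> 0\<close> by simp
      also have "exp (- Re w * ln (r\<^sup>2 / 2)) = exp (Re w * ln 2) * exp (- 2 * Re w * ln \<bar>r\<bar>)"
        unfolding ln[OF \<open>r \<noteq> 0\<close>] by (simp add: algebra_simps flip: exp_add)
      finally show "Gamma (Re w) * exp (Re w * ln 2) * (norm (F r) * exp (- 2 * Re w * ln \<bar>r\<bar>)) =
        (LINT y|lborel. norm (F r * ?k r y))" by simp
    qed
    ultimately show "integrable lborel (\<lambda>r. LINT y|lborel. norm (case (r, y) of (r, y) \<Rightarrow> F r * ?k r y))"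
      by (subst integrable_cong_AE[symmetric]) (auto simp del: norm_mult)
    show "AE r in lborel. integrable lborel (\<lambda>y. case (r, y) of (r, y) \<Rightarrow> F r * ?k r y)"
    proof (rule eventually_mono[OF AE_lborel_singleton[of 0]])
      fix r :: real assume "r \<noteq> 0"
      then show "integrable lborel (\<lambda>y. case (r, y) of (r, y) \<Rightarrow> F r * ?k r y)"
        using Gamma_log(1)[OF w, of "r\<^sup>2 / 2"] by simp
    qed
  qed measurable
  have "(LINT y|lborel. exp (w * of_real y) * (LINT r|lborel. F r * of_real (exp (- (r\<^sup>2 / 2 * exp y))))) =
      (LINT y|lborel. LINT r|lborel. F r * ?k r y)"
    by (simp add: mult.left_commute[of "F _" "exp _"])
  also have "\<dots> = (LINT r|lborel. LINT y|lborel. F r * ?k r y)"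
    using lborel_pair.Fubini_integral[OF I] by simp
  also have "\<dots> = (LINT r|lborel. Gamma w * exp (w * of_real (ln 2)) * (F r * exp (- 2 * w * of_real (ln \<bar>r\<bar>))))"
  proof (rule Bochner_Integration.integral_cong_AE)
    show "AE r in lborel. (LINT y|lborel. F r * ?k r y) = Gamma w * exp (w * of_real (ln 2)) * (F r * exp (- 2 * w * of_real (ln \<bar>r\<bar>)))"
    proof (rule eventually_mono[OF AE_lborel_singleton[of 0]])
      fix r :: real assume "r \<noteq> 0"
      have "(LINT y|lborel. F r * ?k r y) = F r * (Gamma w * exp (- w * of_real (ln (r\<^sup>2 / 2))))"
        using Gamma_log(2)[OF w, of "r\<^sup>2 / 2"] \<open>r \<noteq> 0\<close> by simp
      also have "exp (- w * of_real (ln (r\<^sup>2 / 2))) = exp (w * of_real (ln 2)) * exp (- 2 * w * of_real (ln \<bar>r\<bar>))"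
        unfolding ln[OF \<open>r \<noteq> 0\<close>] by (simp add: algebra_simps flip: exp_add)
      finally show "(LINT y|lborel. F r * ?k r y) = Gamma w * exp (w * of_real (ln 2)) * (F r * exp (- 2 * w * of_real (ln \<bar>r\<bar>)))"
        by simp
    qed
  qed measurable
  finally show ?thesis by simp
qed

lemma fourier_gaussian:
  assumes "\<rho> > 0"
  shows "fourier (\<lambda>r. of_real (exp (- (r\<^sup>2 / 2 * \<rho>)))) t = of_real (sqrt (2 * pi / \<rho>) * exp (- (t\<^sup>2 / 2 / \<rho>)))"
    and "integrable lborel (\<lambda>r. complex_of_real (exp (- (r\<^sup>2 / 2 * \<rho>))))"
proof -
  define g where "g h = complex_of_real (exp (- h\<^sup>2 / 2))" for h :: real
  have g: "fourier g t = of_real (sqrt (2 * pi) * exp (- t\<^sup>2 / 2))" for t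
  proof -
    have "fourier g t = (LINT z|lborel. of_real (sqrt (2 * pi)) * (of_real (std_normal_density z) * exp (\<i> * of_real z * of_real (- t))))"
      unfolding fourier_def by (rule Bochner_Integration.integral_cong[OF refl]) (simp add: g_def std_normal_density_def)
    then show ?thesis using integral_gauss_exp[of "- t"] by simp
  qed
  have eq: "(\<lambda>r. complex_of_real (exp (- (r\<^sup>2 / 2 * \<rho>)))) = (\<lambda>r. g (sqrt \<rho> * r + 0))"
    using assms by (simp add: g_def power_mult_distrib fun_eq_iff mult.commute)
  show "fourier (\<lambda>r. of_real (exp (- (r\<^sup>2 / 2 * \<rho>)))) t = of_real (sqrt (2 * pi / \<rho>) * exp (- (t\<^sup>2 / 2 / \<rho>)))"
    unfolding eq using assms by (subst fourier_affine) (auto simp: g real_sqrt_divide power_divide)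
  have "integrable lborel g"
    unfolding g_def[abs_def] complex_of_real_integrable_eq by (rule integral_exp_square)
  from lborel_integrable_real_affine[OF this, of "sqrt \<rho>" 0] assms
  show "integrable lborel (\<lambda>r. complex_of_real (exp (- (r\<^sup>2 / 2 * \<rho>))))"
    unfolding eq by simp
qed

lemma gaussian_duality:
  assumes f: "integrable lborel f" and \<rho>: "\<rho> > 0"
  shows "(LINT r|lborel. fourier f r * of_real (exp (- (r\<^sup>2 / 2 * \<rho>)))) =
     of_real (sqrt (2 * pi / \<rho>)) * (LINT t|lborel. f t * of_real (exp (- (t\<^sup>2 / 2 / \<rho>))))"
proof -
  let ?g = "\<lambda>r. complex_of_real (exp (- (r\<^sup>2 / 2 * \<rho>)))"
  have [measurable]: "f \<in> borel_measurable borel" using f by simp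
  have "(LINT r|lborel. fourier f r * ?g r) = (LINT r|lborel. ?g r * (LINT t|lborel. f t * exp (- (\<i> * of_real t * of_real r))))"
    by (simp add: fourier_def mult.commute)
  also have "\<dots> = (LINT t|lborel. f t * (LINT r|lborel. ?g r * exp (- (\<i> * of_real t * of_real r))))"
    by (rule fubini_kernel(1)[OF fourier_gaussian(2)[OF \<rho>] f, where B = 1]) auto
  also have "\<dots> = (LINT t|lborel. f t * fourier ?g t)"
    by (simp add: fourier_def mult.commute mult.left_commute)
  finally have e: "(LINT r|lborel. fourier f r * ?g r) = (LINT t|lborel. f t * fourier ?g t)" .
  show ?thesis
    unfolding e fourier_gaussian(1)[OF \<rho>] of_real_mult mult.left_commute[of "f _"]
    by (rule integral_mult_right_zero)
qed

text \<open>This is the preceding identity for the derivative of \<open>f\<close>, whose transform is \<open>\<i> r\<close> times that of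
  \<open>f\<close>, followed by an integration by parts.\<close>

lemma gaussian_duality_odd:
  assumes f: "test_fun f" and \<rho>: "\<rho> > 0"
  shows "(LINT r|lborel. (of_real r * fourier f r) * of_real (exp (- (r\<^sup>2 / 2 * \<rho>)))) =
     - \<i> * of_real (sqrt (2 * pi / \<rho>) / \<rho>) * (LINT t|lborel. (of_real t * f t) * of_real (exp (- (t\<^sup>2 / 2 / \<rho>))))"
proof -
  obtain f' where f': "test_fun f'" and der: "\<And>t. (f has_vector_derivative f' t) (at t)"
    using test_fun_has_derivative[OF f] by blast
  obtain R where R: "\<And>t. R < \<bar>t\<bar> \<Longrightarrow> f t = 0" using f by (meson test_funE)
  have R': "\<And>t. R < \<bar>t\<bar> \<Longrightarrow> f' t = 0" by (rule vanishes_outside_derivative[OF der R])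
  let ?g = "\<lambda>t. complex_of_real (exp (- (t\<^sup>2 / 2 / \<rho>)))"
  have gder: "(?g has_vector_derivative of_real (- t / \<rho>) * ?g t) (at t)" for t
  proof -
    have "((\<lambda>t. exp (- (t\<^sup>2 / 2 / \<rho>))) has_real_derivative (- t / \<rho>) * exp (- (t\<^sup>2 / 2 / \<rho>))) (at t)"
      using \<rho> by (auto intro!: derivative_eq_intros)
    then have "(?g has_vector_derivative of_real ((- t / \<rho>) * exp (- (t\<^sup>2 / 2 / \<rho>)))) (at t)"
      by (intro has_vector_derivative_of_real) (simp add: has_real_derivative_iff_has_vector_derivative)
    then show ?thesis by simp
  qed
  have g1: "norm (?g t) \<le> 1" for t using \<rho> by simp
  have [measurable]: "f \<in> borel_measurable borel" using test_fun_integrable[OF f] by simp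
  have tf: "test_fun (\<lambda>t. of_real t * f t)"
  proof (rule test_fun_mult_smooth[OF f])
    show "smooth complex_of_real"
      by (rule smooth_antiderivative[OF smooth_const[of 1]])
         (auto intro!: derivative_eq_intros has_vector_derivative_of_real simp flip: has_real_derivative_iff_has_vector_derivative)
  qed
  have i1: "integrable lborel (\<lambda>t. of_real t * f t * ?g t)"
    by (rule integrable_times_bounded[OF test_fun_integrable[OF tf] _ g1]) simp
  have i2: "integrable lborel (\<lambda>t. f' t * ?g t)"
    by (rule integrable_times_bounded[OF test_fun_integrable[OF f'] _ g1]) simp
  have "(LINT t|lborel. f t * (of_real (- t / \<rho>) * ?g t) + f' t * ?g t) = 0"
  proof (rule integral_derivative_eq_0[where R = R and g = "\<lambda>t. f t * ?g t"])
    show "((\<lambda>t. f t * ?g t) has_vector_derivative f t * (of_real (- t / \<rho>) * ?g t) + f' t * ?g t) (at t)" for t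
      by (rule has_vector_derivative_mult[OF der gder])
    have "integrable lborel (\<lambda>t. of_real (- 1 / \<rho>) * (of_real t * f t * ?g t) + f' t * ?g t)"
      by (intro Bochner_Integration.integrable_add integrable_mult_right i1 i2)
    then show "integrable lborel (\<lambda>t. f t * (of_real (- t / \<rho>) * ?g t) + f' t * ?g t)"
      by (simp add: mult_ac)
  qed (use R R' in auto)
  moreover have "(LINT t|lborel. f t * (of_real (- t / \<rho>) * ?g t) + f' t * ?g t) =
      of_real (- 1 / \<rho>) * (LINT t|lborel. of_real t * f t * ?g t) + (LINT t|lborel. f' t * ?g t)"
  proof -
    have "(LINT t|lborel. of_real (- 1 / \<rho>) * (of_real t * f t * ?g t) + f' t * ?g t) =
      of_real (- 1 / \<rho>) * (LINT t|lborel. of_real t * f t * ?g t) + (LINT t|lborel. f' t * ?g t)"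
      using i1 i2 by (subst Bochner_Integration.integral_add) auto
    then show ?thesis by (simp add: mult_ac)
  qed
  ultimately have parts: "(LINT t|lborel. f' t * ?g t) = of_real (1 / \<rho>) * (LINT t|lborel. of_real t * f t * ?g t)"
    by (simp add: field_simps)
  have "\<i> * (LINT r|lborel. (of_real r * fourier f r) * of_real (exp (- (r\<^sup>2 / 2 * \<rho>)))) =
     (LINT r|lborel. fourier f' r * of_real (exp (- (r\<^sup>2 / 2 * \<rho>))))"
    by (simp add: fourier_derivative[OF f f' der] mult.assoc)
  also have "\<dots> = of_real (sqrt (2 * pi / \<rho>)) * (LINT t|lborel. f' t * ?g t)"
    by (rule gaussian_duality[OF test_fun_integrable[OF f'] \<rho>])
  also have "\<dots> = of_real (sqrt (2 * pi / \<rho>) / \<rho>) * (LINT t|lborel. of_real t * f t * ?g t)"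
    unfolding parts by simp
  finally have "- \<i> * (\<i> * (LINT r|lborel. (of_real r * fourier f r) * of_real (exp (- (r\<^sup>2 / 2 * \<rho>))))) =
     - \<i> * (of_real (sqrt (2 * pi / \<rho>) / \<rho>) * (LINT t|lborel. of_real t * f t * ?g t))" by simp
  then show ?thesis by (simp add: mult.assoc)
qed

section \<open>The norm in Mellin coordinates\<close>

lemma integrable_decay:
  fixes g :: "real \<Rightarrow> complex"
  assumes [measurable]: "g \<in> borel_measurable borel"
    and N: "\<And>r. r \<noteq> 0 \<Longrightarrow> norm (g r) \<le> N * min 1 (1 / \<bar>r\<bar>)" and a: "-1 < a" "a < 0"
  shows "integrable lborel (\<lambda>r. norm (g r) * exp (a * ln \<bar>r\<bar>))"
proof (rule Bochner_Integration.integrable_bound)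
  show "integrable lborel (\<lambda>r::real. N * (\<bar>r\<bar> powr a * min 1 (1 / \<bar>r\<bar> powr 1)))"
    using a by (intro integrable_mult_right integrable_powr_min) auto
  have "norm (norm (g r) * exp (a * ln \<bar>r\<bar>)) \<le> norm (N * (\<bar>r\<bar> powr a * min 1 (1 / \<bar>r\<bar> powr 1)))" if "r \<noteq> 0" for r
  proof -
    have "norm (g r) * \<bar>r\<bar> powr a \<le> (N * min 1 (1 / \<bar>r\<bar>)) * \<bar>r\<bar> powr a"
      by (intro mult_right_mono N that) simp
    also have "\<dots> = N * (\<bar>r\<bar> powr a * min 1 (1 / \<bar>r\<bar> powr 1))"
      using that by simp
    also have "\<dots> \<le> norm (N * (\<bar>r\<bar> powr a * min 1 (1 / \<bar>r\<bar> powr 1)))"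
      by (simp only: real_norm_def abs_ge_self)
    finally show ?thesis using that by (simp add: powr_def)
  qed
  then show "AE r in lborel. norm (norm (g r) * exp (a * ln \<bar>r\<bar>)) \<le> norm (N * (\<bar>r\<bar> powr a * min 1 (1 / \<bar>r\<bar> powr 1)))"
    using AE_lborel_singleton[of 0] by (rule eventually_mono[rotated])
qed measurable

lemma fourier_decay:
  assumes f: "test_fun f"
  obtains N where "\<And>r. r \<noteq> 0 \<Longrightarrow> norm (fourier f r) \<le> N * min 1 (1 / \<bar>r\<bar>)" "N \<ge> 0"
proof -
  obtain f' where f': "test_fun f'" and der: "\<And>t. (f has_vector_derivative f' t) (at t)"
    using test_fun_has_derivative[OF f] by blast
  define N where "N = (LINT t|lborel. norm (f t)) + (LINT t|lborel. norm (f' t))"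
  have N: "N \<ge> 0" by (auto simp: N_def intro!: add_nonneg_nonneg integral_nonneg_AE)
  have "norm (fourier f r) \<le> N * min 1 (1 / \<bar>r\<bar>)" if "r \<noteq> 0" for r
  proof (rule power2_le_imp_le)
    have "(min 1 (1 / \<bar>r\<bar>))\<^sup>2 = min 1 (1 / r\<^sup>2)"
      using that by (auto simp: min_def power_divide abs_square_le_1 divide_le_eq_1 le_divide_eq_1 abs_square_less_1)
    then show "(norm (fourier f r))\<^sup>2 \<le> (N * min 1 (1 / \<bar>r\<bar>))\<^sup>2"
      using fourier_test_bound[OF f f' der that] by (simp add: power_mult_distrib N_def)
  qed (use N in auto)
  then show ?thesis using N that by blast
qed

lemma test_decay:
  assumes f: "test_fun f"
  obtains N where "\<And>t. t \<noteq> 0 \<Longrightarrow> norm (f t) \<le> N * min 1 (1 / \<bar>t\<bar>)"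
proof -
  obtain R where R: "R > 0" "\<And>t. R < \<bar>t\<bar> \<Longrightarrow> f t = 0" using f by (meson test_funE)
  obtain B where B: "\<And>t. norm (f t) \<le> B" using test_fun_nice[OF f] by (auto simp: nice_def bounded_iff)
  have B0: "B \<ge> 0" using B[of 0] norm_ge_zero order_trans by blast
  have "norm (f t) \<le> (B * max 1 R) * min 1 (1 / \<bar>t\<bar>)" if "t \<noteq> 0" for t
  proof (cases "R < \<bar>t\<bar>")
    case False
    have "1 \<le> max 1 R * min 1 (1 / \<bar>t\<bar>)"
      using False that by (auto simp: min_def max_def field_simps)
    then have "B * 1 \<le> B * (max 1 R * min 1 (1 / \<bar>t\<bar>))" using B0 by (rule mult_left_mono)
    with B[of t] show ?thesis by (simp add: mult.assoc)
  qed (use R B0 in \<open>auto intro!: mult_nonneg_nonneg\<close>)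
  then show ?thesis using that by blast
qed

text \<open>If \<open>F\<close> and \<open>G\<close> have dual integrals against Gaussians of dual widths, then integrating over all
  widths relates their Mellin transforms.\<close>

lemma gaussian_functional_equation:
  fixes F G :: "real \<Rightarrow> complex"
  assumes F: "F \<in> borel_measurable borel" and w: "Re w > 0"
    and intF: "integrable lborel (\<lambda>r. norm (F r) * exp (- 2 * Re w * ln \<bar>r\<bar>))"
    and G: "G \<in> borel_measurable borel" and w': "Re w' > 0"
    and intG: "integrable lborel (\<lambda>r. norm (G r) * exp (- 2 * Re w' * ln \<bar>r\<bar>))"
    and dual: "\<And>y. exp (w * of_real y) * (LINT r|lborel. F r * of_real (exp (- (r\<^sup>2 / 2 * exp y)))) =
       \<kappa> * (exp (w' * of_real (- y)) * (LINT t|lborel. G t * of_real (exp (- (t\<^sup>2 / 2 * exp (- y))))))"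
  shows "Gamma w * exp (w * of_real (ln 2)) * (LINT r|lborel. F r * exp (- 2 * w * of_real (ln \<bar>r\<bar>))) =
     \<kappa> * (Gamma w' * exp (w' * of_real (ln 2)) * (LINT t|lborel. G t * exp (- 2 * w' * of_real (ln \<bar>t\<bar>))))"
proof -
  let ?H = "\<lambda>y. exp (w' * of_real y) * (LINT t|lborel. G t * of_real (exp (- (t\<^sup>2 / 2 * exp y))))"
  have "(LINT y|lborel. \<kappa> * ?H (- y)) = \<kappa> * (LINT y|lborel. ?H y)"
    using lborel_integral_real_affine[of "-1" ?H 0] by simp
  then show ?thesis
    unfolding integral_powr_gaussian_superposition[OF F w intF, symmetric]
      integral_powr_gaussian_superposition[OF G w' intG, symmetric] dual
    by simp
qed

text \<open>Twice the even (\<open>k = 0\<close>) or odd (\<open>k = 1\<close>) part of \<open>f\<close> on the half-line, in the coordinate \<open>t = exp x\<close>.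
  The exponential factor is chosen such that its Fourier transform is a Mellin transform on the line
  of real part \<open>1/2 - \<alpha>\<close>.\<close>

definition logpart :: "nat \<Rightarrow> real \<Rightarrow> (real \<Rightarrow> complex) \<Rightarrow> real \<Rightarrow> complex" where
  "logpart k \<alpha> f x = of_real (exp (x * (1/2 - \<alpha>))) * (f (exp x) + (-1) ^ k * f (- exp x))"

lemma mellin_log_coordinates:
  fixes g :: "real \<Rightarrow> complex"
  assumes [measurable]: "g \<in> borel_measurable borel"
    and N: "\<And>r. r \<noteq> 0 \<Longrightarrow> norm (g r) \<le> N * min 1 (1 / \<bar>r\<bar>)" and a: "-1 < Re a" "Re a < 0"
  shows "integrable lborel (\<lambda>x. exp ((a + 1) * of_real x) * g (exp x))"
    and "integrable lborel (\<lambda>x. exp ((a + 1) * of_real x) * g (- exp x))"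
    and "(LINT r|lborel. of_real (sgn r ^ k) * exp (a * of_real (ln \<bar>r\<bar>)) * g r) =
       (LINT x|lborel. exp ((a + 1) * of_real x) * g (exp x)) + (-1) ^ k * (LINT x|lborel. exp ((a + 1) * of_real x) * g (- exp x))"
proof -
  define h where "h k r = of_real (sgn r ^ k) * exp (a * of_real (ln \<bar>r\<bar>)) * g r" for k r
  have [measurable]: "h k \<in> borel_measurable borel" for k unfolding h_def[abs_def] by measurable
  have hi: "integrable lborel (h k)" for k
  proof (rule Bochner_Integration.integrable_bound[OF integrable_decay[OF _ N a]])
    have "\<bar>sgn r ^ k\<bar> \<le> 1" for r :: real by (simp add: power_abs abs_sgn_eq power_le_one)
    then have "norm (h k r) \<le> 1 * (norm (g r) * exp (Re a * ln \<bar>r\<bar>))" for r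
      by (simp add: h_def norm_mult norm_power mult_left_le_one_le mult.commute[of "norm (g r)"] mult.assoc power_abs)
    then show "AE r in lborel. norm (h k r) \<le> norm (norm (g r) * exp (Re a * ln \<bar>r\<bar>))" by simp
  qed simp_all
  have p: "exp x *\<^sub>R h k (exp x) = exp ((a + 1) * of_real x) * g (exp x)" for k x
    by (simp add: h_def scaleR_conv_of_real distrib_right exp_add exp_of_real)
  have n: "exp x *\<^sub>R h k (- exp x) = (-1) ^ k * (exp ((a + 1) * of_real x) * g (- exp x))" for k x
    by (simp add: h_def scaleR_conv_of_real distrib_right exp_add exp_of_real)
  show "integrable lborel (\<lambda>x. exp ((a + 1) * of_real x) * g (exp x))"
    using log_coordinates(1)[OF hi[of 0]] unfolding p .
  show "integrable lborel (\<lambda>x. exp ((a + 1) * of_real x) * g (- exp x))"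
    using log_coordinates(2)[OF hi[of 0]] unfolding n by simp
  show "(LINT r|lborel. of_real (sgn r ^ k) * exp (a * of_real (ln \<bar>r\<bar>)) * g r) =
       (LINT x|lborel. exp ((a + 1) * of_real x) * g (exp x)) + (-1) ^ k * (LINT x|lborel. exp ((a + 1) * of_real x) * g (- exp x))"
    using log_coordinates(3)[OF hi[of k]] unfolding p n unfolding h_def by simp
qed

context
  fixes \<alpha> :: real
  assumes \<alpha>: "\<bar>\<alpha>\<bar> < 1/2"
begin

text \<open>Tate's local functional equation, with the Gaussian (\<open>k = 0\<close>) or \<open>t\<close> times the Gaussian
  (\<open>k = 1\<close>) as the second function.  The quotient of Gamma factors that it produces is \<open>m_k\<close> up to a
  factor of modulus 1.\<close>

lemma local_functional_equation:
  assumes f: "test_fun f" and k: "k \<in> {0, 1}"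
  shows "norm (LINT r|lborel. of_real (sgn r ^ k) * exp ((Complex (1/2 + \<alpha>) u - 1) * of_real (ln \<bar>r\<bar>)) * fourier f r) =
     abs_m k \<alpha> u * norm (LINT t|lborel. of_real (sgn t ^ k) * exp (- Complex (1/2 + \<alpha>) u * of_real (ln \<bar>t\<bar>)) * f t)"
proof -
  define w w' where "w = Complex (1/4 + k/2 - \<alpha>/2) (- (u/2))" and "w' = Complex (1/4 + k/2 + \<alpha>/2) (u/2)"
  have Re: "Re w > 0" "Re w' > 0" using \<alpha> k by (auto simp: w_def w'_def)
  define F G where "F r = of_real (r ^ k) * fourier f r" and "G t = of_real (t ^ k) * f t" for r t
  define \<kappa> where "\<kappa> = (- \<i>) ^ k * of_real (sqrt (2 * pi))"
  have [measurable]: "f \<in> borel_measurable borel" "fourier f \<in> borel_measurable borel"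
    using test_fun_integrable[OF f] by auto
  have Fm [measurable]: "F \<in> borel_measurable borel" and Gm [measurable]: "G \<in> borel_measurable borel"
    unfolding F_def[abs_def] G_def[abs_def] by measurable
  have pw: "\<bar>r\<bar> ^ k * exp (b * ln \<bar>r\<bar>) = exp ((b + real k) * ln \<bar>r\<bar>)" if "r \<noteq> 0" for b r :: real
    using that k by (auto simp: distrib_right exp_add)
  have intF: "integrable lborel (\<lambda>r. norm (F r) * exp (- 2 * Re w * ln \<bar>r\<bar>))"
  proof -
    obtain N where "\<And>r. r \<noteq> 0 \<Longrightarrow> norm (fourier f r) \<le> N * min 1 (1 / \<bar>r\<bar>)" using fourier_decay[OF f] by blast
    then have "integrable lborel (\<lambda>r. norm (fourier f r) * exp ((\<alpha> - 1/2) * ln \<bar>r\<bar>))"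
      using \<alpha> by (intro integrable_decay) auto
    moreover have "AE r in lborel. norm (fourier f r) * exp ((\<alpha> - 1/2) * ln \<bar>r\<bar>) = norm (F r) * exp (- 2 * Re w * ln \<bar>r\<bar>)"
    proof (rule eventually_mono[OF AE_lborel_singleton[of 0]])
      fix r :: real assume "r \<noteq> 0"
      have "- 2 * Re w + real k = \<alpha> - 1/2" by (simp add: w_def)
      with pw[OF \<open>r \<noteq> 0\<close>, of "- 2 * Re w"]
      show "norm (fourier f r) * exp ((\<alpha> - 1/2) * ln \<bar>r\<bar>) = norm (F r) * exp (- 2 * Re w * ln \<bar>r\<bar>)"
        by (simp add: F_def norm_mult norm_power mult_ac)
    qed
    ultimately show ?thesis by (subst (asm) integrable_cong_AE) auto
  qed
  have intG: "integrable lborel (\<lambda>r. norm (G r) * exp (- 2 * Re w' * ln \<bar>r\<bar>))"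
  proof -
    obtain N where "\<And>r. r \<noteq> 0 \<Longrightarrow> norm (f r) \<le> N * min 1 (1 / \<bar>r\<bar>)" using test_decay[OF f] by blast
    then have "integrable lborel (\<lambda>r. norm (f r) * exp ((- \<alpha> - 1/2) * ln \<bar>r\<bar>))"
      using \<alpha> by (intro integrable_decay) auto
    moreover have "AE r in lborel. norm (f r) * exp ((- \<alpha> - 1/2) * ln \<bar>r\<bar>) = norm (G r) * exp (- 2 * Re w' * ln \<bar>r\<bar>)"
    proof (rule eventually_mono[OF AE_lborel_singleton[of 0]])
      fix r :: real assume "r \<noteq> 0"
      have "- 2 * Re w' + real k = - \<alpha> - 1/2" by (simp add: w'_def)
      with pw[OF \<open>r \<noteq> 0\<close>, of "- 2 * Re w'"]
      show "norm (f r) * exp ((- \<alpha> - 1/2) * ln \<bar>r\<bar>) = norm (G r) * exp (- 2 * Re w' * ln \<bar>r\<bar>)"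
        by (simp add: G_def norm_mult norm_power mult_ac)
    qed
    ultimately show ?thesis by (subst (asm) integrable_cong_AE) auto
  qed
  have dual: "exp (w * of_real y) * (LINT r|lborel. F r * of_real (exp (- (r\<^sup>2 / 2 * exp y)))) =
       \<kappa> * (exp (w' * of_real (- y)) * (LINT t|lborel. G t * of_real (exp (- (t\<^sup>2 / 2 * exp (- y))))))" for y
  proof -
    have 1: "(LINT r|lborel. F r * of_real (exp (- (r\<^sup>2 / 2 * exp y)))) =
       (- \<i>) ^ k * of_real (sqrt (2 * pi / exp y) / exp y ^ k) * (LINT t|lborel. G t * of_real (exp (- (t\<^sup>2 / 2 / exp y))))"
      using k gaussian_duality[OF test_fun_integrable[OF f] exp_gt_zero, of y] gaussian_duality_odd[OF f exp_gt_zero, of y]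
      by (auto simp: F_def G_def)
    have 2: "sqrt (2 * pi / exp y) / exp y ^ k = sqrt (2 * pi) * exp (- (1/2 + real k) * y)"
    proof -
      have "sqrt (exp y) = exp (y / 2)"
        by (rule real_sqrt_unique) (simp_all add: power2_eq_square flip: exp_add)
      then show ?thesis
        by (simp add: real_sqrt_divide exp_of_nat_mult[symmetric] exp_minus field_simps flip: exp_add)
    qed
    \<comment> \<open>The factors from the width of the Gaussian move the exponent from \<open>w\<close> to \<open>- w'\<close>.\<close>
    have 3: "exp (w * of_real y) * of_real (exp (- (1/2 + real k) * y)) = exp (w' * of_real (- y))"
    proof -
      have "w * of_real y + of_real (- (1/2 + real k) * y) = w' * of_real (- y)"
        by (simp add: w_def w'_def complex_eq_iff field_simps)
      then show ?thesis by (simp only: exp_of_real[symmetric] exp_add[symmetric])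
    qed
    have 4: "t\<^sup>2 / 2 / exp y = t\<^sup>2 / 2 * exp (- y)" for t by (simp add: exp_minus inverse_eq_divide)
    show ?thesis
      unfolding 1 2 3[symmetric] 4 \<kappa>_def of_real_mult by (simp only: mult_ac)
  qed
  note main = gaussian_functional_equation[OF Fm Re(1) intF Gm Re(2) intG dual]
  have A: "(LINT r|lborel. F r * exp (- 2 * w * of_real (ln \<bar>r\<bar>))) =
     (LINT r|lborel. of_real (sgn r ^ k) * exp ((Complex (1/2 + \<alpha>) u - 1) * of_real (ln \<bar>r\<bar>)) * fourier f r)"
  proof (rule Bochner_Integration.integral_cong_AE)
    show "AE r in lborel. F r * exp (- 2 * w * of_real (ln \<bar>r\<bar>)) =
       of_real (sgn r ^ k) * exp ((Complex (1/2 + \<alpha>) u - 1) * of_real (ln \<bar>r\<bar>)) * fourier f r"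
    proof (rule eventually_mono[OF AE_lborel_singleton[of 0]])
      fix r :: real assume "r \<noteq> 0"
      have 1: "complex_of_real (r ^ k) = of_real (sgn r ^ k) * exp (of_nat k * of_real (ln \<bar>r\<bar>))"
      proof -
        have "exp (of_nat k * complex_of_real (ln \<bar>r\<bar>)) = of_real (\<bar>r\<bar> ^ k)"
          using k \<open>r \<noteq> 0\<close> by (auto simp: exp_of_real)
        moreover have "r ^ k = sgn r ^ k * \<bar>r\<bar> ^ k"
          by (simp only: power_mult_distrib[symmetric] sgn_mult_abs)
        ultimately show ?thesis by (simp only: of_real_mult)
      qed
      have 2: "of_nat k * of_real (ln \<bar>r\<bar>) + - 2 * w * of_real (ln \<bar>r\<bar>) = (Complex (1/2 + \<alpha>) u - 1) * of_real (ln \<bar>r\<bar>)"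
        by (simp add: w_def complex_eq_iff field_simps)
      show "F r * exp (- 2 * w * of_real (ln \<bar>r\<bar>)) =
         of_real (sgn r ^ k) * exp ((Complex (1/2 + \<alpha>) u - 1) * of_real (ln \<bar>r\<bar>)) * fourier f r"
        unfolding F_def 1 2[symmetric] exp_add by (simp only: mult_ac)
    qed
  qed measurable
  have B: "(LINT t|lborel. G t * exp (- 2 * w' * of_real (ln \<bar>t\<bar>))) =
     (LINT t|lborel. of_real (sgn t ^ k) * exp (- Complex (1/2 + \<alpha>) u * of_real (ln \<bar>t\<bar>)) * f t)"
  proof (rule Bochner_Integration.integral_cong_AE)
    show "AE t in lborel. G t * exp (- 2 * w' * of_real (ln \<bar>t\<bar>)) =
       of_real (sgn t ^ k) * exp (- Complex (1/2 + \<alpha>) u * of_real (ln \<bar>t\<bar>)) * f t"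
    proof (rule eventually_mono[OF AE_lborel_singleton[of 0]])
      fix r :: real assume "r \<noteq> 0"
      have 1: "complex_of_real (r ^ k) = of_real (sgn r ^ k) * exp (of_nat k * of_real (ln \<bar>r\<bar>))"
      proof -
        have "exp (of_nat k * complex_of_real (ln \<bar>r\<bar>)) = of_real (\<bar>r\<bar> ^ k)"
          using k \<open>r \<noteq> 0\<close> by (auto simp: exp_of_real)
        moreover have "r ^ k = sgn r ^ k * \<bar>r\<bar> ^ k"
          by (simp only: power_mult_distrib[symmetric] sgn_mult_abs)
        ultimately show ?thesis by (simp only: of_real_mult)
      qed
      have 2: "of_nat k * of_real (ln \<bar>r\<bar>) + - 2 * w' * of_real (ln \<bar>r\<bar>) = - Complex (1/2 + \<alpha>) u * of_real (ln \<bar>r\<bar>)"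
        by (simp add: w'_def complex_eq_iff field_simps)
      show "G r * exp (- 2 * w' * of_real (ln \<bar>r\<bar>)) =
         of_real (sgn r ^ k) * exp (- Complex (1/2 + \<alpha>) u * of_real (ln \<bar>r\<bar>)) * f r"
        unfolding G_def 1 2[symmetric] exp_add by (simp only: mult_ac)
    qed
  qed measurable
  have nG: "norm (Gamma w) = norm (Gamma (Complex (1/4 + k/2 - \<alpha>/2) (u/2)))"
    unfolding w_def by (rule norm_Gamma_minus)
  have "norm (Gamma w) * exp (Re w * ln 2) * norm (LINT r|lborel. F r * exp (- 2 * w * of_real (ln \<bar>r\<bar>))) =
     sqrt (2 * pi) * (norm (Gamma w') * exp (Re w' * ln 2) * norm (LINT t|lborel. G t * exp (- 2 * w' * of_real (ln \<bar>t\<bar>))))"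
    using arg_cong[OF main, of norm] by (simp add: norm_mult \<kappa>_def norm_power)
  moreover have "exp (Re w' * ln 2) = exp (Re w * ln 2) * 2 powr \<alpha>"
    by (simp add: powr_def w_def w'_def field_simps flip: exp_add)
  moreover have "norm (Gamma w) > 0"
    using Gamma_Complex_nonzero[OF Re(1), of "Im w"] by simp
  ultimately show ?thesis
    unfolding A B abs_m_eq[OF k] nG[symmetric] w'_def[symmetric]
    by (simp add: field_simps)
qed

lemma fourier_logpart:
  assumes f: "test_fun f"
  shows "integrable lborel (logpart k \<alpha> f)"
    and "fourier (logpart k \<alpha> f) u =
       (LINT t|lborel. of_real (sgn t ^ k) * exp (- Complex (1/2 + \<alpha>) u * of_real (ln \<bar>t\<bar>)) * f t)"
proof -
  obtain N where N: "\<And>r. r \<noteq> 0 \<Longrightarrow> norm (f r) \<le> N * min 1 (1 / \<bar>r\<bar>)" using test_decay[OF f] by blast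
  have fm: "f \<in> borel_measurable borel" using test_fun_integrable[OF f] by simp
  note M = mellin_log_coordinates[OF fm N, of "- Complex (1/2 + \<alpha>) v" for v]
  have e: "exp ((- Complex (1/2 + \<alpha>) v + 1) * of_real x) = of_real (exp (x * (1/2 - \<alpha>))) * exp (- (\<i> * of_real x * of_real v))" for v x
    unfolding exp_of_real[symmetric] exp_add[symmetric]
    by (rule arg_cong[of _ _ exp]) (simp add: complex_eq_iff algebra_simps)
  have M12: "integrable lborel (\<lambda>x. of_real (exp (x * (1/2 - \<alpha>))) * f (exp x))"
       "integrable lborel (\<lambda>x. of_real (exp (x * (1/2 - \<alpha>))) * f (- exp x))"
    using M(1,2)[of 0] \<alpha> unfolding e by simp_all
  have split: "logpart k \<alpha> f = (\<lambda>x. of_real (exp (x * (1/2 - \<alpha>))) * f (exp x) + (-1) ^ k * (of_real (exp (x * (1/2 - \<alpha>))) * f (- exp x)))"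
    by (simp add: logpart_def fun_eq_iff algebra_simps)
  show "integrable lborel (logpart k \<alpha> f)"
    unfolding split by (intro Bochner_Integration.integrable_add integrable_mult_right M12)
  have "fourier (logpart k \<alpha> f) u =
      (LINT x|lborel. exp ((- Complex (1/2 + \<alpha>) u + 1) * of_real x) * f (exp x)) +
      (-1) ^ k * (LINT x|lborel. exp ((- Complex (1/2 + \<alpha>) u + 1) * of_real x) * f (- exp x))"
  proof -
    have F: "fourier (\<lambda>x. of_real (exp (x * (1/2 - \<alpha>))) * f (s * exp x)) u =
        (LINT x|lborel. exp ((- Complex (1/2 + \<alpha>) u + 1) * of_real x) * f (s * exp x))" for s
      unfolding fourier_def e by (simp only: mult_ac)
    show ?thesis
      unfolding split fourier_add[OF M12(1) integrable_mult_right[OF M12(2)]] fourier_cmult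
      using F[of 1] F[of "-1"] by simp
  qed
  also have "\<dots> = (LINT t|lborel. of_real (sgn t ^ k) * exp (- Complex (1/2 + \<alpha>) u * of_real (ln \<bar>t\<bar>)) * f t)"
    by (rule M(3)[symmetric]) (use \<alpha> in auto)
  finally show "fourier (logpart k \<alpha> f) u =
       (LINT t|lborel. of_real (sgn t ^ k) * exp (- Complex (1/2 + \<alpha>) u * of_real (ln \<bar>t\<bar>)) * f t)" .
qed

text \<open>Plancherel's theorem applies to the transform of \<open>f\<close> on the two half-lines of \<open>r\<close>, in the
  coordinate \<open>\<bar>r\<bar> = exp x\<close> and multiplied by \<open>exp (x * (1/2 + \<alpha>))\<close>.  The parallelogram law passes from the
  half-lines to even and odd parts, and the local functional equation returns to \<open>f\<close>.\<close>

theorem mellin_plancherel: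
  assumes f: "test_fun f"
  shows "k \<in> {0, 1} \<Longrightarrow> integrable lborel (\<lambda>u. (abs_m k \<alpha> u * norm (fourier (logpart k \<alpha> f) u))\<^sup>2)"
    and "(test_norm \<alpha> f)\<^sup>2 = 1 / (4 * pi) *
      ((LINT u|lborel. (abs_m 0 \<alpha> u * norm (fourier (logpart 0 \<alpha> f) u))\<^sup>2) +
       (LINT u|lborel. (abs_m 1 \<alpha> u * norm (fourier (logpart 1 \<alpha> f) u))\<^sup>2))"
proof -
  obtain N where N: "\<And>r. r \<noteq> 0 \<Longrightarrow> norm (fourier f r) \<le> N * min 1 (1 / \<bar>r\<bar>)" "N \<ge> 0" using fourier_decay[OF f] by blast
  have fm [measurable]: "fourier f \<in> borel_measurable borel" using test_fun_integrable[OF f] by simp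
  note M = mellin_log_coordinates[OF fm N(1), of "Complex (1/2 + \<alpha>) v - 1" for v]
  define E where "E s x = of_real (exp (x * (1/2 + \<alpha>))) * fourier f (s * exp x)" for s x :: real
  have e: "exp ((Complex (1/2 + \<alpha>) v - 1 + 1) * of_real x) = of_real (exp (x * (1/2 + \<alpha>))) * exp (- (\<i> * of_real x * of_real (- v)))" for v x
    unfolding exp_of_real[symmetric] exp_add[symmetric]
    by (rule arg_cong[of _ _ exp]) (simp add: complex_eq_iff algebra_simps)
  have nice_E: "nice (E s)" if s: "s = 1 \<or> s = -1" for s
    unfolding nice_def
  proof (intro conjI)
    show "continuous_on UNIV (E s)"
      unfolding E_def[abs_def]
      by (intro continuous_intros continuous_on_compose2[OF continuous_fourier[OF test_fun_integrable[OF f], of UNIV]]) auto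
    show "integrable lborel (E s)"
      using s M(1,2)[of 0] \<alpha> unfolding e by (auto simp: E_def[abs_def])
    have "norm (E s x) \<le> N" for x
    proof -
      have "norm (fourier f (s * exp x)) \<le> N * min 1 (1 / exp x)"
        using N(1)[of "s * exp x"] s by auto
      then have "norm (E s x) \<le> exp (x * (1/2 + \<alpha>)) * (N * min 1 (1 / exp x))"
        unfolding E_def norm_mult by (intro mult_mono) auto
      also have "\<dots> \<le> N"
      proof (cases "x \<le> 0")
        case True
        then have "exp (x * (1/2 + \<alpha>)) \<le> 1" using \<alpha> by (simp add: mult_nonpos_nonneg)
        then have "exp (x * (1/2 + \<alpha>)) * (N * min 1 (1 / exp x)) \<le> 1 * (N * 1)"
          using N(2) by (intro mult_mono) auto
        then show ?thesis by simp
      next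
        case False
        have "exp (x * (1/2 + \<alpha>)) * (N * min 1 (1 / exp x)) \<le> exp (x * (1/2 + \<alpha>)) * (N * (1 / exp x))"
          using N(2) by (intro mult_left_mono) auto
        also have "\<dots> = N * exp (x * (\<alpha> - 1/2))"
          by (simp add: algebra_simps exp_diff exp_add) (simp add: field_simps flip: exp_add)
        also have "\<dots> \<le> N * 1"
          using False \<alpha> N(2) by (intro mult_left_mono) (auto simp: mult_nonneg_nonpos)
        finally show ?thesis by simp
      qed
      finally show ?thesis .
    qed
    then show "bounded (range (E s))" by (auto simp: bounded_iff)
  qed
  note nE = nice_E[of 1, simplified] nice_E[of "-1", simplified]
  have Ei: "integrable lborel (E 1)" "integrable lborel (E (-1))" using nE by (auto simp: nice_def)
  have FE: "norm (fourier (E 1) (- u) + (-1) ^ k * fourier (E (-1)) (- u)) = abs_m k \<alpha> u * norm (fourier (logpart k \<alpha> f) u)"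
    if k: "k \<in> {0, 1}" for k u
  proof -
    have "fourier (E 1) (- u) + (-1) ^ k * fourier (E (-1)) (- u) =
        (LINT r|lborel. of_real (sgn r ^ k) * exp ((Complex (1/2 + \<alpha>) u - 1) * of_real (ln \<bar>r\<bar>)) * fourier f r)"
    proof -
      have F: "fourier (E s) (- u) = (LINT x|lborel. exp ((Complex (1/2 + \<alpha>) u - 1 + 1) * of_real x) * fourier f (s * exp x))" for s
        unfolding fourier_def[of "E s"] E_def e by (simp only: mult_ac)
      show ?thesis
        unfolding F using M(3)[of u k] \<alpha> by simp
    qed
    then show ?thesis
      by (simp only: local_functional_equation[OF f k] fourier_logpart(2)[OF f])
  qed
  have sum_sq: "(norm a)\<^sup>2 + (norm b)\<^sup>2 = 1/2 * ((norm (a + b))\<^sup>2 + (norm (a - b))\<^sup>2)" for a b :: complex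
    using norm_add_sq[of a b] norm_add_sq[of a "- b"] by simp
  note P = plancherel[OF nE(1)] plancherel[OF nE(2)]
  note [measurable] = fourier_measurable[OF Ei(1)] fourier_measurable[OF Ei(2)]
  have refl: "(LINT u|lborel. h (- u)) = (LINT u|lborel. h u)" "integrable lborel (\<lambda>u. h (- u)) \<longleftrightarrow> integrable lborel h"
    for h :: "real \<Rightarrow> real"
    using lborel_integral_real_affine[of "-1" h 0] lborel_integrable_real_affine_iff[of "-1" h 0] by simp_all
  define Q where "Q k u = (norm (fourier (E 1) u + (-1) ^ k * fourier (E (-1)) u))\<^sup>2" for k :: nat and u
  have S: "(norm (fourier (E 1) u))\<^sup>2 + (norm (fourier (E (-1)) u))\<^sup>2 = 1/2 * (Q 0 u + Q 1 u)" for u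
    using sum_sq[of "fourier (E 1) u" "fourier (E (-1)) u"] by (simp add: Q_def)
  have Q0: "0 \<le> Q k u" for k u by (simp add: Q_def)
  have QI: "integrable lborel (Q k)" if "k \<in> {0, 1}" for k
  proof (rule Bochner_Integration.integrable_bound)
    show "integrable lborel (\<lambda>u. 2 * ((norm (fourier (E 1) u))\<^sup>2 + (norm (fourier (E (-1)) u))\<^sup>2))"
      using P by simp
    have "Q k u \<le> 2 * ((norm (fourier (E 1) u))\<^sup>2 + (norm (fourier (E (-1)) u))\<^sup>2)" for u
      unfolding S using that Q0[of 0 u] Q0[of 1 u] by auto
    then show "AE u in lborel. norm (Q k u) \<le> norm (2 * ((norm (fourier (E 1) u))\<^sup>2 + (norm (fourier (E (-1)) u))\<^sup>2))"
      using Q0 by (intro AE_I2) (auto intro: order_trans[OF _ abs_ge_self])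
  qed (simp add: Q_def[abs_def])
  have Q: "Q k (- u) = (abs_m k \<alpha> u * norm (fourier (logpart k \<alpha> f) u))\<^sup>2" if "k \<in> {0, 1}" for k u
    unfolding Q_def FE[OF that] ..
  show "k \<in> {0, 1} \<Longrightarrow> integrable lborel (\<lambda>u. (abs_m k \<alpha> u * norm (fourier (logpart k \<alpha> f) u))\<^sup>2)"
    using QI[of k] refl(2)[of "Q k"] Q[of k] by simp
  have "(test_norm \<alpha> f)\<^sup>2 = (LINT r|lborel. (norm (of_real (\<bar>r\<bar> powr \<alpha>) * fourier f r))\<^sup>2)"
    unfolding test_norm_def by (intro real_sqrt_pow2 integral_nonneg_AE) simp
  also have "\<dots> = (LINT x|lborel. (norm (E 1 x))\<^sup>2) + (LINT x|lborel. (norm (E (-1) x))\<^sup>2)"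
  proof -
    have "exp x * (norm (of_real (exp x powr \<alpha>) * fourier f (s * exp x)))\<^sup>2 = (norm (E s x))\<^sup>2" for s x
    proof -
      have "(exp (x * (1/2 + \<alpha>)))\<^sup>2 = exp x * (exp x powr \<alpha>)\<^sup>2"
        by (simp add: powr_def power2_eq_square algebra_simps flip: exp_add)
      then show ?thesis by (simp add: E_def norm_mult power_mult_distrib)
    qed
    from this[of _ 1] this[of _ "-1"] show ?thesis
      using log_coordinates(3)[OF test_weight_integrable[OF \<alpha> f]] by simp
  qed
  also have "\<dots> = 1 / (2 * pi) * ((LINT u|lborel. (norm (fourier (E 1) u))\<^sup>2) + (LINT u|lborel. (norm (fourier (E (-1)) u))\<^sup>2))"
    by (simp add: P distrib_left)
  also have "(LINT u|lborel. (norm (fourier (E 1) u))\<^sup>2) + (LINT u|lborel. (norm (fourier (E (-1)) u))\<^sup>2) =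
      (LINT u|lborel. 1/2 * (Q 0 u + Q 1 u))"
    unfolding S[symmetric] using P by (intro Bochner_Integration.integral_add[symmetric])
  also have "\<dots> = 1/2 * ((LINT u|lborel. Q 0 u) + (LINT u|lborel. Q 1 u))"
    using QI[of 0] QI[of 1] by simp
  also have "1 / (2 * pi) * \<dots> = 1 / (4 * pi) * ((LINT u|lborel. Q 0 (- u)) + (LINT u|lborel. Q 1 (- u)))"
    by (simp add: refl)
  finally show "(test_norm \<alpha> f)\<^sup>2 = 1 / (4 * pi) *
      ((LINT u|lborel. (abs_m 0 \<alpha> u * norm (fourier (logpart 0 \<alpha> f) u))\<^sup>2) +
       (LINT u|lborel. (abs_m 1 \<alpha> u * norm (fourier (logpart 1 \<alpha> f) u))\<^sup>2))"
    by (simp add: Q)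
qed

end

section \<open>The completion\<close>

lemma test_norm_cmult: "test_norm \<alpha> (\<lambda>t. k * f t) = norm k * test_norm \<alpha> f"
  using wnorm_cmult[OF weight_one] by (simp add: test_norm_wnorm)

lemma test_norm_zero: "test_norm \<alpha> (\<lambda>t. 0) = 0"
  using test_norm_cmult[of \<alpha> 0 "\<lambda>t. 0"] by simp

lemma test_norm_diff_commute: "test_norm \<alpha> (\<lambda>t. f t - g t) = test_norm \<alpha> (\<lambda>t. g t - f t)"
  using test_norm_cmult[of \<alpha> "-1" "\<lambda>t. f t - g t"] by simp

lemma distr_of_diff:
  assumes "test_fun f" "test_fun g"
  shows "distr_of (\<lambda>t. f t - g t) \<phi> = distr_of f \<phi> - distr_of g \<phi>"
proof (cases "test_fun \<phi>")
  case True
  have "integrable lborel (\<lambda>t. h t * \<phi> t)" if "test_fun h" for h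
  proof -
    obtain B where "\<And>t. norm (\<phi> t) \<le> B" using test_fun_nice[OF True] by (auto simp: nice_def bounded_iff)
    then show ?thesis
      by (rule integrable_times_bounded[OF test_fun_integrable[OF that], rotated])
         (use test_fun_integrable[OF True] in auto)
  qed
  then show ?thesis using True assms by (simp add: distr_of_def left_diff_distrib)
qed (simp add: distr_of_def)

lemma H_approx_test: "H_approx \<alpha> f u \<Longrightarrow> test_fun (f n)"
  by (simp add: H_approx_def)

lemma H_approx_cauchy:
  assumes "H_approx \<alpha> f u" "e > 0"
  obtains N where "\<And>m n. m \<ge> N \<Longrightarrow> n \<ge> N \<Longrightarrow> test_norm \<alpha> (\<lambda>t. f m t - f n t) < e"
  using assms unfolding H_approx_def by meson

lemma H_approx_lim: "H_approx \<alpha> f u \<Longrightarrow> (\<lambda>n. distr_of (f n) \<phi>) \<longlonglongrightarrow> u \<phi>"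
  by (simp add: H_approx_def)

context
  fixes \<alpha> :: real
  assumes \<alpha>: "\<bar>\<alpha>\<bar> < 1/2"
begin

lemma test_norm_triangle:
  "test_fun f \<Longrightarrow> test_fun g \<Longrightarrow> test_norm \<alpha> (\<lambda>t. f t + g t) \<le> test_norm \<alpha> f + test_norm \<alpha> g"
  using wnorm_triangle[OF \<alpha> weight_one] by (simp add: test_norm_wnorm)

lemma test_norm_diff_triangle:
  assumes "test_fun f" "test_fun g" "test_fun h"
  shows "test_norm \<alpha> (\<lambda>t. f t - h t) \<le> test_norm \<alpha> (\<lambda>t. f t - g t) + test_norm \<alpha> (\<lambda>t. g t - h t)"
  using test_norm_triangle[OF test_fun_diff[OF assms(1,2)] test_fun_diff[OF assms(2,3)]] by simp

lemma distr_of_bound: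
  "\<exists>C\<ge>0. \<forall>f. test_fun f \<longrightarrow> norm (distr_of f \<phi>) \<le> C * test_norm \<alpha> f"
proof (cases "test_fun \<phi>")
  case True
  show ?thesis
  proof (intro exI conjI allI impI)
    show "0 \<le> 1 / (2 * pi) * test_norm (- \<alpha>) (\<lambda>t. cnj (\<phi> t))"
      using test_norm_nonneg[of "- \<alpha>"] by simp
    show "norm (distr_of f \<phi>) \<le> 1 / (2 * pi) * test_norm (- \<alpha>) (\<lambda>t. cnj (\<phi> t)) * test_norm \<alpha> f" if "test_fun f" for f
      using pairing_bound[OF \<alpha> that True] True by (simp add: distr_of_def mult_ac)
  qed
qed (auto simp: distr_of_def)

lemma distr_of_tendsto:
  assumes "\<And>n. test_fun (f n)" "\<And>n. test_fun (g n)"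
    and "(\<lambda>n. test_norm \<alpha> (\<lambda>t. f n t - g n t)) \<longlonglongrightarrow> 0" and "(\<lambda>n. distr_of (f n) \<phi>) \<longlonglongrightarrow> c"
  shows "(\<lambda>n. distr_of (g n) \<phi>) \<longlonglongrightarrow> c"
proof -
  obtain C where C: "\<And>f. test_fun f \<Longrightarrow> norm (distr_of f \<phi>) \<le> C * test_norm \<alpha> f" using distr_of_bound by blast
  have "(\<lambda>n. C * test_norm \<alpha> (\<lambda>t. f n t - g n t)) \<longlonglongrightarrow> C * 0" by (intro tendsto_intros assms)
  then have L: "(\<lambda>n. C * test_norm \<alpha> (\<lambda>t. f n t - g n t)) \<longlonglongrightarrow> 0" by simp
  have "(\<lambda>n. distr_of (f n) \<phi> - distr_of (g n) \<phi>) \<longlonglongrightarrow> 0"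
  proof (rule Lim_null_comparison[OF always_eventually[OF allI] L])
    show "norm (distr_of (f n) \<phi> - distr_of (g n) \<phi>) \<le> C * test_norm \<alpha> (\<lambda>t. f n t - g n t)" for n
      using C[OF test_fun_diff[OF assms(1,2)]] by (simp add: distr_of_diff assms)
  qed
  from tendsto_diff[OF assms(4) this] show ?thesis by simp
qed

lemma H_approx_const: "test_fun f \<Longrightarrow> H_approx \<alpha> (\<lambda>_. f) (distr_of f)"
  by (simp add: H_approx_def test_norm_zero)

lemma H_approx_diff:
  assumes f: "H_approx \<alpha> f u" and g: "H_approx \<alpha> g v"
  shows "H_approx \<alpha> (\<lambda>n t. f n t - g n t) (\<lambda>\<phi>. u \<phi> - v \<phi>)"
  unfolding H_approx_def
proof (intro conjI allI impI)
  note tf = H_approx_test[OF f] and tg = H_approx_test[OF g]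
  show "test_fun (\<lambda>t. f n t - g n t)" for n by (rule test_fun_diff[OF tf tg])
  show "(\<lambda>n. distr_of (\<lambda>t. f n t - g n t) \<phi>) \<longlonglongrightarrow> u \<phi> - v \<phi>" for \<phi>
    unfolding distr_of_diff[OF tf tg] by (intro tendsto_diff H_approx_lim[OF f] H_approx_lim[OF g])
  fix e :: real assume "e > 0"
  then have "e / 2 > 0" by simp
  obtain M where M: "\<And>m n. m \<ge> M \<Longrightarrow> n \<ge> M \<Longrightarrow> test_norm \<alpha> (\<lambda>t. f m t - f n t) < e / 2"
    using H_approx_cauchy[OF f \<open>e / 2 > 0\<close>] by blast
  obtain N where N: "\<And>m n. m \<ge> N \<Longrightarrow> n \<ge> N \<Longrightarrow> test_norm \<alpha> (\<lambda>t. g m t - g n t) < e / 2"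
    using H_approx_cauchy[OF g \<open>e / 2 > 0\<close>] by blast
  show "\<exists>N. \<forall>m\<ge>N. \<forall>n\<ge>N. test_norm \<alpha> (\<lambda>t. f m t - g m t - (f n t - g n t)) < e"
  proof (intro exI[of _ "max M N"] allI impI)
    fix m n assume mn: "m \<ge> max M N" "n \<ge> max M N"
    have "test_norm \<alpha> (\<lambda>t. f m t - g m t - (f n t - g n t)) = test_norm \<alpha> (\<lambda>t. (f m t - f n t) - (g m t - g n t))"
      by (simp add: algebra_simps)
    also have "\<dots> \<le> test_norm \<alpha> (\<lambda>t. (f m t - f n t) - 0) + test_norm \<alpha> (\<lambda>t. 0 - (g m t - g n t))"
      by (rule test_norm_diff_triangle[OF test_fun_diff[OF tf tf] test_fun_zero test_fun_diff[OF tg tg]])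
    also have "\<dots> = test_norm \<alpha> (\<lambda>t. f m t - f n t) + test_norm \<alpha> (\<lambda>t. g m t - g n t)"
      using test_norm_diff_commute[of \<alpha> "\<lambda>t. 0" "\<lambda>t. g m t - g n t"] by simp
    also have "\<dots> < e" using M[of m n] N[of m n] mn by simp
    finally show "test_norm \<alpha> (\<lambda>t. f m t - g m t - (f n t - g n t)) < e" .
  qed
qed

lemma H_approx_null:
  assumes f: "H_approx \<alpha> f (\<lambda>\<phi>. 0)"
  shows "(\<lambda>n. test_norm \<alpha> (f n)) \<longlonglongrightarrow> 0"
proof (rule distribution_null_imp_norm_null[OF \<alpha> H_approx_test[OF f]])
  show "\<exists>N. \<forall>m\<ge>N. \<forall>n\<ge>N. test_norm \<alpha> (\<lambda>t. f m t - f n t) < e" if "e > 0" for e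
    using f that by (simp add: H_approx_def)
  show "(\<lambda>n. LINT t|lborel. f n t * \<phi> t) \<longlonglongrightarrow> 0" if "test_fun \<phi>" for \<phi>
    using H_approx_lim[OF f, of \<phi>] that by (simp add: distr_of_def)
qed

lemma H_approx_unique:
  assumes f: "H_approx \<alpha> f u" and g: "H_approx \<alpha> g u"
  shows "(\<lambda>n. test_norm \<alpha> (\<lambda>t. f n t - g n t)) \<longlonglongrightarrow> 0"
  using H_approx_null[of "\<lambda>n t. f n t - g n t"] H_approx_diff[OF f g] by simp

lemma H_approx_same_limit:
  assumes f: "H_approx \<alpha> f u" and g: "H_approx \<alpha> g v"
    and fg: "(\<lambda>n. test_norm \<alpha> (\<lambda>t. f n t - g n t)) \<longlonglongrightarrow> 0"
  shows "u = v"
proof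
  show "u \<phi> = v \<phi>" for \<phi>
    using distr_of_tendsto[OF H_approx_test[OF f] H_approx_test[OF g] fg H_approx_lim[OF f]] H_approx_lim[OF g]
    by (rule LIMSEQ_unique)
qed

lemma H_complete:
  assumes f: "\<And>n. test_fun (f n)"
    and cauchy: "\<And>e. e > 0 \<Longrightarrow> \<exists>N. \<forall>m\<ge>N. \<forall>n\<ge>N. test_norm \<alpha> (\<lambda>t. f m t - f n t) < e"
  shows "\<exists>u. H_approx \<alpha> f u"
proof -
  have "Cauchy (\<lambda>n. distr_of (f n) \<phi>)" for \<phi>
  proof (rule CauchyI)
    fix e :: real assume "e > 0"
    obtain C where C: "C \<ge> 0" "\<And>f. test_fun f \<Longrightarrow> norm (distr_of f \<phi>) \<le> C * test_norm \<alpha> f" using distr_of_bound by blast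
    from \<open>e > 0\<close> C have "e / (C + 1) > 0" by simp
    then obtain N where N: "\<And>m n. m \<ge> N \<Longrightarrow> n \<ge> N \<Longrightarrow> test_norm \<alpha> (\<lambda>t. f m t - f n t) < e / (C + 1)"
      using cauchy by meson
    have "norm (distr_of (f m) \<phi> - distr_of (f n) \<phi>) < e" if "m \<ge> N" "n \<ge> N" for m n
    proof -
      have "norm (distr_of (f m) \<phi> - distr_of (f n) \<phi>) \<le> C * test_norm \<alpha> (\<lambda>t. f m t - f n t)"
        using C(2)[OF test_fun_diff[OF f f]] by (simp add: distr_of_diff f)
      also have "\<dots> \<le> (C + 1) * test_norm \<alpha> (\<lambda>t. f m t - f n t)"
        using test_norm_nonneg by (simp add: mult_right_mono)
      also have "\<dots> < (C + 1) * (e / (C + 1))" using N[OF that] C(1) by (intro mult_strict_left_mono) auto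
      finally show ?thesis using C(1) by simp
    qed
    then show "\<exists>M. \<forall>m\<ge>M. \<forall>n\<ge>M. norm (distr_of (f m) \<phi> - distr_of (f n) \<phi>) < e" by blast
  qed
  then have "\<And>\<phi>. \<exists>c. (\<lambda>n. distr_of (f n) \<phi>) \<longlonglongrightarrow> c" using Cauchy_convergent_iff convergent_def by blast
  then obtain u where "\<And>\<phi>. (\<lambda>n. distr_of (f n) \<phi>) \<longlonglongrightarrow> u \<phi>" by metis
  then show ?thesis using f cauchy unfolding H_approx_def by blast
qed

text \<open>This allows approximating sequences to be replaced by sequences with better supports.\<close>

lemma H_approx_perturb:
  assumes f: "H_approx \<alpha> f u" and g: "\<And>n. test_fun (g n)"
    and fg: "(\<lambda>n. test_norm \<alpha> (\<lambda>t. f n t - g n t)) \<longlonglongrightarrow> 0"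
  shows "H_approx \<alpha> g u"
  unfolding H_approx_def
proof (intro conjI allI impI)
  note tf = H_approx_test[OF f]
  show "test_fun (g n)" for n by (rule g)
  show "(\<lambda>n. distr_of (g n) \<phi>) \<longlonglongrightarrow> u \<phi>" for \<phi>
    by (rule distr_of_tendsto[OF tf g fg H_approx_lim[OF f]])
  fix e :: real assume "e > 0"
  then have "e / 3 > 0" by simp
  obtain M where M: "\<And>m n. m \<ge> M \<Longrightarrow> n \<ge> M \<Longrightarrow> test_norm \<alpha> (\<lambda>t. f m t - f n t) < e / 3"
    using H_approx_cauchy[OF f \<open>e / 3 > 0\<close>] by blast
  obtain N where N: "\<And>n. n \<ge> N \<Longrightarrow> test_norm \<alpha> (\<lambda>t. f n t - g n t) < e / 3"
    using LIMSEQ_D[OF fg \<open>e / 3 > 0\<close>] test_norm_nonneg by (metis abs_of_nonneg diff_zero real_norm_def)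
  show "\<exists>N. \<forall>m\<ge>N. \<forall>n\<ge>N. test_norm \<alpha> (\<lambda>t. g m t - g n t) < e"
  proof (intro exI[of _ "max M N"] allI impI)
    fix m n assume mn: "m \<ge> max M N" "n \<ge> max M N"
    have "test_norm \<alpha> (\<lambda>t. g m t - g n t) \<le> test_norm \<alpha> (\<lambda>t. g m t - f m t) + test_norm \<alpha> (\<lambda>t. f m t - g n t)"
      by (rule test_norm_diff_triangle[OF g tf g])
    also have "test_norm \<alpha> (\<lambda>t. f m t - g n t) \<le> test_norm \<alpha> (\<lambda>t. f m t - f n t) + test_norm \<alpha> (\<lambda>t. f n t - g n t)"
      by (rule test_norm_diff_triangle[OF tf tf g])
    finally show "test_norm \<alpha> (\<lambda>t. g m t - g n t) < e"
      using M[of m n] N[of m] N[of n] mn test_norm_diff_commute[of \<alpha> "g m" "f m"] by simp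
  qed
qed

text \<open>Two sequences that approximate the same distribution differ by a null sequence in norm, by the
  injectivity of the completion, so the limit of the norms does not depend on the sequence.\<close>

lemma H_extend_tendsto:
  assumes c: "weight B c" and N: "\<And>f. test_fun f \<Longrightarrow> N f = wnorm \<alpha> c f" and f: "H_approx \<alpha> f u"
  shows "(\<lambda>n. N (f n)) \<longlonglongrightarrow> H_extend \<alpha> N u"
proof -
  have B: "B \<ge> 0" using c by (auto simp: weight_def intro: order_trans)
  have diff: "\<bar>N f - N g\<bar> \<le> sqrt B * test_norm \<alpha> (\<lambda>t. f t - g t)" if "test_fun f" "test_fun g" for f g
    using order_trans[OF wnorm_diff_triangle[OF \<alpha> c that] wnorm_le[OF \<alpha> c test_fun_diff[OF that]]] N that by simp
  have "Cauchy (\<lambda>n. N (f n))"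
  proof (rule CauchyI)
    fix e :: real assume "e > 0"
    then have "e / (sqrt B + 1) > 0" using B by (simp add: add_nonneg_pos)
    from H_approx_cauchy[OF f this] obtain M
      where M: "\<And>m n. m \<ge> M \<Longrightarrow> n \<ge> M \<Longrightarrow> test_norm \<alpha> (\<lambda>t. f m t - f n t) < e / (sqrt B + 1)" by blast
    have "norm (N (f m) - N (f n)) < e" if "m \<ge> M" "n \<ge> M" for m n
    proof -
      have "norm (N (f m) - N (f n)) \<le> sqrt B * test_norm \<alpha> (\<lambda>t. f m t - f n t)"
        using diff[OF H_approx_test[OF f] H_approx_test[OF f]] by simp
      also have "\<dots> \<le> (sqrt B + 1) * test_norm \<alpha> (\<lambda>t. f m t - f n t)"
        using test_norm_nonneg by (simp add: mult_right_mono)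
      also have "\<dots> < (sqrt B + 1) * (e / (sqrt B + 1))"
        using M[OF that] B by (intro mult_strict_left_mono) (auto intro: add_nonneg_pos)
      also have "\<dots> = e"
      proof -
        have "sqrt B + 1 \<noteq> 0" using B real_sqrt_ge_zero[OF B] by linarith
        then show ?thesis by simp
      qed
      finally show ?thesis .
    qed
    then show "\<exists>M. \<forall>m\<ge>M. \<forall>n\<ge>M. norm (N (f m) - N (f n)) < e" by blast
  qed
  then obtain l where l: "(\<lambda>n. N (f n)) \<longlonglongrightarrow> l" using Cauchy_convergent_iff convergent_def by blast
  have "H_extend \<alpha> N u = l"
    unfolding H_extend_def
  proof (rule the_equality)
    show "\<exists>f. H_approx \<alpha> f u \<and> (\<lambda>n. N (f n)) \<longlonglongrightarrow> l" using f l by blast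
    fix l' assume "\<exists>g. H_approx \<alpha> g u \<and> (\<lambda>n. N (g n)) \<longlonglongrightarrow> l'"
    then obtain g where g: "H_approx \<alpha> g u" "(\<lambda>n. N (g n)) \<longlonglongrightarrow> l'" by blast
    have "(\<lambda>n. sqrt B * test_norm \<alpha> (\<lambda>t. f n t - g n t)) \<longlonglongrightarrow> sqrt B * 0"
      by (intro tendsto_intros H_approx_unique[OF f g(1)])
    then have L: "(\<lambda>n. sqrt B * test_norm \<alpha> (\<lambda>t. f n t - g n t)) \<longlonglongrightarrow> 0" by simp
    have "(\<lambda>n. N (f n) - N (g n)) \<longlonglongrightarrow> 0"
    proof (rule Lim_null_comparison[OF always_eventually[OF allI] L])
      show "norm (N (f n) - N (g n)) \<le> sqrt B * test_norm \<alpha> (\<lambda>t. f n t - g n t)" for n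
        using diff[OF H_approx_test[OF f] H_approx_test[OF g(1)]] by simp
    qed
    moreover have "(\<lambda>n. N (f n) - N (g n)) \<longlonglongrightarrow> l - l'" by (intro tendsto_diff l g)
    ultimately show "l' = l" using LIMSEQ_unique by fastforce
  qed
  with l show ?thesis by simp
qed

lemma H_norm_tendsto: "H_approx \<alpha> f u \<Longrightarrow> (\<lambda>n. test_norm \<alpha> (f n)) \<longlonglongrightarrow> H_norm \<alpha> u"
  unfolding H_norm_def by (rule H_extend_tendsto[OF weight_one]) (simp_all add: test_norm_wnorm)

lemma H_norm_diff_triangle:
  assumes "u \<in> H_space \<alpha>" "v \<in> H_space \<alpha>" "w \<in> H_space \<alpha>"
  shows "H_norm \<alpha> (\<lambda>\<phi>. u \<phi> - w \<phi>) \<le> H_norm \<alpha> (\<lambda>\<phi>. u \<phi> - v \<phi>) + H_norm \<alpha> (\<lambda>\<phi>. v \<phi> - w \<phi>)"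
proof -
  obtain f g h where f: "H_approx \<alpha> f u" and g: "H_approx \<alpha> g v" and h: "H_approx \<alpha> h w"
    using assms by (auto simp: H_space_def)
  show ?thesis
    by (rule LIMSEQ_le[OF H_norm_tendsto[OF H_approx_diff[OF f h]]
          tendsto_add[OF H_norm_tendsto[OF H_approx_diff[OF f g]] H_norm_tendsto[OF H_approx_diff[OF g h]]]])
       (intro exI allI impI test_norm_diff_triangle H_approx_test[OF f] H_approx_test[OF g] H_approx_test[OF h])
qed

lemma H_norm_diff_commute:
  assumes "u \<in> H_space \<alpha>" "v \<in> H_space \<alpha>"
  shows "H_norm \<alpha> (\<lambda>\<phi>. u \<phi> - v \<phi>) = H_norm \<alpha> (\<lambda>\<phi>. v \<phi> - u \<phi>)"
proof -
  obtain f g where f: "H_approx \<alpha> f u" and g: "H_approx \<alpha> g v"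
    using assms by (auto simp: H_space_def)
  show ?thesis
    using H_norm_tendsto[OF H_approx_diff[OF f g]] H_norm_tendsto[OF H_approx_diff[OF g f]]
    unfolding test_norm_diff_commute[of \<alpha> "f _" "g _"] by (rule LIMSEQ_unique)
qed

lemma H_norm_diff_eq_0:
  assumes "u \<in> H_space \<alpha>" "v \<in> H_space \<alpha>" "H_norm \<alpha> (\<lambda>\<phi>. u \<phi> - v \<phi>) = 0"
  shows "u = v"
proof -
  obtain f g where f: "H_approx \<alpha> f u" and g: "H_approx \<alpha> g v"
    using assms by (auto simp: H_space_def)
  show ?thesis
    by (rule H_approx_same_limit[OF f g]) (use H_norm_tendsto[OF H_approx_diff[OF f g]] assms in simp)
qed

lemma H_norm_diff_nonneg:
  assumes "u \<in> H_space \<alpha>" "v \<in> H_space \<alpha>"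
  shows "0 \<le> H_norm \<alpha> (\<lambda>\<phi>. u \<phi> - v \<phi>)"
proof -
  obtain f g where f: "H_approx \<alpha> f u" and g: "H_approx \<alpha> g v"
    using assms by (auto simp: H_space_def)
  show ?thesis
    by (rule LIMSEQ_le_const[OF H_norm_tendsto[OF H_approx_diff[OF f g]]]) (auto intro: test_norm_nonneg)
qed

lemma H_approx_norm_tendsto:
  assumes f: "H_approx \<alpha> f u"
  shows "(\<lambda>n. H_norm \<alpha> (\<lambda>\<phi>. distr_of (f n) \<phi> - u \<phi>)) \<longlonglongrightarrow> 0"
proof (rule LIMSEQ_I)
  fix e :: real assume "e > 0"
  then have "e / 2 > 0" by simp
  obtain N where N: "\<And>m n. m \<ge> N \<Longrightarrow> n \<ge> N \<Longrightarrow> test_norm \<alpha> (\<lambda>t. f m t - f n t) < e / 2"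
    using H_approx_cauchy[OF f \<open>e / 2 > 0\<close>] by blast
  have "norm (H_norm \<alpha> (\<lambda>\<phi>. distr_of (f n) \<phi> - u \<phi>) - 0) < e" if "n \<ge> N" for n
  proof -
    have lim: "(\<lambda>m. test_norm \<alpha> (\<lambda>t. f n t - f m t)) \<longlonglongrightarrow> H_norm \<alpha> (\<lambda>\<phi>. distr_of (f n) \<phi> - u \<phi>)"
      by (rule H_norm_tendsto[OF H_approx_diff[OF H_approx_const[OF H_approx_test[OF f]] f]])
    have "H_norm \<alpha> (\<lambda>\<phi>. distr_of (f n) \<phi> - u \<phi>) \<le> e / 2"
      by (rule LIMSEQ_le_const2[OF lim]) (use N[OF that] in \<open>auto intro!: exI[of _ N] less_imp_le\<close>)
    moreover have "0 \<le> H_norm \<alpha> (\<lambda>\<phi>. distr_of (f n) \<phi> - u \<phi>)"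
      by (rule LIMSEQ_le_const[OF lim]) (auto intro: test_norm_nonneg)
    ultimately show ?thesis using \<open>e > 0\<close> by simp
  qed
  then show "\<exists>no. \<forall>n\<ge>no. norm (H_norm \<alpha> (\<lambda>\<phi>. distr_of (f n) \<phi> - u \<phi>) - 0) < e" by blast
qed

lemma test_in_H_space: "test_fun f \<Longrightarrow> distr_of f \<in> H_space \<alpha>"
  using H_approx_const by (auto simp: H_space_def)

end

section \<open>The operators on test functions\<close>

text \<open>The operator of the matrix with rows \<open>(0, -1)\<close> and \<open>(1, 0)\<close>.\<close>

definition inversion :: "complex \<Rightarrow> nat \<Rightarrow> (real \<Rightarrow> complex) \<Rightarrow> real \<Rightarrow> complex" where
  "inversion s \<epsilon> g t = of_real (sgn t ^ \<epsilon>) * of_real \<bar>t\<bar> powr (2 * s - 1) * g (- 1 / t)"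

definition vanishes_near :: "real \<Rightarrow> (real \<Rightarrow> complex) \<Rightarrow> bool" where
  "vanishes_near p f \<longleftrightarrow> (\<exists>d>0. \<forall>t. \<bar>t - p\<bar> < d \<longrightarrow> f t = 0)"

lemma inversion_test:
  assumes g: "test_fun g" and v: "vanishes_near 0 g"
  shows "test_fun (inversion s \<epsilon> g)" and "vanishes_near 0 (inversion s \<epsilon> g)"
proof -
  obtain R where R: "R > 0" "\<And>t. R < \<bar>t\<bar> \<Longrightarrow> g t = 0" using g by (meson test_funE)
  obtain d where d: "d > 0" "\<And>t. \<bar>t\<bar> < d \<Longrightarrow> g t = 0" using v by (auto simp: vanishes_near_def)
  have big: "R < \<bar>- 1 / t\<bar>" if "0 < \<bar>t\<bar>" "\<bar>t\<bar> < 1 / R" for t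
    using that R(1) by (simp add: field_simps)
  have "smooth (inversion s \<epsilon> g)"
    unfolding inversion_def[abs_def]
  proof (rule smooth_singular_power[OF test_fun_smooth[OF g] R(2) _ big])
    show "((\<lambda>t. - 1 / t) has_real_derivative 1 * sgn t ^ 0 * \<bar>t\<bar> powr (- 2)) (at t)" if "t \<noteq> 0" for t
      using that by (auto intro!: derivative_eq_intros simp: powr_minus divide_inverse power2_eq_square)
  qed (use R in auto)
  moreover have "inversion s \<epsilon> g t = 0" if "1 / d < \<bar>t\<bar>" for t
  proof -
    have "0 < \<bar>t\<bar>" using that d(1) by (meson divide_pos_pos less_trans zero_less_one)
    then have "\<bar>- 1 / t\<bar> < d" using that d(1) by (simp add: field_simps)
    then show ?thesis using d(2) by (simp add: inversion_def)
  qed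
  ultimately show "test_fun (inversion s \<epsilon> g)" by (rule test_funI)
  have "inversion s \<epsilon> g t = 0" if "\<bar>t\<bar> < 1 / R" for t
    using big[of t] R(2)[of "- 1 / t"] that by (cases "t = 0") (auto simp: inversion_def)
  then show "vanishes_near 0 (inversion s \<epsilon> g)"
    using R(1) by (auto simp: vanishes_near_def intro!: exI[of _ "1 / R"])
qed

lemma inversion_involution:
  assumes "vanishes_near 0 g"
  shows "inversion s \<epsilon> (inversion s \<epsilon> g) = (\<lambda>t. (-1) ^ \<epsilon> * g t)"
proof
  fix t :: real
  show "inversion s \<epsilon> (inversion s \<epsilon> g) t = (-1) ^ \<epsilon> * g t"
  proof (cases "t = 0")
    case True
    then show ?thesis using assms by (auto simp: vanishes_near_def inversion_def)
  next
    case False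
    have "of_real \<bar>t\<bar> powr (2 * s - 1) * of_real \<bar>- 1 / t\<bar> powr (2 * s - 1) = (of_real \<bar>t\<bar> * of_real \<bar>- 1 / t\<bar> :: complex) powr (2 * s - 1)"
      by (rule powr_times_real[symmetric]) auto
    also have "\<dots> = 1" using False by (simp flip: of_real_mult)
    finally have 1: "of_real \<bar>t\<bar> powr (2 * s - 1) * of_real \<bar>- 1 / t\<bar> powr (2 * s - 1) = (1::complex)" .
    have "sgn t * sgn (- 1 / t) = - 1" using False by (simp add: sgn_if)
    then have 2: "complex_of_real (sgn t ^ \<epsilon>) * of_real (sgn (- 1 / t) ^ \<epsilon>) = (-1) ^ \<epsilon>"
      by (metis of_real_1 of_real_minus of_real_mult of_real_power power_mult_distrib)
    have 3: "- 1 / (- 1 / t) = t" using False by simp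
    have "inversion s \<epsilon> (inversion s \<epsilon> g) t =
       (of_real (sgn t ^ \<epsilon>) * of_real (sgn (- 1 / t) ^ \<epsilon>)) *
       (of_real \<bar>t\<bar> powr (2 * s - 1) * of_real \<bar>- 1 / t\<bar> powr (2 * s - 1)) * g t"
      unfolding inversion_def 3 by (simp only: mult_ac)
    then show ?thesis unfolding 1 2 by simp
  qed
qed

lemma test_norm_affine:
  assumes a: "a \<noteq> 0"
  shows "test_norm \<alpha> (\<lambda>t. f (a * t + b)) = \<bar>a\<bar> powr (\<alpha> - 1/2) * test_norm \<alpha> f"
proof -
  let ?h = "\<lambda>r. (norm (of_real (\<bar>r\<bar> powr \<alpha>) * fourier f r))\<^sup>2"
  have pt: "(norm (of_real (\<bar>0 + a * r\<bar> powr \<alpha>) * fourier (\<lambda>t. f (a * t + b)) (0 + a * r)))\<^sup>2 = (\<bar>a\<bar> powr \<alpha> / \<bar>a\<bar>)\<^sup>2 * ?h r" for r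
    using a by (simp add: fourier_affine norm_mult norm_divide power_mult_distrib abs_mult powr_mult power_divide)
  have "(LINT r|lborel. (norm (of_real (\<bar>r\<bar> powr \<alpha>) * fourier (\<lambda>t. f (a * t + b)) r))\<^sup>2) =
      \<bar>a\<bar> *\<^sub>R (LINT r|lborel. (\<bar>a\<bar> powr \<alpha> / \<bar>a\<bar>)\<^sup>2 * ?h r)"
    unfolding pt[symmetric] using a by (rule lborel_integral_real_affine)
  also have "\<dots> = (\<bar>a\<bar> powr (\<alpha> - 1/2))\<^sup>2 * (LINT r|lborel. ?h r)"
  proof -
    have "\<bar>a\<bar> powr (\<alpha> - 1/2) = \<bar>a\<bar> powr \<alpha> / sqrt \<bar>a\<bar>" using a by (simp add: powr_diff powr_half_sqrt)
    moreover have "(P / sqrt y)\<^sup>2 = y * (P / y)\<^sup>2" if "y > 0" for P y :: real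
      using that by (simp add: power_divide power2_eq_square)
    ultimately have "(\<bar>a\<bar> powr (\<alpha> - 1/2))\<^sup>2 = \<bar>a\<bar> * (\<bar>a\<bar> powr \<alpha> / \<bar>a\<bar>)\<^sup>2"
      using a by simp
    then show ?thesis by simp
  qed
  finally show ?thesis by (simp add: test_norm_def real_sqrt_mult)
qed

text \<open>The point \<open>x$2$2 / x$2$1\<close> is the value of the fractional linear map at infinity; \<open>f\<close> must vanish near it
  for the image of \<open>f\<close> to have compact support.\<close>

definition admissible :: "real^2^2 \<Rightarrow> (real \<Rightarrow> complex) \<Rightarrow> bool" where
  "admissible x f \<longleftrightarrow> test_fun f \<and> (x$2$1 \<noteq> 0 \<longrightarrow> vanishes_near (x$2$2 / x$2$1) f)"

lemma admissible_test: "admissible x f \<Longrightarrow> test_fun f"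
  by (simp add: admissible_def)

lemma admissible_diff:
  assumes f: "admissible x f" and g: "admissible x g"
  shows "admissible x (\<lambda>t. f t - g t)"
proof -
  have "vanishes_near p (\<lambda>t. f t - g t)" if f: "vanishes_near p f" and g: "vanishes_near p g" for p
  proof -
    obtain c d where "c > 0" "d > 0" "\<And>t. \<bar>t - p\<bar> < c \<Longrightarrow> f t = 0" "\<And>t. \<bar>t - p\<bar> < d \<Longrightarrow> g t = 0"
      using f g by (auto simp: vanishes_near_def)
    then show ?thesis unfolding vanishes_near_def by (intro exI[of _ "min c d"]) auto
  qed
  then show ?thesis using assms by (auto simp: admissible_def intro: test_fun_diff)
qed

lemma ks_fun_diff: "ks_fun s \<epsilon> x (\<lambda>t. f t - g t) = (\<lambda>t. ks_fun s \<epsilon> x f t - ks_fun s \<epsilon> x g t)"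
  by (simp add: ks_fun_def fun_eq_iff right_diff_distrib)

lemma powr_abs_mult:
  "complex_of_real \<bar>a * b\<bar> powr z = of_real \<bar>a\<bar> powr z * of_real \<bar>b\<bar> powr z"
proof -
  have "(of_real \<bar>a\<bar> * of_real \<bar>b\<bar> :: complex) powr z = of_real \<bar>a\<bar> powr z * of_real \<bar>b\<bar> powr z"
    by (rule powr_times_real) auto
  then show ?thesis by (simp add: abs_mult)
qed

text \<open>Bruhat decomposition: an affine substitution, followed by inversion, a translation and a scalar.\<close>

lemma ks_fun_bruhat:
  assumes x: "x \<in> SL2R" and c: "x$2$1 \<noteq> 0"
  shows "ks_fun s \<epsilon> x f = (\<lambda>t. (of_real (sgn (x$2$1) ^ \<epsilon>) * of_real \<bar>x$2$1\<bar> powr (2 * s - 1)) *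
     inversion s \<epsilon> (\<lambda>u. f (1 / (x$2$1)\<^sup>2 * u + x$2$2 / x$2$1)) (1 * t + x$1$1 / x$2$1))"
proof
  fix t
  define \<tau> where "\<tau> = t + x$1$1 / x$2$1"
  have det: "x$1$1 * x$2$2 - x$1$2 * x$2$1 = 1" using x by (simp add: SL2R_def det_2)
  have lin: "x$1$1 + t * x$2$1 = x$2$1 * \<tau>" "x$1$1 + x$2$1 * t = x$2$1 * \<tau>"
    using c by (auto simp: \<tau>_def field_simps)
  show "ks_fun s \<epsilon> x f t = (of_real (sgn (x$2$1) ^ \<epsilon>) * of_real \<bar>x$2$1\<bar> powr (2 * s - 1)) *
     inversion s \<epsilon> (\<lambda>u. f (1 / (x$2$1)\<^sup>2 * u + x$2$2 / x$2$1)) (1 * t + x$1$1 / x$2$1)"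
  proof (cases "\<tau> = 0")
    case True
    then show ?thesis unfolding ks_fun_def inversion_def lin by (simp add: \<tau>_def)
  next
    case False
    have t: "t = \<tau> - x$1$1 / x$2$1" by (simp add: \<tau>_def)
    have "(x$1$2 + x$2$2 * t) / (x$2$1 * \<tau>) = 1 / (x$2$1)\<^sup>2 * (- 1 / \<tau>) + x$2$2 / x$2$1"
    proof -
      have "x$2$1 * (x$1$2 + x$2$2 * t) = x$2$1 * x$2$2 * \<tau> - (x$1$1 * x$2$2 - x$1$2 * x$2$1)"
        using c unfolding t by (simp add: field_simps)
      then have num: "x$1$2 + x$2$2 * t = (x$2$1 * x$2$2 * \<tau> - 1) / x$2$1"
        using c unfolding det by (simp add: field_simps)
      show ?thesis unfolding num using c False by (simp add: field_simps power2_eq_square)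
    qed
    then show ?thesis
      unfolding ks_fun_def inversion_def lin
      by (simp add: \<tau>_def[symmetric] powr_abs_mult sgn_mult power_mult_distrib mult_ac)
  qed
qed

lemma ks_fun_triangular:
  assumes x: "x \<in> SL2R" and c: "x$2$1 = 0"
  shows "x$1$1 \<noteq> 0" "ks_fun s \<epsilon> x f = (\<lambda>t. (of_real (sgn (x$1$1) ^ \<epsilon>) * of_real \<bar>x$1$1\<bar> powr (2 * s - 1)) *
     f (1 / (x$1$1)\<^sup>2 * t + x$1$2 / x$1$1))"
proof -
  have det: "x$1$1 * x$2$2 = 1" using x c by (simp add: SL2R_def det_2)
  then show nz: "x$1$1 \<noteq> 0" by auto
  have "(x$1$2 + x$2$2 * t) / x$1$1 = 1 / (x$1$1)\<^sup>2 * t + x$1$2 / x$1$1" for t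
  proof -
    have "x$2$2 = 1 / x$1$1" using det nz by (simp add: field_simps)
    then show ?thesis using nz by (simp add: field_simps power2_eq_square)
  qed
  then show "ks_fun s \<epsilon> x f = (\<lambda>t. (of_real (sgn (x$1$1) ^ \<epsilon>) * of_real \<bar>x$1$1\<bar> powr (2 * s - 1)) *
     f (1 / (x$1$1)\<^sup>2 * t + x$1$2 / x$1$1))"
    using c by (simp add: ks_fun_def fun_eq_iff)
qed

lemma bruhat_pullback:
  assumes f: "test_fun f" and v: "vanishes_near p f" and q: "q \<noteq> 0"
  shows "test_fun (\<lambda>u. f (q * u + p))" "vanishes_near 0 (\<lambda>u. f (q * u + p))"
proof -
  show "test_fun (\<lambda>u. f (q * u + p))" by (rule test_fun_affine[OF f q])
  obtain d where d: "d > 0" "\<And>t. \<bar>t - p\<bar> < d \<Longrightarrow> f t = 0" using v by (auto simp: vanishes_near_def)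
  show "vanishes_near 0 (\<lambda>u. f (q * u + p))"
    unfolding vanishes_near_def
    by (rule exI[of _ "d / \<bar>q\<bar>"]) (use d q in \<open>auto simp: abs_mult field_simps\<close>)
qed

lemma ks_fun_test:
  assumes x: "x \<in> SL2R" and f: "admissible x f"
  shows "test_fun (ks_fun s \<epsilon> x f)"
proof (cases "x$2$1 = 0")
  case True
  show ?thesis
    unfolding ks_fun_triangular(2)[OF x True] using ks_fun_triangular(1)[OF x True] admissible_test[OF f]
    by (intro test_fun_cmult test_fun_affine) auto
next
  case False
  then have "vanishes_near (x$2$2 / x$2$1) f" using f by (simp add: admissible_def)
  then show ?thesis
    unfolding ks_fun_bruhat[OF x False] using False
    by (intro test_fun_cmult test_fun_affine inversion_test(1) bruhat_pullback admissible_test[OF f]) auto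
qed

lemma norm_character: "c \<noteq> 0 \<Longrightarrow> norm (of_real (sgn c ^ \<epsilon>) * of_real \<bar>c\<bar> powr (2 * Complex \<alpha> \<beta> - 1)) = \<bar>c\<bar> powr (2 * \<alpha> - 1)"
  for c :: real
  by (simp add: norm_mult norm_power norm_powr_real_powr abs_sgn_eq power_abs)

text \<open>The scalar in front and the change of the norm under the dilation by \<open>1 / c^2\<close> cancel.\<close>

lemma character_cancel:
  assumes "c \<noteq> (0::real)"
  shows "\<bar>c\<bar> powr (2 * \<alpha> - 1) * \<bar>1 / c\<^sup>2\<bar> powr (\<alpha> - 1/2) = 1"
proof -
  have "\<bar>1 / c\<^sup>2\<bar> = \<bar>c\<bar> powr (- 2)" using assms by (simp add: powr_minus divide_inverse power_abs[symmetric])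
  then have "\<bar>1 / c\<^sup>2\<bar> powr (\<alpha> - 1/2) = \<bar>c\<bar> powr (- 2 * (\<alpha> - 1/2))" by (simp only: powr_powr)
  then have "\<bar>c\<bar> powr (2 * \<alpha> - 1) * \<bar>1 / c\<^sup>2\<bar> powr (\<alpha> - 1/2) = \<bar>c\<bar> powr ((2 * \<alpha> - 1) + - 2 * (\<alpha> - 1/2))"
    by (simp only: powr_add)
  then show ?thesis using assms by simp
qed

lemma norm_q0: "norm (q0 \<alpha> \<beta> \<epsilon> u) = abs_m 0 \<alpha> (2 * \<beta> - u) / abs_m \<epsilon> \<alpha> u"
  by (simp add: q0_def abs_m_def norm_divide)

lemma norm_q1: "norm (q1 \<alpha> \<beta> \<epsilon> u) = abs_m 1 \<alpha> (2 * \<beta> - u) / abs_m (1 - \<epsilon>) \<alpha> u"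
  by (simp add: q1_def abs_m_def norm_divide)

text \<open>In the coordinate \<open>t = exp x\<close> inversion reflects \<open>x\<close> and multiplies by \<open>exp (2 \<i> \<beta> x)\<close>, so it takes
  the frequency \<open>u\<close> to \<open>2 \<beta> - u\<close>.  The sign factor exchanges the parities if \<open>\<epsilon> = 1\<close>.\<close>

lemma fourier_logpart_inversion:
  assumes \<epsilon>: "\<epsilon> \<in> {0, 1}" and k: "k \<in> {0, 1}" and j: "j = (if k = 0 then \<epsilon> else 1 - \<epsilon>)"
  shows "norm (fourier (logpart k \<alpha> (inversion (Complex \<alpha> \<beta>) \<epsilon> g)) u) = norm (fourier (logpart j \<alpha> g) (2 * \<beta> - u))"
proof -
  let ?s = "Complex \<alpha> \<beta>"
  have j': "(-1) ^ (k + \<epsilon>) = ((-1) ^ j :: complex)" using k j \<epsilon> by auto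
  have lp: "logpart k \<alpha> (inversion ?s \<epsilon> g) x = (-1) ^ j * exp (\<i> * of_real (2 * \<beta> * x)) * logpart j \<alpha> g (- x)" for x
  proof -
    have pw: "complex_of_real (exp x) powr (2 * ?s - 1) = exp ((2 * ?s - 1) * of_real x)"
      by (simp add: powr_def Ln_of_real)
    have "of_real (exp (x * (1/2 - \<alpha>))) * exp ((2 * ?s - 1) * of_real x) = exp (\<i> * of_real (2 * \<beta> * x)) * of_real (exp (- x * (1/2 - \<alpha>)))"
      unfolding exp_of_real[symmetric] exp_add[symmetric]
      by (rule arg_cong[of _ _ exp]) (simp add: complex_eq_iff algebra_simps)
    note 1 = this
    have "logpart k \<alpha> (inversion ?s \<epsilon> g) x =
       of_real (exp (x * (1/2 - \<alpha>))) * exp ((2 * ?s - 1) * of_real x) * (g (- exp (- x)) + (-1) ^ (k + \<epsilon>) * g (exp (- x)))"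
    proof -
      have "inversion ?s \<epsilon> g (exp x) = exp ((2 * ?s - 1) * of_real x) * g (- exp (- x))"
        unfolding inversion_def abs_exp_cancel pw by (simp add: exp_minus inverse_eq_divide)
      moreover have "inversion ?s \<epsilon> g (- exp x) = (-1) ^ \<epsilon> * exp ((2 * ?s - 1) * of_real x) * g (exp (- x))"
        unfolding inversion_def abs_minus_cancel abs_exp_cancel pw by (simp add: exp_minus inverse_eq_divide)
      ultimately show ?thesis unfolding logpart_def power_add by (simp only: distrib_left mult_ac)
    qed
    also have "g (- exp (- x)) + (-1) ^ (k + \<epsilon>) * g (exp (- x)) = (-1) ^ j * (g (exp (- x)) + (-1) ^ j * g (- exp (- x)))"
      unfolding j' by (simp add: distrib_left mult.assoc[symmetric] flip: power_mult_distrib)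
    finally show ?thesis unfolding 1 logpart_def by (simp only: mult_ac)
  qed
  have "fourier (logpart k \<alpha> (inversion ?s \<epsilon> g)) u =
     (LINT x|lborel. (-1) ^ j * (logpart j \<alpha> g (0 + (-1) * x) * exp (- (\<i> * of_real (0 + (-1) * x) * of_real (2 * \<beta> - u)))))"
    unfolding fourier_def lp
    by (rule Bochner_Integration.integral_cong[OF refl]) (simp add: algebra_simps flip: exp_add)
  also have "\<dots> = (-1) ^ j * fourier (logpart j \<alpha> g) (2 * \<beta> - u)"
    unfolding fourier_def using lborel_integral_real_affine[of "-1" "\<lambda>x. logpart j \<alpha> g x * exp (- (\<i> * of_real x * of_real (2 * \<beta> - u)))" 0]
    by simp
  finally show ?thesis by (simp add: norm_mult norm_power)
qed

context
  fixes \<alpha> \<beta> :: real and \<epsilon> :: nat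
  assumes \<alpha>: "\<bar>\<alpha>\<bar> < 1/2" and \<epsilon>: "\<epsilon> \<in> {0, 1}"
begin

lemma q_bounded: "\<exists>C. \<forall>u. norm (q0 \<alpha> \<beta> \<epsilon> u) \<le> C \<and> norm (q1 \<alpha> \<beta> \<epsilon> u) \<le> C"
proof -
  have e: "1 - \<epsilon> \<in> {0, 1}" using \<epsilon> by auto
  obtain C where C: "\<And>u. abs_m 0 \<alpha> (2 * \<beta> - u) \<le> C * abs_m \<epsilon> \<alpha> u" using abs_m_bounded_ratio[OF \<alpha> _ \<epsilon>, of 0] by blast
  obtain D where D: "\<And>u. abs_m 1 \<alpha> (2 * \<beta> - u) \<le> D * abs_m (1 - \<epsilon>) \<alpha> u" using abs_m_bounded_ratio[OF \<alpha> _ e, of 1] by blast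
  show ?thesis
  proof (intro exI[of _ "max C D"] allI conjI)
    fix u
    have "norm (q0 \<alpha> \<beta> \<epsilon> u) \<le> C" unfolding norm_q0 using C[of u] abs_m_pos[OF \<alpha> \<epsilon>, of u] by (simp add: divide_le_eq)
    then show "norm (q0 \<alpha> \<beta> \<epsilon> u) \<le> max C D" by simp
    have "norm (q1 \<alpha> \<beta> \<epsilon> u) \<le> D" unfolding norm_q1 using D[of u] abs_m_pos[OF \<alpha> e, of u] by (simp add: divide_le_eq)
    then show "norm (q1 \<alpha> \<beta> \<epsilon> u) \<le> max C D" by simp
  qed
qed

lemma inversion_norm_sq:
  assumes g: "test_fun g" and v: "vanishes_near 0 g"
  shows "integrable lborel (\<lambda>u. (abs_m 0 \<alpha> (2 * \<beta> - u) * norm (fourier (logpart \<epsilon> \<alpha> g) u))\<^sup>2)"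
    and "integrable lborel (\<lambda>u. (abs_m 1 \<alpha> (2 * \<beta> - u) * norm (fourier (logpart (1 - \<epsilon>) \<alpha> g) u))\<^sup>2)"
    and "(test_norm \<alpha> (inversion (Complex \<alpha> \<beta>) \<epsilon> g))\<^sup>2 = 1 / (4 * pi) *
      ((LINT u|lborel. (abs_m 0 \<alpha> (2 * \<beta> - u) * norm (fourier (logpart \<epsilon> \<alpha> g) u))\<^sup>2) +
       (LINT u|lborel. (abs_m 1 \<alpha> (2 * \<beta> - u) * norm (fourier (logpart (1 - \<epsilon>) \<alpha> g) u))\<^sup>2))"
proof -
  note W = inversion_test(1)[OF g v, of "Complex \<alpha> \<beta>" \<epsilon>]
  have refl: "(LINT u|lborel. h (2 * \<beta> - u)) = (LINT u|lborel. h u)" "integrable lborel (\<lambda>u. h (2 * \<beta> - u)) \<longleftrightarrow> integrable lborel h"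
    for h :: "real \<Rightarrow> real"
    using lborel_integral_real_affine[of "-1" h "2 * \<beta>"] lborel_integrable_real_affine_iff[of "-1" h "2 * \<beta>"] by simp_all
  have 0: "(abs_m 0 \<alpha> (2 * \<beta> - u) * norm (fourier (logpart \<epsilon> \<alpha> g) u))\<^sup>2 =
     (abs_m 0 \<alpha> (2 * \<beta> - u) * norm (fourier (logpart 0 \<alpha> (inversion (Complex \<alpha> \<beta>) \<epsilon> g)) (2 * \<beta> - u)))\<^sup>2" for u
    using fourier_logpart_inversion[OF \<epsilon>, of 0 \<epsilon> \<alpha> \<beta> g "2 * \<beta> - u"] by simp
  have 1: "(abs_m 1 \<alpha> (2 * \<beta> - u) * norm (fourier (logpart (1 - \<epsilon>) \<alpha> g) u))\<^sup>2 =
     (abs_m 1 \<alpha> (2 * \<beta> - u) * norm (fourier (logpart 1 \<alpha> (inversion (Complex \<alpha> \<beta>) \<epsilon> g)) (2 * \<beta> - u)))\<^sup>2" for u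
    using fourier_logpart_inversion[OF \<epsilon>, of 1 "1 - \<epsilon>" \<alpha> \<beta> g "2 * \<beta> - u"] by simp
  show "integrable lborel (\<lambda>u. (abs_m 0 \<alpha> (2 * \<beta> - u) * norm (fourier (logpart \<epsilon> \<alpha> g) u))\<^sup>2)"
    unfolding 0 using refl(2)[of "\<lambda>u. (abs_m 0 \<alpha> u * norm (fourier (logpart 0 \<alpha> (inversion (Complex \<alpha> \<beta>) \<epsilon> g)) u))\<^sup>2"]
      mellin_plancherel(1)[OF \<alpha> W, of 0] by simp
  show "integrable lborel (\<lambda>u. (abs_m 1 \<alpha> (2 * \<beta> - u) * norm (fourier (logpart (1 - \<epsilon>) \<alpha> g) u))\<^sup>2)"
    unfolding 1 using refl(2)[of "\<lambda>u. (abs_m 1 \<alpha> u * norm (fourier (logpart 1 \<alpha> (inversion (Complex \<alpha> \<beta>) \<epsilon> g)) u))\<^sup>2"]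
      mellin_plancherel(1)[OF \<alpha> W, of 1] by simp
  show "(test_norm \<alpha> (inversion (Complex \<alpha> \<beta>) \<epsilon> g))\<^sup>2 = 1 / (4 * pi) *
      ((LINT u|lborel. (abs_m 0 \<alpha> (2 * \<beta> - u) * norm (fourier (logpart \<epsilon> \<alpha> g) u))\<^sup>2) +
       (LINT u|lborel. (abs_m 1 \<alpha> (2 * \<beta> - u) * norm (fourier (logpart (1 - \<epsilon>) \<alpha> g) u))\<^sup>2))"
    unfolding 0 1
    using refl(1)[of "\<lambda>u. (abs_m 0 \<alpha> u * norm (fourier (logpart 0 \<alpha> (inversion (Complex \<alpha> \<beta>) \<epsilon> g)) u))\<^sup>2"]
      refl(1)[of "\<lambda>u. (abs_m 1 \<alpha> u * norm (fourier (logpart 1 \<alpha> (inversion (Complex \<alpha> \<beta>) \<epsilon> g)) u))\<^sup>2"]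
      mellin_plancherel(2)[OF \<alpha> W] by simp
qed

lemma inversion_norm_le:
  assumes g: "test_fun g" and v: "vanishes_near 0 g" and C: "C \<ge> 0"
    and q0: "AE u in lborel. norm (q0 \<alpha> \<beta> \<epsilon> u) \<le> C" and q1: "AE u in lborel. norm (q1 \<alpha> \<beta> \<epsilon> u) \<le> C"
  shows "test_norm \<alpha> (inversion (Complex \<alpha> \<beta>) \<epsilon> g) \<le> C * test_norm \<alpha> g"
proof (rule power2_le_imp_le)
  have e: "1 - \<epsilon> \<in> {0, 1}" using \<epsilon> by auto
  let ?h = "\<lambda>k u. (abs_m k \<alpha> u * norm (fourier (logpart k \<alpha> g) u))\<^sup>2"
  note I = inversion_norm_sq[OF g v] and M = mellin_plancherel[OF \<alpha> g]
  have 0: "(LINT u|lborel. (abs_m 0 \<alpha> (2 * \<beta> - u) * norm (fourier (logpart \<epsilon> \<alpha> g) u))\<^sup>2) \<le> (LINT u|lborel. C\<^sup>2 * ?h \<epsilon> u)"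
  proof (rule integral_mono_AE[OF I(1)])
    show "AE u in lborel. (abs_m 0 \<alpha> (2 * \<beta> - u) * norm (fourier (logpart \<epsilon> \<alpha> g) u))\<^sup>2 \<le> C\<^sup>2 * ?h \<epsilon> u"
      using q0
    proof eventually_elim
      fix u assume "norm (q0 \<alpha> \<beta> \<epsilon> u) \<le> C"
      then have "abs_m 0 \<alpha> (2 * \<beta> - u) \<le> C * abs_m \<epsilon> \<alpha> u"
        using abs_m_pos[OF \<alpha> \<epsilon>, of u] by (simp add: norm_q0 divide_le_eq)
      then have "abs_m 0 \<alpha> (2 * \<beta> - u) * norm (fourier (logpart \<epsilon> \<alpha> g) u) \<le> C * abs_m \<epsilon> \<alpha> u * norm (fourier (logpart \<epsilon> \<alpha> g) u)"
        by (rule mult_right_mono) simp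
      then show "(abs_m 0 \<alpha> (2 * \<beta> - u) * norm (fourier (logpart \<epsilon> \<alpha> g) u))\<^sup>2 \<le> C\<^sup>2 * ?h \<epsilon> u"
        unfolding power_mult_distrib[symmetric] mult.assoc[symmetric]
        by (rule power_mono) (simp add: abs_m_def)
    qed
  qed (use M(1)[OF \<epsilon>] in simp)
  have 1: "(LINT u|lborel. (abs_m 1 \<alpha> (2 * \<beta> - u) * norm (fourier (logpart (1 - \<epsilon>) \<alpha> g) u))\<^sup>2) \<le> (LINT u|lborel. C\<^sup>2 * ?h (1 - \<epsilon>) u)"
  proof (rule integral_mono_AE[OF I(2)])
    show "AE u in lborel. (abs_m 1 \<alpha> (2 * \<beta> - u) * norm (fourier (logpart (1 - \<epsilon>) \<alpha> g) u))\<^sup>2 \<le> C\<^sup>2 * ?h (1 - \<epsilon>) u"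
      using q1
    proof eventually_elim
      fix u assume "norm (q1 \<alpha> \<beta> \<epsilon> u) \<le> C"
      then have "abs_m 1 \<alpha> (2 * \<beta> - u) \<le> C * abs_m (1 - \<epsilon>) \<alpha> u"
        using abs_m_pos[OF \<alpha> e, of u] by (simp add: norm_q1 divide_le_eq)
      then have "abs_m 1 \<alpha> (2 * \<beta> - u) * norm (fourier (logpart (1 - \<epsilon>) \<alpha> g) u) \<le> C * abs_m (1 - \<epsilon>) \<alpha> u * norm (fourier (logpart (1 - \<epsilon>) \<alpha> g) u)"
        by (rule mult_right_mono) simp
      then show "(abs_m 1 \<alpha> (2 * \<beta> - u) * norm (fourier (logpart (1 - \<epsilon>) \<alpha> g) u))\<^sup>2 \<le> C\<^sup>2 * ?h (1 - \<epsilon>) u"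
        unfolding power_mult_distrib[symmetric] mult.assoc[symmetric]
        by (rule power_mono) (simp add: abs_m_def)
    qed
  qed (use M(1)[OF e] in simp)
  have "(test_norm \<alpha> (inversion (Complex \<alpha> \<beta>) \<epsilon> g))\<^sup>2 \<le> 1 / (4 * pi) * (C\<^sup>2 * (LINT u|lborel. ?h \<epsilon> u) + C\<^sup>2 * (LINT u|lborel. ?h (1 - \<epsilon>) u))"
    unfolding I(3) using 0 1 by (intro mult_left_mono add_mono) auto
  also have "\<dots> = C\<^sup>2 * (1 / (4 * pi) * ((LINT u|lborel. ?h 0 u) + (LINT u|lborel. ?h 1 u)))"
    using \<epsilon> by (auto simp: distrib_left)
  also have "\<dots> = (C * test_norm \<alpha> g)\<^sup>2" unfolding M(2) power_mult_distrib ..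
  finally show "(test_norm \<alpha> (inversion (Complex \<alpha> \<beta>) \<epsilon> g))\<^sup>2 \<le> (C * test_norm \<alpha> g)\<^sup>2" .
qed (use C test_norm_nonneg in simp)

text \<open>Up to a sign, inversion is its own inverse.\<close>

lemma inversion_norm_ge:
  assumes g: "test_fun g" and v: "vanishes_near 0 g" and C: "C \<ge> 0"
    and q0: "AE u in lborel. norm (q0 \<alpha> \<beta> \<epsilon> u) \<le> C" and q1: "AE u in lborel. norm (q1 \<alpha> \<beta> \<epsilon> u) \<le> C"
  shows "test_norm \<alpha> g \<le> C * test_norm \<alpha> (inversion (Complex \<alpha> \<beta>) \<epsilon> g)"
  using inversion_norm_le[OF inversion_test[OF g v] C q0 q1, of "Complex \<alpha> \<beta>" \<epsilon>]
  unfolding inversion_involution[OF v]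
  by (simp add: test_norm_cmult norm_power)

lemma ks_norm_bounds:
  assumes x: "x \<in> SL2R" and f: "admissible x f" and C: "C \<ge> 1"
    and q0: "AE u in lborel. norm (q0 \<alpha> \<beta> \<epsilon> u) \<le> C" and q1: "AE u in lborel. norm (q1 \<alpha> \<beta> \<epsilon> u) \<le> C"
  shows "test_norm \<alpha> (ks_fun (Complex \<alpha> \<beta>) \<epsilon> x f) \<le> C * test_norm \<alpha> f"
    and "test_norm \<alpha> f \<le> C * test_norm \<alpha> (ks_fun (Complex \<alpha> \<beta>) \<epsilon> x f)"
proof -
  have "test_norm \<alpha> (ks_fun (Complex \<alpha> \<beta>) \<epsilon> x f) \<le> C * test_norm \<alpha> f \<and>
        test_norm \<alpha> f \<le> C * test_norm \<alpha> (ks_fun (Complex \<alpha> \<beta>) \<epsilon> x f)"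
  proof (cases "x$2$1 = 0")
    case True
    have "test_norm \<alpha> (ks_fun (Complex \<alpha> \<beta>) \<epsilon> x f) = test_norm \<alpha> f"
    proof -
      define c where "c = x$1$1"
      have c: "c \<noteq> 0" using ks_fun_triangular(1)[OF x True] by (simp add: c_def)
      then have "1 / c\<^sup>2 \<noteq> 0" by simp
      from test_norm_affine[OF this, of \<alpha> f "x$1$2 / c"] show ?thesis
        unfolding ks_fun_triangular(2)[OF x True] c_def[symmetric] test_norm_cmult norm_character[OF c]
        using character_cancel[OF c, of \<alpha>] by (simp only: mult.assoc[symmetric] mult_1_left)
    qed
    then show ?thesis using C mult_right_mono[of 1 C "test_norm \<alpha> f"] test_norm_nonneg[of \<alpha> f] by simp
  next
    case False
    define c where "c = x$2$1"
    have c: "c \<noteq> 0" using False by (simp add: c_def)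
    define g where "g u = f (1 / c\<^sup>2 * u + x$2$2 / c)" for u
    have v: "vanishes_near (x$2$2 / c) f" using f False by (simp add: admissible_def c_def)
    have g: "test_fun g" "vanishes_near 0 g"
      unfolding g_def[abs_def] using bruhat_pullback[OF admissible_test[OF f] v, of "1 / c\<^sup>2"] c by auto
    have ng: "test_norm \<alpha> g = \<bar>1 / c\<^sup>2\<bar> powr (\<alpha> - 1/2) * test_norm \<alpha> f"
      unfolding g_def[abs_def] using c by (intro test_norm_affine) simp
    have nk: "test_norm \<alpha> (ks_fun (Complex \<alpha> \<beta>) \<epsilon> x f) = \<bar>c\<bar> powr (2 * \<alpha> - 1) * test_norm \<alpha> (inversion (Complex \<alpha> \<beta>) \<epsilon> g)"
      unfolding ks_fun_bruhat[OF x False] c_def[symmetric] g_def[abs_def, symmetric]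
        test_norm_cmult norm_character[OF c] using test_norm_affine[of 1 \<alpha> "inversion (Complex \<alpha> \<beta>) \<epsilon> g" "x$1$1 / c"] by simp
    have C0: "C \<ge> 0" using C by simp
    have "\<bar>c\<bar> powr (2 * \<alpha> - 1) * test_norm \<alpha> (inversion (Complex \<alpha> \<beta>) \<epsilon> g) \<le> \<bar>c\<bar> powr (2 * \<alpha> - 1) * (C * test_norm \<alpha> g)"
      by (intro mult_left_mono inversion_norm_le[OF g C0 q0 q1]) simp
    also have "\<dots> = C * ((\<bar>c\<bar> powr (2 * \<alpha> - 1) * \<bar>1 / c\<^sup>2\<bar> powr (\<alpha> - 1/2)) * test_norm \<alpha> f)"
      unfolding ng by (simp only: mult_ac)
    finally have 1: "test_norm \<alpha> (ks_fun (Complex \<alpha> \<beta>) \<epsilon> x f) \<le> C * test_norm \<alpha> f"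
      unfolding nk character_cancel[OF c] by simp
    have "test_norm \<alpha> f = (\<bar>c\<bar> powr (2 * \<alpha> - 1) * \<bar>1 / c\<^sup>2\<bar> powr (\<alpha> - 1/2)) * test_norm \<alpha> f"
      unfolding character_cancel[OF c] by simp
    also have "\<dots> = \<bar>c\<bar> powr (2 * \<alpha> - 1) * test_norm \<alpha> g" unfolding ng by (simp only: mult_ac)
    also have "\<dots> \<le> \<bar>c\<bar> powr (2 * \<alpha> - 1) * (C * test_norm \<alpha> (inversion (Complex \<alpha> \<beta>) \<epsilon> g))"
      by (intro mult_left_mono inversion_norm_ge[OF g C0 q0 q1]) simp
    finally have 2: "test_norm \<alpha> f \<le> C * test_norm \<alpha> (ks_fun (Complex \<alpha> \<beta>) \<epsilon> x f)"
      unfolding nk by (simp only: mult_ac)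
    from 1 2 show ?thesis by blast
  qed
  then show "test_norm \<alpha> (ks_fun (Complex \<alpha> \<beta>) \<epsilon> x f) \<le> C * test_norm \<alpha> f"
    and "test_norm \<alpha> f \<le> C * test_norm \<alpha> (ks_fun (Complex \<alpha> \<beta>) \<epsilon> x f)" by auto
qed

end

section \<open>The representation on the completion\<close>

lemma bounded_test:
  assumes "test_fun f" obtains B where "B \<ge> 0" "\<And>t. norm (f t) \<le> B"
proof -
  obtain B where "\<And>t. norm (f t) \<le> B" using test_fun_nice[OF assms] by (auto simp: nice_def bounded_iff)
  then show ?thesis using that norm_ge_zero order_trans by metis
qed

text \<open>Dilation by \<open>n\<close> turns the function into \<open>G n t = f (t / n + p) w t\<close>, at the cost of a factor
  \<open>n powr (\<alpha> - 1/2)\<close>, which tends to 0.  The functions \<open>G n\<close> and their derivatives are bounded in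
  \<open>L^1\<close>, hence bounded in norm.\<close>

lemma localized_norm_null:
  assumes \<alpha>: "\<bar>\<alpha>\<bar> < 1/2" and f: "test_fun f" and w: "test_fun w"
  shows "(\<lambda>n. test_norm \<alpha> (\<lambda>t. f t * w (real (Suc n) * (t - p)))) \<longlonglongrightarrow> 0"
proof -
  obtain f' where f': "test_fun f'" and fder: "\<And>t. (f has_vector_derivative f' t) (at t)"
    using test_fun_has_derivative[OF f] by blast
  obtain w' where w': "test_fun w'" and wder: "\<And>t. (w has_vector_derivative w' t) (at t)"
    using test_fun_has_derivative[OF w] by blast
  obtain A where A: "A \<ge> 0" "\<And>t. norm (f t) \<le> A" using bounded_test[OF f] by blast
  obtain A' where A': "A' \<ge> 0" "\<And>t. norm (f' t) \<le> A'" using bounded_test[OF f'] by blast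
  let ?I = "LINT t|lborel. norm (w t)" and ?I' = "LINT t|lborel. norm (w' t)"
  let ?K = "LINT r|lborel. \<bar>r\<bar> powr (2 * \<alpha>) * min 1 (1 / r\<^sup>2)"
  note wi = test_fun_integrable[OF w] test_fun_integrable[OF w']
  have I0: "0 \<le> ?I" "0 \<le> ?I'" "0 \<le> ?K" by (auto intro!: integral_nonneg_AE)
  define G where "G n t = f (1 / real (Suc n) * t + p) * w t" for n t
  define G' where "G' n t = f (1 / real (Suc n) * t + p) * w' t + (1 / real (Suc n)) *\<^sub>R f' (1 / real (Suc n) * t + p) * w t" for n t
  have sm: "smooth (\<lambda>t. f (a * t + b))" "smooth (\<lambda>t. f' (a * t + b))" for a b
    by (intro smooth_affine test_fun_smooth f f')+
  have G: "test_fun (G n)" for n unfolding G_def[abs_def] by (intro test_fun_mult_smooth w sm)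
  have G'_eq: "G' n = (\<lambda>t. f (1 / real (Suc n) * t + p) * w' t + of_real (1 / real (Suc n)) * f' (1 / real (Suc n) * t + p) * w t)" for n
    by (simp add: G'_def fun_eq_iff scaleR_conv_of_real)
  have G': "test_fun (G' n)" for n
    unfolding G'_eq by (intro test_fun_add test_fun_mult_smooth w w' smooth_mult[OF smooth_const] sm)
  have Gder: "(G n has_vector_derivative G' n t) (at t)" for n t
  proof -
    have "((\<lambda>t. 1 / real (Suc n) * t + p) has_vector_derivative (1 / real (Suc n))) (at t)"
      by (auto intro!: derivative_eq_intros simp flip: has_real_derivative_iff_has_vector_derivative)
    from vector_diff_chain_at[OF this fder]
    have "((\<lambda>t. f (1 / real (Suc n) * t + p)) has_vector_derivative (1 / real (Suc n)) *\<^sub>R f' (1 / real (Suc n) * t + p)) (at t)"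
      by (simp add: o_def)
    from has_vector_derivative_mult[OF this wder] show ?thesis
      unfolding G_def[abs_def] G'_def by simp
  qed
  have b1: "(LINT t|lborel. norm (G n t)) \<le> A * ?I" for n
  proof -
    have "(LINT t|lborel. norm (G n t)) \<le> (LINT t|lborel. A * norm (w t))"
    proof (rule integral_mono)
      show "integrable lborel (\<lambda>t. norm (G n t))" by (rule integrable_norm[OF test_fun_integrable[OF G]])
      show "integrable lborel (\<lambda>t. A * norm (w t))" by (intro integrable_mult_right integrable_norm wi)
      show "norm (G n t) \<le> A * norm (w t)" for t
        unfolding G_def norm_mult by (intro mult_right_mono A) simp
    qed
    then show ?thesis by simp
  qed
  have b2: "(LINT t|lborel. norm (G' n t)) \<le> A * ?I' + A' * ?I" for n
  proof -
    have "norm (G' n t) \<le> A * norm (w' t) + A' * norm (w t)" for t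
    proof -
      have "norm (G' n t) \<le> norm (f (1 / real (Suc n) * t + p)) * norm (w' t) + (1 / real (Suc n)) * norm (f' (1 / real (Suc n) * t + p)) * norm (w t)"
        unfolding G'_def by (rule order_trans[OF norm_triangle_ineq]) (simp add: norm_mult)
      also have "\<dots> \<le> A * norm (w' t) + 1 * A' * norm (w t)"
        using A A' by (intro add_mono mult_mono mult_right_mono) auto
      finally show ?thesis by simp
    qed
    then have "(LINT t|lborel. norm (G' n t)) \<le> (LINT t|lborel. A * norm (w' t) + A' * norm (w t))"
      using wi test_fun_integrable[OF G'] by (intro integral_mono integrable_norm Bochner_Integration.integrable_add integrable_mult_right) auto
    then show ?thesis using wi by simp
  qed
  define D where "D = sqrt ((A * ?I + (A * ?I' + A' * ?I))\<^sup>2 * ?K)"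
  have bound: "test_norm \<alpha> (G n) \<le> D" for n
  proof -
    have "(test_norm \<alpha> (G n))\<^sup>2 \<le> ((LINT t|lborel. norm (G n t)) + (LINT t|lborel. norm (G' n t)))\<^sup>2 * ?K"
      by (rule test_norm_finite(2)[OF \<alpha> G G' Gder])
    also have "\<dots> \<le> (A * ?I + (A * ?I' + A' * ?I))\<^sup>2 * ?K"
      using I0 b1[of n] b2[of n] by (intro mult_right_mono power_mono add_mono add_nonneg_nonneg integral_nonneg_AE) auto
    finally show ?thesis unfolding D_def by (rule real_le_rsqrt)
  qed
  have "test_norm \<alpha> (\<lambda>t. f t * w (real (Suc n) * (t - p))) \<le> D * real (Suc n) powr (\<alpha> - 1/2)" for n
  proof -
    have "(\<lambda>t. f t * w (real (Suc n) * (t - p))) = (\<lambda>t. G n (real (Suc n) * t + - real (Suc n) * p))"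
      by (simp add: G_def fun_eq_iff right_diff_distrib diff_divide_distrib del: of_nat_Suc)
    then have "test_norm \<alpha> (\<lambda>t. f t * w (real (Suc n) * (t - p))) = real (Suc n) powr (\<alpha> - 1/2) * test_norm \<alpha> (G n)"
      using test_norm_affine[of "real (Suc n)" \<alpha> "G n" "- real (Suc n) * p"] by simp
    also have "\<dots> \<le> real (Suc n) powr (\<alpha> - 1/2) * D" by (intro mult_left_mono bound) simp
    finally show ?thesis by (simp only: mult.commute)
  qed
  note le = this
  have "(\<lambda>n. D * real (Suc n) powr (\<alpha> - 1/2)) \<longlonglongrightarrow> D * 0"
  proof (intro tendsto_mult tendsto_const)
    have "((\<lambda>x. x powr (\<alpha> - 1/2)) \<longlongrightarrow> 0) at_top" using \<alpha> by (intro tendsto_neg_powr filterlim_ident) auto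
    then show "(\<lambda>n. real (Suc n) powr (\<alpha> - 1/2)) \<longlonglongrightarrow> 0"
      by (rule filterlim_compose) (rule filterlim_compose[OF filterlim_real_sequentially filterlim_Suc])
  qed
  then have "(\<lambda>n. D * real (Suc n) powr (\<alpha> - 1/2)) \<longlonglongrightarrow> 0" by simp
  then show ?thesis
    by (rule tendsto_sandwich[OF always_eventually[OF allI[OF test_norm_nonneg]] always_eventually[OF allI[OF le]] tendsto_const])
qed

text \<open>Remove a shrinking neighbourhood of the singular point \<open>p\<close>.  On the support of a fixed test function
  \<open>\<phi>\<close> the fractional linear map stays away from \<open>p\<close>, so the images are eventually unchanged there.\<close>

lemma admissible_approximation:
  assumes \<alpha>: "\<bar>\<alpha>\<bar> < 1/2" and f: "test_fun f" and x: "x \<in> SL2R"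
  obtains g where "\<And>n. admissible x (g n)" "(\<lambda>n. test_norm \<alpha> (\<lambda>t. f t - g n t)) \<longlonglongrightarrow> 0"
    "\<And>\<phi>. (\<lambda>n. distr_of (ks_fun s \<epsilon> x (g n)) \<phi>) \<longlonglongrightarrow> distr_of (ks_fun s \<epsilon> x f) \<phi>"
proof (cases "x$2$1 = 0")
  case True
  show ?thesis
    by (rule that[of "\<lambda>_. f"]) (use True f test_norm_zero in \<open>auto simp: admissible_def\<close>)
next
  case False
  define c p where "c = x$2$1" and "p = x$2$2 / x$2$1"
  have c: "c \<noteq> 0" using False by (simp add: c_def)
  have det: "x$1$1 * x$2$2 - x$1$2 * x$2$1 = 1" using x by (simp add: SL2R_def det_2)
  obtain w :: "real \<Rightarrow> real" where w: "test_fun (\<lambda>t. of_real (w t))"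
    "\<And>t. \<bar>t\<bar> \<le> 1 \<Longrightarrow> w t = 1" "\<And>t. 3 < \<bar>t\<bar> \<Longrightarrow> w t = 0" using plateau_exists by blast
  define g where "g n t = f t - f t * of_real (w (real (Suc n) * (t - p)))" for n t
  have gt: "test_fun (g n)" for n
  proof -
    have "test_fun (\<lambda>t. f t * of_real (w (real (Suc n) * t + - real (Suc n) * p)))"
      by (intro test_fun_mult_smooth[OF test_fun_affine[OF w(1)] test_fun_smooth[OF f]]) simp
    from test_fun_diff[OF f this] show ?thesis by (simp add: g_def[abs_def] right_diff_distrib del: of_nat_Suc)
  qed
  show ?thesis
  proof (rule that[of g])
    show "admissible x (g n)" for n
    proof -
      have "g n t = 0" if "\<bar>t - p\<bar> < 1 / real (Suc n)" for t
      proof -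
        have "real (Suc n) * \<bar>t - p\<bar> < 1"
          using that by (simp only: pos_less_divide_eq of_nat_0_less_iff zero_less_Suc mult.commute)
        then have "\<bar>real (Suc n) * (t - p)\<bar> \<le> 1" by (simp only: abs_mult abs_of_nat less_imp_le)
        then show ?thesis by (simp add: g_def w(2) del: of_nat_Suc)
      qed
      then have "vanishes_near p (g n)"
        unfolding vanishes_near_def by (intro exI[of _ "1 / real (Suc n)"]) simp
      then show ?thesis using gt by (simp add: admissible_def p_def)
    qed
    show "(\<lambda>n. test_norm \<alpha> (\<lambda>t. f t - g n t)) \<longlonglongrightarrow> 0"
      using localized_norm_null[OF \<alpha> f w(1), of p] by (simp add: g_def)
    fix \<phi>
    show "(\<lambda>n. distr_of (ks_fun s \<epsilon> x (g n)) \<phi>) \<longlonglongrightarrow> distr_of (ks_fun s \<epsilon> x f) \<phi>"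
    proof (cases "test_fun \<phi>")
      case True
      then obtain R where R: "R > 0" "\<And>t. R < \<bar>t\<bar> \<Longrightarrow> \<phi> t = 0" by (meson test_funE)
      \<comment> \<open>On \<open>[- R, R]\<close> the distance of the fractional linear map from \<open>p\<close> is at least \<open>1 / L\<close>.\<close>
      define L where "L = \<bar>c\<bar> * (\<bar>x$1$1\<bar> + \<bar>c\<bar> * R)"
      have L: "L > 0" using c R(1) by (simp add: L_def add_nonneg_pos)
      have ev: "ks_fun s \<epsilon> x (g n) t * \<phi> t = ks_fun s \<epsilon> x f t * \<phi> t" if n: "real (Suc n) > 3 * L" for n t
      proof (cases "R < \<bar>t\<bar> \<or> x$1$1 + t * c = 0")
        case True
        then show ?thesis using R(2) by (auto simp: ks_fun_def c_def)
      next
        case False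
        define y where "y = (x$1$2 + x$2$2 * t) / (x$1$1 + c * t)"
        have nz: "x$1$1 + c * t \<noteq> 0" using False by (simp add: mult.commute)
        have "y - p = (c * (x$1$2 + x$2$2 * t) - x$2$2 * (x$1$1 + c * t)) / (c * (x$1$1 + c * t))"
          unfolding y_def p_def c_def[symmetric] using nz c by (simp add: diff_frac_eq mult.commute)
        also have "c * (x$1$2 + x$2$2 * t) - x$2$2 * (x$1$1 + c * t) = - 1"
          using det by (simp add: c_def algebra_simps)
        finally have yp: "\<bar>y - p\<bar> = 1 / (\<bar>c\<bar> * \<bar>x$1$1 + c * t\<bar>)" by (simp add: abs_mult)
        have "\<bar>x$1$1 + c * t\<bar> \<le> \<bar>x$1$1\<bar> + \<bar>c\<bar> * R"
        proof -
          have "\<bar>c * t\<bar> \<le> \<bar>c\<bar> * R" using False by (auto simp: abs_mult intro: mult_left_mono)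
          then show ?thesis by linarith
        qed
        then have "\<bar>c\<bar> * \<bar>x$1$1 + c * t\<bar> \<le> L" unfolding L_def by (intro mult_left_mono) auto
        then have "1 / L \<le> \<bar>y - p\<bar>" unfolding yp using nz c L by (intro divide_left_mono mult_pos_pos) auto
        then have "real (Suc n) * (1 / L) \<le> real (Suc n) * \<bar>y - p\<bar>" by (intro mult_left_mono) auto
        moreover have "3 < real (Suc n) * (1 / L)" using n L by (simp add: field_simps)
        ultimately have "3 < \<bar>real (Suc n) * (y - p)\<bar>" by (simp add: abs_mult)
        then have "g n y = f y" by (simp add: g_def w(3) del: of_nat_Suc)
        then show ?thesis by (simp add: ks_fun_def y_def c_def)
      qed
      obtain N where N: "real N > 3 * L" using reals_Archimedean2 by blast
      have "distr_of (ks_fun s \<epsilon> x (g n)) \<phi> = distr_of (ks_fun s \<epsilon> x f) \<phi>" if "n \<ge> N" for n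
      proof -
        have "real (Suc n) > 3 * L" using N that by simp
        from ev[OF this] show ?thesis unfolding distr_of_def by (simp only:)
      qed
      then have "\<forall>\<^sub>F n in sequentially. distr_of (ks_fun s \<epsilon> x (g n)) \<phi> = distr_of (ks_fun s \<epsilon> x f) \<phi>"
        unfolding eventually_sequentially by blast
      then show ?thesis by (rule tendsto_eventually)
    qed (simp add: distr_of_def)
  qed
qed

context
  fixes \<alpha> \<beta> :: real and \<epsilon> :: nat
  assumes \<alpha>: "\<bar>\<alpha>\<bar> < 1/2" and \<epsilon>: "\<epsilon> \<in> {0, 1}"
begin

abbreviation "KS \<equiv> ks_fun (Complex \<alpha> \<beta>) \<epsilon>"

lemma ks_bounded:
  obtains M where "M \<ge> 1" "\<And>x f. x \<in> SL2R \<Longrightarrow> admissible x f \<Longrightarrow> test_norm \<alpha> (KS x f) \<le> M * test_norm \<alpha> f"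
proof -
  obtain C where C: "\<And>u. norm (q0 \<alpha> \<beta> \<epsilon> u) \<le> C" "\<And>u. norm (q1 \<alpha> \<beta> \<epsilon> u) \<le> C"
    using q_bounded[OF \<alpha> \<epsilon>] by blast
  show ?thesis
  proof (rule that[of "max 1 C"])
    show "test_norm \<alpha> (KS x f) \<le> max 1 C * test_norm \<alpha> f" if "x \<in> SL2R" "admissible x f" for x f
      by (rule ks_norm_bounds(1)[OF \<alpha> \<epsilon> that])
         (use C in \<open>auto intro!: AE_I2 intro: order_trans[OF _ max.cobounded2]\<close>)
  qed simp
qed

lemma ks_cauchy:
  assumes x: "x \<in> SL2R" and g: "\<And>n. admissible x (g n)" and u: "H_approx \<alpha> g u"
  shows "\<exists>v. H_approx \<alpha> (\<lambda>n. KS x (g n)) v"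
proof (rule H_complete[OF \<alpha> ks_fun_test[OF x g]])
  fix e :: real assume "e > 0"
  obtain M where M: "M \<ge> 1" "\<And>x f. x \<in> SL2R \<Longrightarrow> admissible x f \<Longrightarrow> test_norm \<alpha> (KS x f) \<le> M * test_norm \<alpha> f"
    using ks_bounded by blast
  have "e / M > 0" using \<open>e > 0\<close> M(1) by simp
  obtain N where N: "\<And>m n. m \<ge> N \<Longrightarrow> n \<ge> N \<Longrightarrow> test_norm \<alpha> (\<lambda>t. g m t - g n t) < e / M"
    using H_approx_cauchy[OF u \<open>e / M > 0\<close>] by blast
  have "test_norm \<alpha> (\<lambda>t. KS x (g m) t - KS x (g n) t) < e" if "m \<ge> N" "n \<ge> N" for m n
  proof -
    have "test_norm \<alpha> (\<lambda>t. KS x (g m) t - KS x (g n) t) \<le> M * test_norm \<alpha> (\<lambda>t. g m t - g n t)"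
      using M(2)[OF x admissible_diff[OF g g], of m n] by (simp add: ks_fun_diff)
    also have "\<dots> < M * (e / M)" using N[OF that] M(1) by (intro mult_strict_left_mono) auto
    finally show ?thesis using M(1) by simp
  qed
  then show "\<exists>N. \<forall>m\<ge>N. \<forall>n\<ge>N. test_norm \<alpha> (\<lambda>t. KS x (g m) t - KS x (g n) t) < e" by blast
qed

text \<open>The image of a test function that is not admissible has no compact support, but it is approximated by
  the images of admissible ones, both as a distribution and in norm.\<close>

lemma ks_fun_H_space:
  assumes x: "x \<in> SL2R" and f: "test_fun f"
  obtains h where "\<And>n. admissible x (h n)" "(\<lambda>n. test_norm \<alpha> (\<lambda>t. f t - h n t)) \<longlonglongrightarrow> 0"
    "H_approx \<alpha> (\<lambda>n. KS x (h n)) (distr_of (KS x f))"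
proof -
  obtain h where h: "\<And>n. admissible x (h n)" "(\<lambda>n. test_norm \<alpha> (\<lambda>t. f t - h n t)) \<longlonglongrightarrow> 0"
    "\<And>\<phi>. (\<lambda>n. distr_of (KS x (h n)) \<phi>) \<longlonglongrightarrow> distr_of (KS x f) \<phi>"
    using admissible_approximation[OF \<alpha> f x] by blast
  have "H_approx \<alpha> h (distr_of f)"
    by (rule H_approx_perturb[OF \<alpha> H_approx_const[OF \<alpha> f] admissible_test[OF h(1)] h(2)])
  from ks_cauchy[OF x h(1) this] obtain v where v: "H_approx \<alpha> (\<lambda>n. KS x (h n)) v" by blast
  have "v = distr_of (KS x f)"
  proof
    show "v \<phi> = distr_of (KS x f) \<phi>" for \<phi> using H_approx_lim[OF v] h(3) by (rule LIMSEQ_unique)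
  qed
  then show ?thesis using that h v by blast
qed

lemma ks_fun_H_norm_le:
  assumes x: "x \<in> SL2R" and f: "test_fun f" and g: "admissible x g"
    and M: "\<And>x f. x \<in> SL2R \<Longrightarrow> admissible x f \<Longrightarrow> test_norm \<alpha> (KS x f) \<le> M * test_norm \<alpha> f"
  shows "H_norm \<alpha> (\<lambda>\<phi>. distr_of (KS x f) \<phi> - distr_of (KS x g) \<phi>) \<le> M * test_norm \<alpha> (\<lambda>t. f t - g t)"
proof -
  obtain h where h: "\<And>n. admissible x (h n)" "(\<lambda>n. test_norm \<alpha> (\<lambda>t. f t - h n t)) \<longlonglongrightarrow> 0"
    "H_approx \<alpha> (\<lambda>n. KS x (h n)) (distr_of (KS x f))"
    using ks_fun_H_space[OF x f] by blast
  have "H_approx \<alpha> h (distr_of f)"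
    by (rule H_approx_perturb[OF \<alpha> H_approx_const[OF \<alpha> f] admissible_test[OF h(1)] h(2)])
  note d = H_approx_diff[OF \<alpha> this H_approx_const[OF \<alpha> admissible_test[OF g]]]
  have "(\<lambda>n. M * test_norm \<alpha> (\<lambda>t. h n t - g t)) \<longlonglongrightarrow> M * test_norm \<alpha> (\<lambda>t. f t - g t)"
  proof (intro tendsto_mult tendsto_const)
    have "H_norm \<alpha> (\<lambda>\<phi>. distr_of f \<phi> - distr_of g \<phi>) = test_norm \<alpha> (\<lambda>t. f t - g t)"
      using H_norm_tendsto[OF \<alpha> H_approx_diff[OF \<alpha> H_approx_const[OF \<alpha> f] H_approx_const[OF \<alpha> admissible_test[OF g]]]]
      by (intro LIMSEQ_unique[OF _ tendsto_const])
    then show "(\<lambda>n. test_norm \<alpha> (\<lambda>t. h n t - g t)) \<longlonglongrightarrow> test_norm \<alpha> (\<lambda>t. f t - g t)"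
      using H_norm_tendsto[OF \<alpha> d] by simp
  qed
  moreover have "(\<lambda>n. test_norm \<alpha> (\<lambda>t. KS x (h n) t - KS x g t)) \<longlonglongrightarrow> H_norm \<alpha> (\<lambda>\<phi>. distr_of (KS x f) \<phi> - distr_of (KS x g) \<phi>)"
    by (rule H_norm_tendsto[OF \<alpha> H_approx_diff[OF \<alpha> h(3) H_approx_const[OF \<alpha> ks_fun_test[OF x g]]]])
  moreover have "test_norm \<alpha> (\<lambda>t. KS x (h n) t - KS x g t) \<le> M * test_norm \<alpha> (\<lambda>t. h n t - g t)" for n
    using M[OF x admissible_diff[OF h(1) g]] by (simp add: ks_fun_diff)
  ultimately show ?thesis by (intro LIMSEQ_le) auto
qed

text \<open>The limit \<open>v\<close> of the images exists by completeness.  The definition of the representation also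
  admits approximating sequences that are not admissible; comparing their images with those of \<open>g\<close>
  in norm shows that they have the same limit.\<close>

theorem ks_rep_approx:
  assumes x: "x \<in> SL2R" and g: "\<And>n. admissible x (g n)" and u: "H_approx \<alpha> g u"
  shows "H_approx \<alpha> (\<lambda>n. KS x (g n)) (ks_rep (Complex \<alpha> \<beta>) \<epsilon> x u)"
proof -
  obtain M where M: "M \<ge> 1" "\<And>x f. x \<in> SL2R \<Longrightarrow> admissible x f \<Longrightarrow> test_norm \<alpha> (KS x f) \<le> M * test_norm \<alpha> f"
    using ks_bounded by blast
  obtain v where v: "H_approx \<alpha> (\<lambda>n. KS x (g n)) v" using ks_cauchy[OF x g u] by blast
  have vH: "v \<in> H_space \<alpha>" using v by (auto simp: H_space_def)
  have tg: "\<And>n. distr_of (KS x (g n)) \<in> H_space \<alpha>" by (rule test_in_H_space[OF \<alpha> ks_fun_test[OF x g]])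
  have "ks_rep (Complex \<alpha> \<beta>) \<epsilon> x u = v"
    unfolding ks_rep_def complex.sel
  proof (rule the_equality)
    show "v \<in> H_space \<alpha> \<and> (\<exists>f. H_approx \<alpha> f u \<and> (\<forall>n. distr_of (KS x (f n)) \<in> H_space \<alpha>) \<and>
        (\<lambda>n. H_norm \<alpha> (\<lambda>\<phi>. distr_of (KS x (f n)) \<phi> - v \<phi>)) \<longlonglongrightarrow> 0)"
      using vH u tg H_approx_norm_tendsto[OF \<alpha> v] by blast
  next
    fix v' assume "v' \<in> H_space \<alpha> \<and> (\<exists>f. H_approx \<alpha> f u \<and> (\<forall>n. distr_of (KS x (f n)) \<in> H_space \<alpha>) \<and>
        (\<lambda>n. H_norm \<alpha> (\<lambda>\<phi>. distr_of (KS x (f n)) \<phi> - v' \<phi>)) \<longlonglongrightarrow> 0)"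
    then obtain f where v': "v' \<in> H_space \<alpha>" and f: "H_approx \<alpha> f u" "\<And>n. distr_of (KS x (f n)) \<in> H_space \<alpha>"
        "(\<lambda>n. H_norm \<alpha> (\<lambda>\<phi>. distr_of (KS x (f n)) \<phi> - v' \<phi>)) \<longlonglongrightarrow> 0" by blast
    \<comment> \<open>The triangle inequality along \<open>v'\<close>, \<open>KS x (f n)\<close>, \<open>KS x (g n)\<close> and \<open>v\<close>.\<close>
    define E where "E n = H_norm \<alpha> (\<lambda>\<phi>. distr_of (KS x (f n)) \<phi> - v' \<phi>) + (M * test_norm \<alpha> (\<lambda>t. f n t - g n t) +
         H_norm \<alpha> (\<lambda>\<phi>. distr_of (KS x (g n)) \<phi> - v \<phi>))" for n
    have "H_norm \<alpha> (\<lambda>\<phi>. v' \<phi> - v \<phi>) \<le> E n" for n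
    proof -
      have "H_norm \<alpha> (\<lambda>\<phi>. v' \<phi> - v \<phi>) \<le> H_norm \<alpha> (\<lambda>\<phi>. v' \<phi> - distr_of (KS x (f n)) \<phi>) + H_norm \<alpha> (\<lambda>\<phi>. distr_of (KS x (f n)) \<phi> - v \<phi>)"
        by (rule H_norm_diff_triangle[OF \<alpha> v' f(2) vH])
      also have "H_norm \<alpha> (\<lambda>\<phi>. v' \<phi> - distr_of (KS x (f n)) \<phi>) = H_norm \<alpha> (\<lambda>\<phi>. distr_of (KS x (f n)) \<phi> - v' \<phi>)"
        by (rule H_norm_diff_commute[OF \<alpha> v' f(2)])
      also have "H_norm \<alpha> (\<lambda>\<phi>. distr_of (KS x (f n)) \<phi> - v \<phi>) \<le>
          H_norm \<alpha> (\<lambda>\<phi>. distr_of (KS x (f n)) \<phi> - distr_of (KS x (g n)) \<phi>) + H_norm \<alpha> (\<lambda>\<phi>. distr_of (KS x (g n)) \<phi> - v \<phi>)"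
        by (rule H_norm_diff_triangle[OF \<alpha> f(2) tg vH])
      also have "H_norm \<alpha> (\<lambda>\<phi>. distr_of (KS x (f n)) \<phi> - distr_of (KS x (g n)) \<phi>) \<le> M * test_norm \<alpha> (\<lambda>t. f n t - g n t)"
        by (rule ks_fun_H_norm_le[OF x H_approx_test[OF f(1)] g M(2)])
      finally show ?thesis by (simp add: E_def)
    qed
    moreover have "E \<longlonglongrightarrow> 0 + (M * 0 + 0)"
      unfolding E_def[abs_def]
      by (intro tendsto_add tendsto_mult tendsto_const f(3) H_approx_unique[OF \<alpha> f(1) u] H_approx_norm_tendsto[OF \<alpha> v])
    ultimately have "H_norm \<alpha> (\<lambda>\<phi>. v' \<phi> - v \<phi>) \<le> 0" by (intro LIMSEQ_le_const) auto
    then have "H_norm \<alpha> (\<lambda>\<phi>. v' \<phi> - v \<phi>) = 0" using H_norm_diff_nonneg[OF \<alpha> v' vH] by simp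
    then show "v' = v" by (rule H_norm_diff_eq_0[OF \<alpha> v' vH])
  qed
  with v show ?thesis by simp
qed

lemma admissible_H_approx:
  assumes x: "x \<in> SL2R" and u: "u \<in> H_space \<alpha>"
  obtains g where "\<And>n. admissible x (g n)" "H_approx \<alpha> g u"
proof -
  obtain f where f: "H_approx \<alpha> f u" using u by (auto simp: H_space_def)
  have "\<exists>h. admissible x h \<and> test_norm \<alpha> (\<lambda>t. f n t - h t) < inverse (real (Suc n))" for n
  proof -
    obtain h where h: "\<And>n. admissible x (h n)" "(\<lambda>m. test_norm \<alpha> (\<lambda>t. f n t - h m t)) \<longlonglongrightarrow> 0"
      using ks_fun_H_space[OF x H_approx_test[OF f]] by metis
    have "\<forall>\<^sub>F m in sequentially. test_norm \<alpha> (\<lambda>t. f n t - h m t) < inverse (real (Suc n))"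
      using h(2) by (rule order_tendstoD) simp
    then show ?thesis using h(1) eventually_happens trivial_limit_sequentially by blast
  qed
  then obtain g where g: "\<And>n. admissible x (g n)" "\<And>n. test_norm \<alpha> (\<lambda>t. f n t - g n t) < inverse (real (Suc n))" by metis
  have "(\<lambda>n. test_norm \<alpha> (\<lambda>t. f n t - g n t)) \<longlonglongrightarrow> 0"
    by (rule tendsto_sandwich[OF _ _ tendsto_const LIMSEQ_inverse_real_of_nat])
       (use g(2) test_norm_nonneg in \<open>auto intro!: always_eventually less_imp_le\<close>)
  then have "H_approx \<alpha> g u" by (rule H_approx_perturb[OF \<alpha> f admissible_test[OF g(1)]])
  then show ?thesis using g(1) that by blast
qed

text \<open>A uniform bound passes from admissible test functions to all elements of the completion by taking
  limits of approximating sequences.\<close>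

lemma ub_iff:
  assumes c: "weight B c" and N: "\<And>f. test_fun f \<Longrightarrow> N f = wnorm \<alpha> c f"
  shows "(\<forall>x\<in>SL2R. \<forall>\<xi>\<in>H_space \<alpha>. inverse C * H_extend \<alpha> N \<xi> \<le> H_extend \<alpha> N (ks_rep (Complex \<alpha> \<beta>) \<epsilon> x \<xi>) \<and>
            H_extend \<alpha> N (ks_rep (Complex \<alpha> \<beta>) \<epsilon> x \<xi>) \<le> C * H_extend \<alpha> N \<xi>) \<longleftrightarrow>
         (\<forall>x\<in>SL2R. \<forall>g. admissible x g \<longrightarrow> inverse C * wnorm \<alpha> c g \<le> wnorm \<alpha> c (KS x g) \<and> wnorm \<alpha> c (KS x g) \<le> C * wnorm \<alpha> c g)"
    (is "?L \<longleftrightarrow> ?R")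
proof
  assume L: ?L
  show ?R
  proof (intro ballI allI impI)
    fix x g assume x: "x \<in> SL2R" and g: "admissible x g"
    have const: "H_extend \<alpha> N (distr_of f) = wnorm \<alpha> c f" if "test_fun f" for f
      using H_extend_tendsto[OF \<alpha> c N H_approx_const[OF \<alpha> that]] N[OF that]
      by (intro LIMSEQ_unique[OF _ tendsto_const]) auto
    have "H_approx \<alpha> (\<lambda>n. KS x g) (ks_rep (Complex \<alpha> \<beta>) \<epsilon> x (distr_of g))"
      by (rule ks_rep_approx[OF x g H_approx_const[OF \<alpha> admissible_test[OF g]]])
    from H_approx_same_limit[OF \<alpha> this H_approx_const[OF \<alpha> ks_fun_test[OF x g]]]
    have "ks_rep (Complex \<alpha> \<beta>) \<epsilon> x (distr_of g) = distr_of (KS x g)"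
      using test_norm_zero by simp
    then show "inverse C * wnorm \<alpha> c g \<le> wnorm \<alpha> c (KS x g) \<and> wnorm \<alpha> c (KS x g) \<le> C * wnorm \<alpha> c g"
      using L[rule_format, OF x test_in_H_space[OF \<alpha> admissible_test[OF g]]]
        const[OF admissible_test[OF g]] const[OF ks_fun_test[OF x g]] by simp
  qed
next
  assume R: ?R
  show ?L
  proof (intro ballI)
    fix x \<xi> assume x: "x \<in> SL2R" and \<xi>: "\<xi> \<in> H_space \<alpha>"
    obtain g where g: "\<And>n. admissible x (g n)" "H_approx \<alpha> g \<xi>" using admissible_H_approx[OF x \<xi>] by blast
    have 1: "(\<lambda>n. N (g n)) \<longlonglongrightarrow> H_extend \<alpha> N \<xi>" by (rule H_extend_tendsto[OF \<alpha> c N g(2)])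
    have 2: "(\<lambda>n. N (KS x (g n))) \<longlonglongrightarrow> H_extend \<alpha> N (ks_rep (Complex \<alpha> \<beta>) \<epsilon> x \<xi>)"
      by (rule H_extend_tendsto[OF \<alpha> c N ks_rep_approx[OF x g]])
    have b: "inverse C * N (g n) \<le> N (KS x (g n))" "N (KS x (g n)) \<le> C * N (g n)" for n
      using R x g(1) by (simp_all add: N admissible_test[OF g(1)] ks_fun_test[OF x g(1)])
    show "inverse C * H_extend \<alpha> N \<xi> \<le> H_extend \<alpha> N (ks_rep (Complex \<alpha> \<beta>) \<epsilon> x \<xi>) \<and>
            H_extend \<alpha> N (ks_rep (Complex \<alpha> \<beta>) \<epsilon> x \<xi>) \<le> C * H_extend \<alpha> N \<xi>"
      using LIMSEQ_le[OF tendsto_mult[OF tendsto_const 1] 2] LIMSEQ_le[OF 2 tendsto_mult[OF tendsto_const 1]] b by blast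
  qed
qed

end

section \<open>Weights on the two half-lines\<close>

definition half_weight :: "real \<Rightarrow> real \<Rightarrow> real \<Rightarrow> real" where
  "half_weight a b r = (if r > 0 then a else if r < 0 then b else 0)"

lemma weight_half: "a > 0 \<Longrightarrow> b > 0 \<Longrightarrow> weight (a + b) (half_weight a b)"
  by (auto simp: weight_def half_weight_def[abs_def])

lemma test_norm_ab_wnorm:
  assumes \<alpha>: "\<bar>\<alpha>\<bar> < 1/2" and f: "test_fun f"
  shows "test_norm_ab \<alpha> a b f = wnorm \<alpha> (half_weight a b) f"
proof -
  let ?F = "\<lambda>r. (norm (of_real (\<bar>r\<bar> powr \<alpha>) * fourier f r))\<^sup>2"
  have F: "integrable lborel ?F" by (rule test_weight_integrable[OF \<alpha> f])
  have i: "integrable lborel (\<lambda>r. indicat_real {0<..} r *\<^sub>R ?F r)" "integrable lborel (\<lambda>r. indicat_real {..<0} r *\<^sub>R ?F r)"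
    by (intro integrable_mult_indicator F; simp)+
  have "half_weight a b r * ?F r = a * (indicat_real {0<..} r *\<^sub>R ?F r) + b * (indicat_real {..<0} r *\<^sub>R ?F r)" for r
    by (auto simp: half_weight_def)
  then have "(LINT r|lborel. half_weight a b r * ?F r) =
      a * (LINT r|lborel. indicat_real {0<..} r *\<^sub>R ?F r) + b * (LINT r|lborel. indicat_real {..<0} r *\<^sub>R ?F r)"
    using i by (simp only: Bochner_Integration.integral_add integrable_mult_right integral_mult_right_zero)
  then show ?thesis by (simp add: test_norm_ab_def wnorm_def set_lebesgue_integral_def)
qed

lemma wnorm_reflect: "wnorm \<alpha> c (\<lambda>t. f (- t)) = wnorm \<alpha> (\<lambda>r. c (- r)) f"
proof -
  have "fourier (\<lambda>t. f (- t)) r = fourier f (- r)" for r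
    using fourier_affine[of "-1" f 0 r] by simp
  then show ?thesis
    using lborel_integral_real_affine[of "-1" "\<lambda>r. c r * (norm (of_real (\<bar>r\<bar> powr \<alpha>) * fourier f (- r)))\<^sup>2" 0]
    by (simp add: wnorm_def)
qed

text \<open>Reflection exchanges the two half-lines, so the two weights average to the constant weight.\<close>

lemma wnorm_half_sum:
  assumes \<alpha>: "\<bar>\<alpha>\<bar> < 1/2" and f: "test_fun f" and ab: "a > 0" "b > 0"
  shows "(wnorm \<alpha> (half_weight a b) f)\<^sup>2 + (wnorm \<alpha> (half_weight a b) (\<lambda>t. f (- t)))\<^sup>2 = (a + b) * (test_norm \<alpha> f)\<^sup>2"
proof -
  let ?F = "\<lambda>r. (norm (of_real (\<bar>r\<bar> powr \<alpha>) * fourier f r))\<^sup>2"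
  have w: "weight (a + b) (half_weight a b)" "weight (a + b) (\<lambda>r. half_weight a b (- r))"
    using ab by (auto simp: weight_def half_weight_def[abs_def])
  have "(wnorm \<alpha> (half_weight a b) f)\<^sup>2 + (wnorm \<alpha> (half_weight a b) (\<lambda>t. f (- t)))\<^sup>2 =
      (LINT r|lborel. half_weight a b r * ?F r + half_weight a b (- r) * ?F r)"
    unfolding wnorm_reflect wnorm_sq[OF w(1)] wnorm_sq[OF w(2)]
    by (intro Bochner_Integration.integral_add[symmetric] wnorm_integrable[OF \<alpha> w(1) f] wnorm_integrable[OF \<alpha> w(2) f])
  also have "\<dots> = (LINT r|lborel. (a + b) * ?F r)"
  proof (rule Bochner_Integration.integral_cong[OF refl])
    show "half_weight a b r * ?F r + half_weight a b (- r) * ?F r = (a + b) * ?F r" for r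
      by (cases "r = 0") (auto simp: half_weight_def algebra_simps)
  qed
  also have "\<dots> = (a + b) * (test_norm \<alpha> f)\<^sup>2"
    unfolding test_norm_wnorm wnorm_sq[OF weight_one] by simp
  finally show ?thesis .
qed

text \<open>Conjugation by the diagonal matrix with entries 1 and \<open>-1\<close>, the automorphism that corresponds to the
  reflection \<open>t \<mapsto> - t\<close>.\<close>

definition flip :: "real^2^2 \<Rightarrow> real^2^2" where
  "flip x = vector [vector [x$1$1, - (x$1$2)], vector [- (x$2$1), x$2$2]]"

lemma flip_entries: "flip x$1$1 = x$1$1" "flip x$1$2 = - x$1$2" "flip x$2$1 = - x$2$1" "flip x$2$2 = x$2$2"
  by (simp_all add: flip_def)

lemma flip_SL2R: "x \<in> SL2R \<Longrightarrow> flip x \<in> SL2R"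
  by (simp add: SL2R_def det_2 flip_entries)

lemma ks_fun_flip: "ks_fun s \<epsilon> (flip x) (\<lambda>t. f (- t)) = (\<lambda>t. ks_fun s \<epsilon> x f (- t))"
proof
  fix t
  have "- ((- x$1$2 + x$2$2 * t) / (x$1$1 + - x$2$1 * t)) = (x$1$2 + x$2$2 * - t) / (x$1$1 + x$2$1 * - t)"
    unfolding minus_divide_left by simp
  then show "ks_fun s \<epsilon> (flip x) (\<lambda>t. f (- t)) t = ks_fun s \<epsilon> x f (- t)"
    by (simp add: ks_fun_def flip_entries)
qed

lemma test_fun_reflect: "test_fun f \<Longrightarrow> test_fun (\<lambda>t. f (- t))"
  using test_fun_affine[of f "-1" 0] by simp

lemma admissible_flip:
  assumes "admissible x f" shows "admissible (flip x) (\<lambda>t. f (- t))"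
proof -
  have "vanishes_near (- p) (\<lambda>t. f (- t))" if v: "vanishes_near p f" for p
  proof -
    obtain d where d: "d > 0" "\<And>t. \<bar>t - p\<bar> < d \<Longrightarrow> f t = 0" using v unfolding vanishes_near_def by blast
    have "f (- t) = 0" if "\<bar>t - - p\<bar> < d" for t using that by (intro d(2)) linarith
    with d(1) show ?thesis by (auto simp: vanishes_near_def)
  qed
  then show ?thesis using assms test_fun_reflect by (auto simp: admissible_def flip_entries)
qed

text \<open>The bounds at \<open>x\<close> for \<open>g\<close> and at \<open>flip x\<close> for the reflection of \<open>g\<close> are squared and added.\<close>

lemma weighted_bound_imp_bound:
  assumes \<alpha>: "\<bar>\<alpha>\<bar> < 1/2" and ab: "a > 0" "b > 0" and C: "C > 0"
    and R: "\<forall>x\<in>SL2R. \<forall>g. admissible x g \<longrightarrow> inverse C * wnorm \<alpha> (half_weight a b) g \<le> wnorm \<alpha> (half_weight a b) (ks_fun s \<epsilon> x g) \<and>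
       wnorm \<alpha> (half_weight a b) (ks_fun s \<epsilon> x g) \<le> C * wnorm \<alpha> (half_weight a b) g"
    and x: "x \<in> SL2R" and g: "admissible x g"
  shows "inverse C * test_norm \<alpha> g \<le> test_norm \<alpha> (ks_fun s \<epsilon> x g)" "test_norm \<alpha> (ks_fun s \<epsilon> x g) \<le> C * test_norm \<alpha> g"
proof -
  let ?N = "wnorm \<alpha> (half_weight a b)" and ?h = "ks_fun s \<epsilon> x g"
  note w = weight_half[OF ab]
  have sq: "p\<^sup>2 \<le> c\<^sup>2 * q\<^sup>2" if "p \<le> c * q" "0 \<le> p" for p c q :: real
    using power_mono[OF that, of 2] by (simp add: power_mult_distrib)
  have 1: "inverse C * ?N g \<le> ?N ?h" "?N ?h \<le> C * ?N g" using R x g by auto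
  have 2: "inverse C * ?N (\<lambda>t. g (- t)) \<le> ?N (\<lambda>t. ?h (- t))" "?N (\<lambda>t. ?h (- t)) \<le> C * ?N (\<lambda>t. g (- t))"
    using R flip_SL2R[OF x] admissible_flip[OF g] unfolding ks_fun_flip[symmetric] by auto
  note S = wnorm_half_sum[OF \<alpha> admissible_test[OF g] ab] wnorm_half_sum[OF \<alpha> ks_fun_test[OF x g] ab]
  have le: "p \<le> c * q" if "(a + b) * p\<^sup>2 \<le> c\<^sup>2 * ((a + b) * q\<^sup>2)" "0 \<le> c * q" for p c q :: real
  proof (rule power2_le_imp_le[OF _ that(2)])
    have "(a + b) * p\<^sup>2 \<le> (a + b) * (c * q)\<^sup>2" using that(1) by (simp add: power_mult_distrib mult_ac)
    then show "p\<^sup>2 \<le> (c * q)\<^sup>2" using ab by simp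
  qed
  have "(a + b) * (test_norm \<alpha> ?h)\<^sup>2 \<le> C\<^sup>2 * ((a + b) * (test_norm \<alpha> g)\<^sup>2)"
    unfolding S[symmetric] distrib_left
    by (intro add_mono sq[OF 1(2)] sq[OF 2(2)] wnorm_nonneg[OF w])
  then show "test_norm \<alpha> ?h \<le> C * test_norm \<alpha> g"
    by (rule le) (use C test_norm_nonneg[of \<alpha> g] in simp)
  have "(inverse C)\<^sup>2 * ((a + b) * (test_norm \<alpha> g)\<^sup>2) \<le> (a + b) * (test_norm \<alpha> ?h)\<^sup>2"
  proof -
    have sq': "(inverse C)\<^sup>2 * p\<^sup>2 \<le> q\<^sup>2" if "inverse C * p \<le> q" "0 \<le> p" for p q :: real
      using power_mono[OF that(1), of 2] that(2) C unfolding power_mult_distrib by simp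
    show ?thesis
      unfolding S[symmetric] distrib_left
      by (intro add_mono sq'[OF 1(1)] sq'[OF 2(1)] wnorm_nonneg[OF w])
  qed
  then have "(a + b) * (inverse C * test_norm \<alpha> g)\<^sup>2 \<le> 1\<^sup>2 * ((a + b) * (test_norm \<alpha> ?h)\<^sup>2)"
    by (simp add: power_mult_distrib mult_ac)
  from le[OF this] show "inverse C * test_norm \<alpha> g \<le> test_norm \<alpha> ?h"
    using test_norm_nonneg by simp
qed

section \<open>Sharpness of the multiplier bound\<close>

text \<open>The square of the transform of \<open>\<psi>\<close>, rescaled around \<open>u\<close>, is an approximate identity.  Linear growth
  of \<open>\<mu>\<close> is dominated because \<open>v\<close> times the transform is the transform of the derivative, which is square
  integrable.\<close>

lemma concentration:
  assumes \<psi>: "test_fun \<psi>" and \<mu>: "continuous_on UNIV \<mu>" and growth: "\<And>u. 0 \<le> \<mu> u" "\<And>u. \<mu> u \<le> A * (1 + \<bar>u\<bar>)" and A: "A \<ge> 0"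
  shows "(\<lambda>n. LINT v|lborel. (\<mu> (u + v / real (Suc n)))\<^sup>2 * (norm (fourier \<psi> v))\<^sup>2) \<longlonglongrightarrow>
     (\<mu> u)\<^sup>2 * (LINT v|lborel. (norm (fourier \<psi> v))\<^sup>2)"
proof -
  obtain \<psi>' where \<psi>': "test_fun \<psi>'" and der: "\<And>t. (\<psi> has_vector_derivative \<psi>' t) (at t)"
    using test_fun_has_derivative[OF \<psi>] by blast
  have [measurable]: "fourier \<psi> \<in> borel_measurable borel" "\<mu> \<in> borel_measurable borel"
    using test_fun_integrable[OF \<psi>] borel_measurable_continuous_onI[OF \<mu>] by auto
  note P = plancherel(1)[OF test_fun_nice[OF \<psi>]] plancherel(1)[OF test_fun_nice[OF \<psi>']]
  have d': "(norm (fourier \<psi>' v))\<^sup>2 = v\<^sup>2 * (norm (fourier \<psi> v))\<^sup>2" for v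
    by (simp add: fourier_derivative[OF \<psi> \<psi>' der] norm_mult power_mult_distrib)
  define D where "D = 1 + \<bar>u\<bar>"
  have dom: "(\<mu> (u + v / real (Suc n)))\<^sup>2 \<le> A\<^sup>2 * (2 * D\<^sup>2 + 2 * v\<^sup>2)" for n v
  proof -
    have "\<bar>v / real (Suc n)\<bar> \<le> \<bar>v\<bar>" by (simp add: divide_le_eq mult_le_cancel_left1 abs_divide)
    then have "1 + \<bar>u + v / real (Suc n)\<bar> \<le> D + \<bar>v\<bar>"
      using abs_triangle_ineq[of u "v / real (Suc n)"] unfolding D_def by linarith
    then have "\<mu> (u + v / real (Suc n)) \<le> A * (D + \<bar>v\<bar>)"
      by (rule order_trans[OF growth(2) mult_left_mono[OF _ A]])
    then have "(\<mu> (u + v / real (Suc n)))\<^sup>2 \<le> (A * (D + \<bar>v\<bar>))\<^sup>2" by (intro power_mono growth)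
    also have "\<dots> \<le> A\<^sup>2 * (2 * D\<^sup>2 + 2 * v\<^sup>2)"
      unfolding power_mult_distrib using sum_squares_bound[of D "\<bar>v\<bar>"]
      by (intro mult_left_mono) (auto simp: power2_sum)
    finally show ?thesis .
  qed
  have "(\<lambda>n. LINT v|lborel. (\<mu> (u + v / real (Suc n)))\<^sup>2 * (norm (fourier \<psi> v))\<^sup>2) \<longlonglongrightarrow>
     (LINT v|lborel. (\<mu> u)\<^sup>2 * (norm (fourier \<psi> v))\<^sup>2)"
  proof (rule integral_dominated_convergence)
    show "integrable lborel (\<lambda>v. A\<^sup>2 * (2 * D\<^sup>2 * (norm (fourier \<psi> v))\<^sup>2 + 2 * (norm (fourier \<psi>' v))\<^sup>2))"
      by (intro integrable_mult_right Bochner_Integration.integrable_add P)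
    show "AE v in lborel. norm ((\<mu> (u + v / real (Suc n)))\<^sup>2 * (norm (fourier \<psi> v))\<^sup>2) \<le>
       A\<^sup>2 * (2 * D\<^sup>2 * (norm (fourier \<psi> v))\<^sup>2 + 2 * (norm (fourier \<psi>' v))\<^sup>2)" for n
    proof (rule AE_I2)
      fix v
      have "(\<mu> (u + v / real (Suc n)))\<^sup>2 * (norm (fourier \<psi> v))\<^sup>2 \<le> (A\<^sup>2 * (2 * D\<^sup>2 + 2 * v\<^sup>2)) * (norm (fourier \<psi> v))\<^sup>2"
        by (intro mult_right_mono dom) simp
      also have "\<dots> = A\<^sup>2 * (2 * D\<^sup>2 * (norm (fourier \<psi> v))\<^sup>2 + 2 * (norm (fourier \<psi>' v))\<^sup>2)"
        unfolding d' by (simp add: algebra_simps)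
      finally show "norm ((\<mu> (u + v / real (Suc n)))\<^sup>2 * (norm (fourier \<psi> v))\<^sup>2) \<le>
        A\<^sup>2 * (2 * D\<^sup>2 * (norm (fourier \<psi> v))\<^sup>2 + 2 * (norm (fourier \<psi>' v))\<^sup>2)" by simp
    qed
    have "(\<lambda>n. \<mu> (u + v / real (Suc n))) \<longlonglongrightarrow> \<mu> (u + 0)" for v
      using \<mu> by (intro isCont_tendsto_compose[where g = \<mu>] tendsto_intros LIMSEQ_divide_Suc)
        (simp add: continuous_on_eq_continuous_at)
    then show "AE v in lborel. (\<lambda>n. (\<mu> (u + v / real (Suc n)))\<^sup>2 * (norm (fourier \<psi> v))\<^sup>2) \<longlonglongrightarrow> (\<mu> u)\<^sup>2 * (norm (fourier \<psi> v))\<^sup>2"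
      by (intro AE_I2 tendsto_intros) simp
  qed measurable
  then show ?thesis by simp
qed

text \<open>On one parity, and in the coordinate \<open>x = ln \<bar>t\<bar>\<close>, the function is the oscillation
  \<open>exp (\<i> u0 x)\<close> under the wide envelope \<open>\<psi> (d x)\<close>; its frequency is concentrated near \<open>u0\<close> as \<open>d\<close> tends to 0.\<close>

lemma wave_packet:
  assumes \<psi>: "test_fun \<psi>" and d: "d > 0" and j: "j \<in> {0, 1}"
  obtains f where "test_fun f" "vanishes_near 0 f"
    "logpart (1 - j) \<alpha> f = (\<lambda>x. 0)"
    "\<And>u. norm (fourier (logpart j \<alpha> f) u) = 2 / d * norm (fourier \<psi> ((u - u0) / d))"
proof -
  obtain R where R: "R > 0" "\<And>t. R < \<bar>t\<bar> \<Longrightarrow> \<psi> t = 0" using \<psi> by (meson test_funE)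
  define f where "f t = of_real (sgn t ^ j) * of_real \<bar>t\<bar> powr Complex (\<alpha> - 1/2) u0 * \<psi> (d * ln \<bar>t\<bar>)" for t
  have big: "R < \<bar>d * ln \<bar>t\<bar>\<bar>" if "0 < \<bar>t\<bar>" "\<bar>t\<bar> < exp (- (R / d))" for t
  proof -
    have "ln \<bar>t\<bar> < ln (exp (- (R / d)))" using that by (subst ln_less_cancel_iff) auto
    then have "d * ln \<bar>t\<bar> < - R" using d by (simp add: field_simps)
    then show ?thesis using R(1) by simp
  qed
  have sf: "smooth f"
    unfolding f_def[abs_def]
  proof (rule smooth_singular_power[OF test_fun_smooth[OF \<psi>] R(2) _ big])
    show "((\<lambda>t. d * ln \<bar>t\<bar>) has_real_derivative d * sgn t ^ 1 * \<bar>t\<bar> powr (- 1)) (at t)" if "t \<noteq> 0" for t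
    proof -
      have "d * sgn t ^ 1 * \<bar>t\<bar> powr (- 1) = d * (1 / t)"
        using that by (simp add: powr_minus sgn_if divide_inverse)
      moreover have "((\<lambda>t. ln \<bar>t\<bar>) has_real_derivative 1 / t) (at t)"
      proof (cases "t > 0")
        case True
        have "(ln has_real_derivative 1 / t) (at t)" using True by (auto intro!: derivative_eq_intros)
        then show ?thesis
          by (rule has_field_derivative_transform_within_open[where S = "{0<..}"]) (use True in auto)
      next
        case False
        have "((\<lambda>t. ln (- t)) has_real_derivative 1 / t) (at t)" using False that by (auto intro!: derivative_eq_intros)
        then show ?thesis
          by (rule has_field_derivative_transform_within_open[where S = "{..<0}"]) (use False that in auto)
      qed
      ultimately show ?thesis by (simp only: DERIV_cmult)
    qed
  qed auto
  have f0: "f t = 0" if "exp (R / d) < \<bar>t\<bar>" for t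
  proof -
    have t: "0 < \<bar>t\<bar>" using that exp_gt_zero[of "R / d"] by linarith
    then have "ln (exp (R / d)) < ln \<bar>t\<bar>" using that by (subst ln_less_cancel_iff) auto
    then have "R < d * ln \<bar>t\<bar>" using d by (simp add: field_simps)
    then show ?thesis using R(2)[of "d * ln \<bar>t\<bar>"] by (simp add: f_def)
  qed
  have tf: "test_fun f" by (rule test_funI[OF sf f0])
  have "f t = 0" if "\<bar>t\<bar> < exp (- (R / d))" for t
    using big[OF _ that] R(2)[of "d * ln \<bar>t\<bar>"] by (cases "t = 0") (auto simp: f_def)
  then have v: "vanishes_near 0 f" by (auto simp: vanishes_near_def intro!: exI[of _ "exp (- (R / d))"])
  have pw: "complex_of_real (exp x) powr z = exp (z * of_real x)" for x z
    by (simp add: powr_def Ln_of_real)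
  have fe: "f (exp x) = exp (Complex (\<alpha> - 1/2) u0 * of_real x) * \<psi> (d * x)"
      "f (- exp x) = (-1) ^ j * exp (Complex (\<alpha> - 1/2) u0 * of_real x) * \<psi> (d * x)" for x
    unfolding f_def abs_minus_cancel abs_exp_cancel pw by simp_all
  have osc: "of_real (exp (x * (1/2 - \<alpha>))) * exp (Complex (\<alpha> - 1/2) u0 * of_real x) = exp (\<i> * of_real (u0 * x))" for x
    unfolding exp_of_real[symmetric] exp_add[symmetric]
    by (rule arg_cong[of _ _ exp]) (simp add: complex_eq_iff algebra_simps)
  have lp: "logpart k \<alpha> f x = (1 + (-1) ^ k * (-1) ^ j) * (exp (\<i> * of_real (u0 * x)) * \<psi> (d * x + 0))" for k x
    unfolding logpart_def fe osc[symmetric] by (simp add: algebra_simps)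
  have "logpart (1 - j) \<alpha> f = (\<lambda>x. 0)" using j by (auto simp: lp fun_eq_iff)
  moreover have "norm (fourier (logpart j \<alpha> f) u) = 2 / d * norm (fourier \<psi> ((u - u0) / d))" for u
  proof -
    have "logpart j \<alpha> f = (\<lambda>x. 2 * (exp (\<i> * of_real (u0 * x)) * \<psi> (d * x + 0)))"
      using j by (auto simp: lp fun_eq_iff)
    moreover have "fourier (\<lambda>x. exp (\<i> * of_real (u0 * x)) * \<psi> (d * x + 0)) u = fourier (\<lambda>x. \<psi> (d * x + 0)) (u - u0)"
      unfolding fourier_def
    proof (rule Bochner_Integration.integral_cong[OF refl])
      fix x
      have "exp (\<i> * of_real (u0 * x)) * exp (- (\<i> * of_real x * of_real u)) = exp (- (\<i> * of_real x * of_real (u - u0)))"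
        by (simp add: algebra_simps flip: exp_add)
      then show "exp (\<i> * of_real (u0 * x)) * \<psi> (d * x + 0) * exp (- (\<i> * of_real x * of_real u)) =
         \<psi> (d * x + 0) * exp (- (\<i> * of_real x * of_real (u - u0)))"
        by (metis mult.assoc mult.commute)
    qed
    ultimately show ?thesis
      using d by (simp only: fourier_cmult fourier_affine) (simp add: fourier_affine[of d \<psi> 0, simplified] norm_mult norm_divide)
  qed
  ultimately show ?thesis using that tf v by blast
qed

lemma nonzero_test:
  assumes \<alpha>: "\<bar>\<alpha>\<bar> < 1/2"
  obtains g where "test_fun g" "vanishes_near 0 g" "test_norm \<alpha> g > 0"
proof -
  obtain w :: "real \<Rightarrow> real" where w: "test_fun (\<lambda>t. of_real (w t))" "\<And>t. \<bar>t\<bar> \<le> 1 \<Longrightarrow> w t = 1" "\<And>t. 3 < \<bar>t\<bar> \<Longrightarrow> w t = 0"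
    using plateau_exists by blast
  define g where "g t = complex_of_real (w (1 * t + (- 5)))" for t
  have g: "test_fun g" unfolding g_def[abs_def] by (rule test_fun_affine[OF w(1)]) simp
  have v: "vanishes_near 0 g" unfolding vanishes_near_def by (rule exI[of _ 1]) (auto simp: g_def intro!: w(3))
  have "test_norm \<alpha> g \<noteq> 0"
  proof
    assume z: "test_norm \<alpha> g = 0"
    have "distr_of g g = 0"
    proof -
      obtain C where "\<And>f. test_fun f \<Longrightarrow> norm (distr_of f g) \<le> C * test_norm \<alpha> f" using distr_of_bound[OF \<alpha>] by blast
      from this[OF g] show ?thesis using z by simp
    qed
    then have "complex_of_real (LINT t|lborel. (w (t - 5))\<^sup>2) = 0"
      unfolding integral_complex_of_real[symmetric] using g by (simp add: distr_of_def g_def power2_eq_square)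
    then have "(LINT t|lborel. (w (t - 5))\<^sup>2) = 0" by (simp only: of_real_eq_0_iff)
    then have "(LINT t|lborel. (norm (complex_of_real (w t)))\<^sup>2) = 0"
      using lborel_integral_real_affine[of 1 "\<lambda>t. (w t)\<^sup>2" "- 5"] by simp
    moreover have "0 < (LINT t|lborel. (norm (complex_of_real (w t)))\<^sup>2)"
      by (rule plateau_norm_positive[OF w(1)]) (simp add: w(2))
    ultimately show False by simp
  qed
  then show ?thesis using that g v test_norm_nonneg[of \<alpha> g] by simp
qed

context
  fixes \<alpha> \<beta> :: real and \<epsilon> :: nat
  assumes \<alpha>: "\<bar>\<alpha>\<bar> < 1/2" and \<epsilon>: "\<epsilon> \<in> {0, 1}"
begin

text \<open>Apply the bound to wave packets of parity \<open>j\<close> around \<open>u\<close> with \<open>d = 1 / (n + 1)\<close>.  Both norms are given by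
  the Mellin formula, and as \<open>n\<close> grows they concentrate on the values of the multipliers at \<open>2 \<beta> - u\<close>
  and at \<open>u\<close>.\<close>

lemma bound_imp_q_bound:
  assumes C: "C \<ge> 0"
    and W: "\<And>g. test_fun g \<Longrightarrow> vanishes_near 0 g \<Longrightarrow> test_norm \<alpha> (inversion (Complex \<alpha> \<beta>) \<epsilon> g) \<le> C * test_norm \<alpha> g"
    and k: "k \<in> {0, 1}" and j: "j = (if k = 0 then \<epsilon> else 1 - \<epsilon>)"
  shows "abs_m k \<alpha> (2 * \<beta> - u) \<le> C * abs_m j \<alpha> u"
proof -
  have j1: "j \<in> {0, 1}" using j \<epsilon> k by auto
  obtain B :: "real \<Rightarrow> real" where B: "test_fun (\<lambda>t. of_real (B t))" "\<And>t. \<bar>t\<bar> \<le> 1 \<Longrightarrow> B t = 1"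
    using plateau_exists by metis
  let ?\<psi> = "\<lambda>t. complex_of_real (B t)"
  define P where "P = (LINT v|lborel. (norm (fourier ?\<psi> v))\<^sup>2)"
  have "P > 0"
    unfolding P_def plancherel(2)[OF test_fun_nice[OF B(1)]]
    using plateau_norm_positive[OF B(1)] B(2) by simp
  obtain A where A: "A > 0" "\<And>u. abs_m k \<alpha> u \<le> A * (1 + \<bar>u\<bar>)" using abs_m_growth[OF \<alpha> k] by blast
  obtain A' where A': "A' > 0" "\<And>u. abs_m j \<alpha> u \<le> A' * (1 + \<bar>u\<bar>)" using abs_m_growth[OF \<alpha> j1] by blast
  have m0: "0 \<le> abs_m k \<alpha> u" for k u by (simp add: abs_m_def)
  have A2: "abs_m k \<alpha> (2 * \<beta> - u) \<le> (A * (1 + \<bar>2 * \<beta>\<bar>)) * (1 + \<bar>u\<bar>)" for u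
  proof -
    have "A * (1 + \<bar>2 * \<beta> - u\<bar>) \<le> A * ((1 + \<bar>2 * \<beta>\<bar>) * (1 + \<bar>u\<bar>))"
    proof (intro mult_left_mono)
      have "0 \<le> \<bar>2 * \<beta>\<bar> * \<bar>u\<bar>" by simp
      moreover have "\<bar>2 * \<beta> - u\<bar> \<le> \<bar>2 * \<beta>\<bar> + \<bar>u\<bar>" by (rule abs_triangle_ineq4)
      moreover have "(1 + \<bar>2 * \<beta>\<bar>) * (1 + \<bar>u\<bar>) = 1 + \<bar>2 * \<beta>\<bar> + \<bar>u\<bar> + \<bar>2 * \<beta>\<bar> * \<bar>u\<bar>"
        by (simp only: distrib_left distrib_right mult_1_left mult_1_right add_ac)
      ultimately show "1 + \<bar>2 * \<beta> - u\<bar> \<le> (1 + \<bar>2 * \<beta>\<bar>) * (1 + \<bar>u\<bar>)" by linarith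
    qed (use A in simp)
    with A(2)[of "2 * \<beta> - u"] show ?thesis by (simp add: mult.assoc)
  qed
  have ck: "continuous_on UNIV (\<lambda>u. abs_m k \<alpha> (2 * \<beta> - u))"
    by (intro continuous_on_compose2[OF abs_m_continuous[OF \<alpha> k]] continuous_intros) auto
  have cont: "continuous_on UNIV (abs_m j \<alpha>)" by (rule abs_m_continuous[OF \<alpha> j1])
  define I1 where "I1 n = (LINT v|lborel. (abs_m k \<alpha> (2 * \<beta> - (u + v / real (Suc n))))\<^sup>2 * (norm (fourier ?\<psi> v))\<^sup>2)" for n
  define I2 where "I2 n = (LINT v|lborel. (abs_m j \<alpha> (u + v / real (Suc n)))\<^sup>2 * (norm (fourier ?\<psi> v))\<^sup>2)" for n
  have l1: "I1 \<longlonglongrightarrow> (abs_m k \<alpha> (2 * \<beta> - u))\<^sup>2 * P"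
    unfolding I1_def[abs_def] P_def by (rule concentration[OF B(1) ck m0 A2]) (use A in simp)
  have l2: "I2 \<longlonglongrightarrow> (abs_m j \<alpha> u)\<^sup>2 * P"
    unfolding I2_def[abs_def] P_def by (rule concentration[OF B(1) cont m0 A'(2)]) (use A' in simp)
  have "I1 n \<le> C\<^sup>2 * I2 n" for n
  proof -
    define d where "d = 1 / real (Suc n)"
    have d: "d > 0" by (simp add: d_def)
    obtain f where f: "test_fun f" "vanishes_near 0 f" "logpart (1 - j) \<alpha> f = (\<lambda>x. 0)"
      and ff: "\<And>v. norm (fourier (logpart j \<alpha> f) v) = 2 / d * norm (fourier ?\<psi> ((v - u) / d))"
      using wave_packet[OF B(1) d j1, of \<alpha> u] by blast
    have z: "fourier (logpart (1 - j) \<alpha> f) v = 0" for v unfolding f(3) fourier_def by simp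
    have resc: "(LINT v|lborel. (m v * norm (fourier (logpart j \<alpha> f) v))\<^sup>2) =
        4 / d * (LINT v|lborel. (m (u + v / real (Suc n)))\<^sup>2 * (norm (fourier ?\<psi> v))\<^sup>2)" for m :: "real \<Rightarrow> real"
    proof -
      have pt: "(m (u + d * v) * norm (fourier (logpart j \<alpha> f) (u + d * v)))\<^sup>2 =
          (2 / d)\<^sup>2 * ((m (u + v / real (Suc n)))\<^sup>2 * (norm (fourier ?\<psi> v))\<^sup>2)" for v
      proof -
        have "norm (fourier (logpart j \<alpha> f) (u + d * v)) = 2 / d * norm (fourier ?\<psi> v)"
          using ff[of "u + d * v"] d by simp
        moreover have "m (u + d * v) = m (u + v / real (Suc n))" by (simp add: d_def)
        ultimately show ?thesis by (simp only: power_mult_distrib mult_ac)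
      qed
      have "(LINT v|lborel. (m v * norm (fourier (logpart j \<alpha> f) v))\<^sup>2) =
         \<bar>d\<bar> *\<^sub>R (LINT v|lborel. (m (u + d * v) * norm (fourier (logpart j \<alpha> f) (u + d * v)))\<^sup>2)"
        by (rule lborel_integral_real_affine) (use d in simp)
      then show ?thesis unfolding pt using d by (simp add: power2_eq_square)
    qed
    have lhs: "(test_norm \<alpha> (inversion (Complex \<alpha> \<beta>) \<epsilon> f))\<^sup>2 = 1 / (4 * pi) * (4 / d * I1 n)"
    proof -
      note S = inversion_norm_sq(3)[OF \<alpha> \<epsilon> f(1,2), of \<beta>]
      consider "k = 0" | "k = 1" using k by auto
      then show ?thesis
      proof cases
        case 1
        then have "j = \<epsilon>" using j by simp
        then show ?thesis using S z resc[of "\<lambda>v. abs_m k \<alpha> (2 * \<beta> - v)"] 1 by (simp add: I1_def)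
      next
        case 2
        then have "1 - \<epsilon> = j" "\<epsilon> = 1 - j" using j \<epsilon> by auto
        then show ?thesis using S z resc[of "\<lambda>v. abs_m k \<alpha> (2 * \<beta> - v)"] 2 by (simp add: I1_def)
      qed
    qed
    have rhs: "(test_norm \<alpha> f)\<^sup>2 = 1 / (4 * pi) * (4 / d * I2 n)"
    proof -
      note S = mellin_plancherel(2)[OF \<alpha> f(1)]
      consider "j = 0" | "j = 1" using j1 by auto
      then show ?thesis
      proof cases
        case 1
        show ?thesis using S z resc[of "abs_m j \<alpha>"] unfolding 1 I2_def by simp
      next
        case 2
        show ?thesis using S z resc[of "abs_m j \<alpha>"] unfolding 2 I2_def by simp
      qed
    qed
    have "(test_norm \<alpha> (inversion (Complex \<alpha> \<beta>) \<epsilon> f))\<^sup>2 \<le> (C * test_norm \<alpha> f)\<^sup>2"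
      by (intro power_mono W f test_norm_nonneg)
    then have "1 / (4 * pi) * (4 / d) * I1 n \<le> 1 / (4 * pi) * (4 / d) * (C\<^sup>2 * I2 n)"
      unfolding power_mult_distrib lhs rhs by (simp only: mult_ac)
    moreover have "0 < 1 / (4 * pi) * (4 / d)" using d by simp
    ultimately show ?thesis by (simp only: mult_le_cancel_left_pos)
  qed
  then have "(abs_m k \<alpha> (2 * \<beta> - u))\<^sup>2 * P \<le> C\<^sup>2 * ((abs_m j \<alpha> u)\<^sup>2 * P)"
    by (intro LIMSEQ_le[OF l1 tendsto_mult[OF tendsto_const l2]]) auto
  then have "(abs_m k \<alpha> (2 * \<beta> - u))\<^sup>2 \<le> (C * abs_m j \<alpha> u)\<^sup>2"
    using \<open>P > 0\<close> by (simp add: power_mult_distrib mult.assoc[symmetric])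
  then show ?thesis by (rule power2_le_imp_le) (use C m0 in simp)
qed

lemma q_measurable: "(\<lambda>u. ereal (norm (q0 \<alpha> \<beta> \<epsilon> u))) \<in> borel_measurable lborel" "(\<lambda>u. ereal (norm (q1 \<alpha> \<beta> \<epsilon> u))) \<in> borel_measurable lborel"
proof -
  have e: "1 - \<epsilon> \<in> {0, 1}" using \<epsilon> by auto
  have m: "(\<lambda>u. abs_m k \<alpha> (g u)) \<in> borel_measurable lborel"
    if "k \<in> {0, 1}" "g \<in> borel_measurable lborel" for k and g :: "real \<Rightarrow> real"
    using measurable_compose[OF that(2) borel_measurable_continuous_onI[OF abs_m_continuous[OF \<alpha> that(1)]]] .
  show "(\<lambda>u. ereal (norm (q0 \<alpha> \<beta> \<epsilon> u))) \<in> borel_measurable lborel"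
    unfolding norm_q0 by (intro borel_measurable_ereal borel_measurable_divide m \<epsilon>) auto
  show "(\<lambda>u. ereal (norm (q1 \<alpha> \<beta> \<epsilon> u))) \<in> borel_measurable lborel"
    unfolding norm_q1 by (intro borel_measurable_ereal borel_measurable_divide m e) auto
qed

end

section \<open>The uniform bound\<close>

theorem corollary4p4:
  fixes \<alpha> \<beta> a b :: real and \<epsilon> :: nat
  assumes "\<bar>\<alpha>\<bar> < 1/2"
    and "\<epsilon> \<in> {0, 1}"
    and "a > 0" and "b > 0"
  shows "ub_norm SL2R (H_space \<alpha>) (H_norm_ab \<alpha> a b) (ks_rep (Complex \<alpha> \<beta>) \<epsilon>)
           \<ge> ub_norm SL2R (H_space \<alpha>) (H_norm \<alpha>) (ks_rep (Complex \<alpha> \<beta>) \<epsilon>) \<and>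
         ub_norm SL2R (H_space \<alpha>) (H_norm \<alpha>) (ks_rep (Complex \<alpha> \<beta>) \<epsilon>)
           = max (Linf_norm (q0 \<alpha> \<beta> \<epsilon>)) (Linf_norm (q1 \<alpha> \<beta> \<epsilon>))"
proof -
  note \<alpha> = assms(1) and \<epsilon> = assms(2)
  let ?T = "ks_fun (Complex \<alpha> \<beta>) \<epsilon>"
  define S where "S = {C. 1 \<le> C \<and> (\<forall>x\<in>SL2R. \<forall>g. admissible x g \<longrightarrow>
      inverse C * test_norm \<alpha> g \<le> test_norm \<alpha> (?T x g) \<and> test_norm \<alpha> (?T x g) \<le> C * test_norm \<alpha> g)}"
  define S' where "S' = {C. 1 \<le> C \<and> (\<forall>x\<in>SL2R. \<forall>g. admissible x g \<longrightarrow>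
      inverse C * wnorm \<alpha> (half_weight a b) g \<le> wnorm \<alpha> (half_weight a b) (?T x g) \<and>
      wnorm \<alpha> (half_weight a b) (?T x g) \<le> C * wnorm \<alpha> (half_weight a b) g)}"
  have ub: "ub_norm SL2R (H_space \<alpha>) (H_norm \<alpha>) (ks_rep (Complex \<alpha> \<beta>) \<epsilon>) = Inf (ereal ` S)"
    unfolding ub_norm_def S_def H_norm_def
    by (subst ub_iff[OF \<alpha> \<epsilon> weight_one]) (simp_all add: test_norm_wnorm)
  have ub': "ub_norm SL2R (H_space \<alpha>) (H_norm_ab \<alpha> a b) (ks_rep (Complex \<alpha> \<beta>) \<epsilon>) = Inf (ereal ` S')"
    unfolding ub_norm_def S'_def H_norm_ab_def
    by (subst ub_iff[OF \<alpha> \<epsilon> weight_half[OF assms(3,4)]]) (simp_all add: test_norm_ab_wnorm[OF \<alpha>])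
  have "S' \<subseteq> S"
    unfolding S_def S'_def
    using weighted_bound_imp_bound[OF \<alpha> assms(3,4)] by (auto 0 3 simp del: inverse_eq_divide)
  then have first: "Inf (ereal ` S) \<le> Inf (ereal ` S')" by (intro Inf_superset_mono image_mono)
  have e: "1 - \<epsilon> \<in> {0, 1}" using \<epsilon> by auto
  let ?m = "max (Linf_norm (q0 \<alpha> \<beta> \<epsilon>)) (Linf_norm (q1 \<alpha> \<beta> \<epsilon>))"
  have lower: "?m \<le> ereal C" if "C \<in> S" for C
  proof -
    have C: "C \<ge> 1" using that by (simp add: S_def)
    \<comment> \<open>The matrix of the inversion.\<close>
    define x :: "real^2^2" where "x = vector [vector [0, -1], vector [1, 0]]"
    have xe: "x$1$1 = 0" "x$1$2 = -1" "x$2$1 = 1" "x$2$2 = 0" by (simp_all add: x_def)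
    have x: "x \<in> SL2R" by (simp add: SL2R_def det_2 xe)
    have Tx: "?T x g = inversion (Complex \<alpha> \<beta>) \<epsilon> g" for g by (simp add: ks_fun_def inversion_def xe fun_eq_iff)
    have W: "test_norm \<alpha> (inversion (Complex \<alpha> \<beta>) \<epsilon> g) \<le> C * test_norm \<alpha> g" if "test_fun g" "vanishes_near 0 g" for g
      using \<open>C \<in> S\<close> x that unfolding S_def by (auto simp: admissible_def xe Tx)
    have C0: "C \<ge> 0" using C by simp
    have "norm (q0 \<alpha> \<beta> \<epsilon> u) \<le> C" "norm (q1 \<alpha> \<beta> \<epsilon> u) \<le> C" for u
      using bound_imp_q_bound[OF \<alpha> \<epsilon> C0 W, of 0 \<epsilon> u] bound_imp_q_bound[OF \<alpha> \<epsilon> C0 W, of 1 "1 - \<epsilon>" u]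
        abs_m_pos[OF \<alpha> \<epsilon>, of u] abs_m_pos[OF \<alpha> e, of u]
      by (simp_all add: norm_q0 norm_q1 divide_le_eq)
    then show ?thesis
      unfolding Linf_norm_def by (intro max.boundedI esssup_I q_measurable[OF \<alpha> \<epsilon>] AE_I2) auto
  qed
  obtain M where M: "\<And>u. norm (q0 \<alpha> \<beta> \<epsilon> u) \<le> M" "\<And>u. norm (q1 \<alpha> \<beta> \<epsilon> u) \<le> M"
    using q_bounded[OF \<alpha> \<epsilon>] by blast
  have le: "?m \<le> ereal M"
    unfolding Linf_norm_def using M by (intro max.boundedI esssup_I q_measurable[OF \<alpha> \<epsilon>] AE_I2) auto
  have ae0: "AE u in lborel. ereal (norm (q0 \<alpha> \<beta> \<epsilon> u)) \<le> ?m"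
    unfolding Linf_norm_def
    by (rule eventually_mono[OF esssup_AE[where M = lborel and f = "\<lambda>u. ereal (norm (q0 \<alpha> \<beta> \<epsilon> u))"]])
       (simp add: le_max_iff_disj)
  have ae1: "AE u in lborel. ereal (norm (q1 \<alpha> \<beta> \<epsilon> u)) \<le> ?m"
    unfolding Linf_norm_def
    by (rule eventually_mono[OF esssup_AE[where M = lborel and f = "\<lambda>u. ereal (norm (q1 \<alpha> \<beta> \<epsilon> u))"]])
       (simp add: le_max_iff_disj)
  note ae = ae0 ae1
  have "\<exists>u. ereal (norm (q0 \<alpha> \<beta> \<epsilon> u)) \<le> ?m"
    by (rule eventually_happens'[OF _ ae(1)]) (simp add: ae_filter_eq_bot_iff)
  then have "0 \<le> ?m" by (meson ereal_less_eq(5) norm_ge_zero order_trans)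
  with le obtain m where m: "?m = ereal m" "0 \<le> m" by (cases ?m) auto
  have ae': "AE u in lborel. norm (q0 \<alpha> \<beta> \<epsilon> u) \<le> m" "AE u in lborel. norm (q1 \<alpha> \<beta> \<epsilon> u) \<le> m"
    using ae unfolding m by simp_all
  \<comment> \<open>The uniform bound only ranges over constants from 1 on; that \<open>m\<close> is one of them follows from applying the inversion twice to a function of nonzero norm.\<close>
  have m1: "m \<ge> 1"
  proof -
    obtain g where g: "test_fun g" "vanishes_near 0 g" "test_norm \<alpha> g > 0" using nonzero_test[OF \<alpha>] by blast
    have "test_norm \<alpha> g \<le> m * (m * test_norm \<alpha> g)"
      by (rule order_trans[OF inversion_norm_ge[OF \<alpha> \<epsilon> g(1,2) m(2) ae'] mult_left_mono[OF inversion_norm_le[OF \<alpha> \<epsilon> g(1,2) m(2) ae'] m(2)]])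
    then have "1 * test_norm \<alpha> g \<le> m\<^sup>2 * test_norm \<alpha> g" by (simp add: power2_eq_square mult.assoc)
    then have "1 \<le> m\<^sup>2" using g(3) by simp
    then show ?thesis using m(2) by (metis abs_of_nonneg one_le_power power2_le_imp_le power_one)
  qed
  have "m \<in> S"
  proof -
    have "inverse m * test_norm \<alpha> g \<le> test_norm \<alpha> (?T x g)" if "x \<in> SL2R" "admissible x g" for x g
      using ks_norm_bounds(2)[OF \<alpha> \<epsilon> that m1 ae'] m1 by (simp add: field_simps)
    then show ?thesis
      unfolding S_def using m1 ks_norm_bounds(1)[OF \<alpha> \<epsilon> _ _ m1 ae'] by auto
  qed
  then have "Inf (ereal ` S) = ?m"
    using lower by (intro antisym Inf_greatest) (auto simp: m intro: Inf_lower)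
  with first show ?thesis unfolding ub ub' by simp
qed

end
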